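(* Let $A$ be any commutative unital ring and let $k[S(2)]$ be the Hopf algebra of the constant group scheme over $A$ of the symmetric group $S(2)$ on two elements. There is an isomorphism of Hopf algebras $k[S(2)]\cong A[z]/(z(1-z))$, where $A[z]/(z(1-z))$ has comultiplication $\Delta$, coinversion $S$ and counit $\epsilon$ given by $$\Delta(z)=1+2(z\otimes z)-1\otimes z-z\otimes 1,\qquad S(z)=z,\qquad \epsilon(z)=1 .$$ Hence, for the diagonal torus $T$ and its schematic normalizer $N$ in $\mathrm{GL}_{2,A}$, the group scheme $N/T$ is the constant group scheme of the Weyl group $W_G=S(2)$ of $\mathrm{GL}_{2,A}$.
   Context: $k[X]$ denotes the coordinate ring over $A$ of an affine $A$-scheme $X$. Let $D=x_{11}x_{22}-x_{12}x_{21}$ and $G=\mathrm{GL}_{2,A}=\mathrm{Spec}(A[x_{ij},1/D])$ with the usual Hopf algebra structure. Put $I_1=(x_{12},x_{21})$, $I_2=(x_{11},x_{22})$; $T=\mathrm{Spec}(k[G]/I_1)$ is the diagonal torus and $N=\mathrm{Spec}(k[G]/I_1I_2)$ its schematic normalizer. With $\sigma_T:k[N]\to k[N]\otimes_Ak[T]$ the comodule map corresponding to right multiplication $N\times T\to N$, set $k[N/T]=\{x\in k[N]:\sigma_T(x)=x\otimes1\}$ with Hopf algebra structure induced from $k[N]$, and $N/T=\mathrm{Spec}(k[N/T])$. The Weyl group $W_G$ of $\mathrm{GL}_{2,A}$ is the symmetric group $S(2)$ on two elements. *)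

theory Defs
  imports "HOL-Algebra.UnivPoly" "HOL-Algebra.QuotRing" "HOL-Algebra.Ideal_Product"
    "HOL-Algebra.Sym_Groups"
begin

text \<open>
  Algebras over a commutative ring \<open>A\<close> are rendered by the locale \<^locale>\<open>algebra\<close>. Working with
  carriers (rather than type classes) allows \<open>A\<close> to be the zero ring.
\<close>


section \<open>Algebras and their quotients\<close>

definition alg_hom ::
  "('a, 'm) ring_scheme \<Rightarrow> ('a, 'b, 'n) module_scheme \<Rightarrow> ('a, 'c, 'p) module_scheme \<Rightarrow> ('b \<Rightarrow> 'c) set"
  where "alg_hom A B C =
    {f \<in> ring_hom B C. \<forall>a \<in> carrier A. \<forall>b \<in> carrier B. f (a \<odot>\<^bsub>B\<^esub> b) = a \<odot>\<^bsub>C\<^esub> f b}"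

definition base_alg :: "('a, 'm) ring_scheme \<Rightarrow> ('a, 'a) module"
  where "base_alg A = \<lparr>carrier = carrier A, monoid.mult = monoid.mult A, one = \<one>\<^bsub>A\<^esub>,
    zero = \<zero>\<^bsub>A\<^esub>, add = add A, smult = monoid.mult A\<rparr>"

definition quot_alg :: "('a, 'b, 'n) module_scheme \<Rightarrow> 'b set \<Rightarrow> ('a, 'b set) module"
  where "quot_alg B I = \<lparr>carrier = carrier (B Quot I), monoid.mult = monoid.mult (B Quot I),
    one = \<one>\<^bsub>B Quot I\<^esub>, zero = \<zero>\<^bsub>B Quot I\<^esub>, add = add (B Quot I),
    smult = (\<lambda>a X. \<Union>x\<in>X. I +>\<^bsub>B\<^esub> (a \<odot>\<^bsub>B\<^esub> x))\<rparr>"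

text \<open>
  The map on cosets induced by a map \<open>f\<close> that is constant on each coset.
\<close>

definition quot_lift :: "('b \<Rightarrow> 'c) \<Rightarrow> 'b set \<Rightarrow> 'c"
  where "quot_lift f X = the_elem (f ` X)"


section \<open>Monoid algebras and multivariate polynomials\<close>

definition mon_alg :: "('a, 'm) ring_scheme \<Rightarrow> ('k, 'n) monoid_scheme \<Rightarrow> ('a, 'k \<Rightarrow> 'a) module"
  where "mon_alg A M = \<lparr>
    carrier = {f. (\<forall>m \<in> carrier M. f m \<in> carrier A) \<and> (\<forall>m. m \<notin> carrier M \<longrightarrow> f m = \<zero>\<^bsub>A\<^esub>) \<and>
      finite {m. f m \<noteq> \<zero>\<^bsub>A\<^esub>}},
    monoid.mult = (\<lambda>f g m. \<Oplus>\<^bsub>A\<^esub>p \<in> {(u, v). f u \<noteq> \<zero>\<^bsub>A\<^esub> \<and> g v \<noteq> \<zero>\<^bsub>A\<^esub> \<and> u \<otimes>\<^bsub>M\<^esub> v = m}.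
      f (fst p) \<otimes>\<^bsub>A\<^esub> g (snd p)),
    one = (\<lambda>m. if m = \<one>\<^bsub>M\<^esub> then \<one>\<^bsub>A\<^esub> else \<zero>\<^bsub>A\<^esub>),
    zero = (\<lambda>m. \<zero>\<^bsub>A\<^esub>),
    add = (\<lambda>f g m. f m \<oplus>\<^bsub>A\<^esub> g m),
    smult = (\<lambda>a f m. a \<otimes>\<^bsub>A\<^esub> f m)\<rparr>"

definition mon_basis :: "('a, 'm) ring_scheme \<Rightarrow> 'k \<Rightarrow> 'k \<Rightarrow> 'a"
  where "mon_basis A u = (\<lambda>m. if m = u then \<one>\<^bsub>A\<^esub> else \<zero>\<^bsub>A\<^esub>)"

text \<open>The \<open>A\<close>-linear extension of a map \<open>h\<close> given on the basis elements.\<close>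

definition mon_eval ::
  "('a, 'm) ring_scheme \<Rightarrow> ('a, 'b, 'n) module_scheme \<Rightarrow> ('k \<Rightarrow> 'b) \<Rightarrow> ('k \<Rightarrow> 'a) \<Rightarrow> 'b"
  where "mon_eval A E h f = (\<Oplus>\<^bsub>E\<^esub>m \<in> {m. f m \<noteq> \<zero>\<^bsub>A\<^esub>}. f m \<odot>\<^bsub>E\<^esub> h m)"

definition exponents :: "('v \<Rightarrow> nat) monoid"
  where "exponents = \<lparr>carrier = {e. finite {v. e v \<noteq> 0}},
    monoid.mult = (\<lambda>e e' v. e v + e' v), one = (\<lambda>v. 0)\<rparr>"

definition mpoly :: "('a, 'm) ring_scheme \<Rightarrow> ('a, ('v \<Rightarrow> nat) \<Rightarrow> 'a) module"
  where "mpoly A = mon_alg A exponents"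

definition mvar :: "('a, 'm) ring_scheme \<Rightarrow> 'v \<Rightarrow> ('v \<Rightarrow> nat) \<Rightarrow> 'a"
  where "mvar A v = mon_basis A (\<lambda>w. if w = v then 1 else 0)"

definition mpoly_eval ::
  "('a, 'm) ring_scheme \<Rightarrow> ('a, 'b, 'n) module_scheme \<Rightarrow> ('v \<Rightarrow> 'b) \<Rightarrow> (('v \<Rightarrow> nat) \<Rightarrow> 'a) \<Rightarrow> 'b"
  where "mpoly_eval A E s =
    mon_eval A E (\<lambda>e. \<Otimes>\<^bsub>E\<^esub>v \<in> {v. e v \<noteq> 0}. s v [^]\<^bsub>E\<^esub> e v)"


section \<open>Tensor products of algebras\<close>

text \<open>
  \<open>B \<otimes>\<^sub>A C\<close> is the free \<open>A\<close>-module on the set \<open>B \<times> C\<close> modulo the bilinearity relations. The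
  multiplication is \<open>(b, c) (b', c') = (b b', c c')\<close> on basis elements, so the free module is the
  monoid algebra of the multiplicative monoid \<open>B \<times> C\<close>; the product of a relation
  with a basis element is again a relation, so the \<open>A\<close>-submodule spanned by the relations is the
  ideal they generate.
\<close>

definition tensor_free ::
  "('a, 'm) ring_scheme \<Rightarrow> ('a, 'b, 'n) module_scheme \<Rightarrow> ('a, 'c, 'p) module_scheme \<Rightarrow>
    ('a, 'b \<times> 'c \<Rightarrow> 'a) module"
  where "tensor_free A B C = mon_alg A (B \<times>\<times> C)"

definition tensor_rel ::
  "('a, 'm) ring_scheme \<Rightarrow> ('a, 'b, 'n) module_scheme \<Rightarrow> ('a, 'c, 'p) module_scheme \<Rightarrow>
    ('b \<times> 'c \<Rightarrow> 'a) set"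
  where "tensor_rel A B C = (let F = tensor_free A B C; d = (\<lambda>b c. mon_basis A (b, c)) in
      {d (b \<oplus>\<^bsub>B\<^esub> b') c \<ominus>\<^bsub>F\<^esub> (d b c \<oplus>\<^bsub>F\<^esub> d b' c) | b b' c.
        b \<in> carrier B \<and> b' \<in> carrier B \<and> c \<in> carrier C}
    \<union> {d b (c \<oplus>\<^bsub>C\<^esub> c') \<ominus>\<^bsub>F\<^esub> (d b c \<oplus>\<^bsub>F\<^esub> d b c') | b c c'.
        b \<in> carrier B \<and> c \<in> carrier C \<and> c' \<in> carrier C}
    \<union> {d (a \<odot>\<^bsub>B\<^esub> b) c \<ominus>\<^bsub>F\<^esub> (a \<odot>\<^bsub>F\<^esub> d b c) | a b c.
        a \<in> carrier A \<and> b \<in> carrier B \<and> c \<in> carrier C}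
    \<union> {d b (a \<odot>\<^bsub>C\<^esub> c) \<ominus>\<^bsub>F\<^esub> (a \<odot>\<^bsub>F\<^esub> d b c) | a b c.
        a \<in> carrier A \<and> b \<in> carrier B \<and> c \<in> carrier C})"

definition tensor_ideal ::
  "('a, 'm) ring_scheme \<Rightarrow> ('a, 'b, 'n) module_scheme \<Rightarrow> ('a, 'c, 'p) module_scheme \<Rightarrow>
    ('b \<times> 'c \<Rightarrow> 'a) set"
  where "tensor_ideal A B C = Idl\<^bsub>tensor_free A B C\<^esub> (tensor_rel A B C)"

definition tensor ::
  "('a, 'm) ring_scheme \<Rightarrow> ('a, 'b, 'n) module_scheme \<Rightarrow> ('a, 'c, 'p) module_scheme \<Rightarrow>
    ('a, ('b \<times> 'c \<Rightarrow> 'a) set) module"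
  where "tensor A B C = quot_alg (tensor_free A B C) (tensor_ideal A B C)"

text \<open>\<open>b \<otimes> c\<close>\<close>

definition tensor_elt ::
  "('a, 'm) ring_scheme \<Rightarrow> ('a, 'b, 'n) module_scheme \<Rightarrow> ('a, 'c, 'p) module_scheme \<Rightarrow>
    'b \<Rightarrow> 'c \<Rightarrow> ('b \<times> 'c \<Rightarrow> 'a) set"
  where "tensor_elt A B C b c = tensor_ideal A B C +>\<^bsub>tensor_free A B C\<^esub> mon_basis A (b, c)"

text \<open>\<open>b \<otimes> c \<mapsto> f b \<cdot> g c\<close>, for \<open>A\<close>-linear maps \<open>f\<close> and \<open>g\<close> into an algebra \<open>E\<close>.\<close>

definition tensor_lift ::
  "('a, 'm) ring_scheme \<Rightarrow> ('a, 'e, 'n) module_scheme \<Rightarrow> ('b \<Rightarrow> 'e) \<Rightarrow> ('c \<Rightarrow> 'e) \<Rightarrow>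
    ('b \<times> 'c \<Rightarrow> 'a) set \<Rightarrow> 'e"
  where "tensor_lift A E f g = quot_lift (mon_eval A E (\<lambda>p. f (fst p) \<otimes>\<^bsub>E\<^esub> g (snd p)))"

text \<open>\<open>f \<otimes> g\<close>, with values in \<open>B \<otimes>\<^sub>A C\<close>.\<close>

definition tensor_map ::
  "('a, 'm) ring_scheme \<Rightarrow> ('a, 'b, 'n) module_scheme \<Rightarrow> ('a, 'c, 'p) module_scheme \<Rightarrow>
    ('x \<Rightarrow> 'b) \<Rightarrow> ('y \<Rightarrow> 'c) \<Rightarrow> ('x \<times> 'y \<Rightarrow> 'a) set \<Rightarrow> ('b \<times> 'c \<Rightarrow> 'a) set"
  where "tensor_map A B C f g =
    tensor_lift A (tensor A B C)
      (\<lambda>x. tensor_elt A B C (f x) \<one>\<^bsub>C\<^esub>) (\<lambda>y. tensor_elt A B C \<one>\<^bsub>B\<^esub> (g y))"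

text \<open>\<open>(x \<otimes> y) \<otimes> z \<mapsto> x \<otimes> (y \<otimes> z)\<close>.\<close>

definition tensor_assoc ::
  "('a, 'm) ring_scheme \<Rightarrow> ('a, 'b, 'n) module_scheme \<Rightarrow> ('a, 'c, 'p) module_scheme \<Rightarrow>
    ('a, 'd, 'q) module_scheme \<Rightarrow>
    (('b \<times> 'c \<Rightarrow> 'a) set \<times> 'd \<Rightarrow> 'a) set \<Rightarrow> ('b \<times> ('c \<times> 'd \<Rightarrow> 'a) set \<Rightarrow> 'a) set"
  where "tensor_assoc A B C D =
    (let CD = tensor A C D; E = tensor A B CD; t = tensor_elt A B CD in
      tensor_lift A E
        (tensor_lift A E (\<lambda>x. t x \<one>\<^bsub>CD\<^esub>) (\<lambda>y. t \<one>\<^bsub>B\<^esub> (tensor_elt A C D y \<one>\<^bsub>D\<^esub>)))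
        (\<lambda>z. t \<one>\<^bsub>B\<^esub> (tensor_elt A C D \<one>\<^bsub>C\<^esub> z)))"


section \<open>Commutative Hopf algebras\<close>

record ('a, 'b) hopf = "('a, 'b) module" +
  comult :: "'b \<Rightarrow> ('b \<times> 'b \<Rightarrow> 'a) set"
  counit :: "'b \<Rightarrow> 'a"
  antipode :: "'b \<Rightarrow> 'b"

definition with_coalg ::
  "('a, 'b, 'n) module_scheme \<Rightarrow> ('b \<Rightarrow> ('b \<times> 'b \<Rightarrow> 'a) set) \<Rightarrow> ('b \<Rightarrow> 'a) \<Rightarrow> ('b \<Rightarrow> 'b) \<Rightarrow>
    ('a, 'b) hopf"
  where "with_coalg B \<Delta> \<epsilon> S = \<lparr>carrier = carrier B, monoid.mult = monoid.mult B, one = \<one>\<^bsub>B\<^esub>,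
    zero = \<zero>\<^bsub>B\<^esub>, add = add B, smult = smult B, comult = \<Delta>, counit = \<epsilon>, antipode = S\<rparr>"

definition hopf_algebra :: "('a, 'm) ring_scheme \<Rightarrow> ('a, 'b, 'n) hopf_scheme \<Rightarrow> bool"
  where "hopf_algebra A H \<longleftrightarrow>
    algebra A H \<and>
    comult H \<in> alg_hom A H (tensor A H H) \<and>
    counit H \<in> alg_hom A H (base_alg A) \<and>
    antipode H \<in> alg_hom A H H \<and>
    (\<forall>x \<in> carrier H.
      tensor_assoc A H H H (tensor_map A (tensor A H H) H (comult H) (\<lambda>y. y) (comult H x)) =
        tensor_map A H (tensor A H H) (\<lambda>y. y) (comult H) (comult H x) \<and>
      tensor_lift A H (\<lambda>y. counit H y \<odot>\<^bsub>H\<^esub> \<one>\<^bsub>H\<^esub>) (\<lambda>y. y) (comult H x) = x \<and>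
      tensor_lift A H (\<lambda>y. y) (\<lambda>y. counit H y \<odot>\<^bsub>H\<^esub> \<one>\<^bsub>H\<^esub>) (comult H x) = x \<and>
      tensor_lift A H (antipode H) (\<lambda>y. y) (comult H x) = counit H x \<odot>\<^bsub>H\<^esub> \<one>\<^bsub>H\<^esub> \<and>
      tensor_lift A H (\<lambda>y. y) (antipode H) (comult H x) = counit H x \<odot>\<^bsub>H\<^esub> \<one>\<^bsub>H\<^esub>)"

definition hopf_hom ::
  "('a, 'm) ring_scheme \<Rightarrow> ('a, 'b, 'n) hopf_scheme \<Rightarrow> ('a, 'c, 'p) hopf_scheme \<Rightarrow> ('b \<Rightarrow> 'c) set"
  where "hopf_hom A H K = {\<phi> \<in> alg_hom A H K. \<forall>x \<in> carrier H.
    comult K (\<phi> x) = tensor_map A K K \<phi> \<phi> (comult H x) \<and>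
    counit K (\<phi> x) = counit H x \<and>
    antipode K (\<phi> x) = \<phi> (antipode H x)}"

definition hopf_iso ::
  "('a, 'm) ring_scheme \<Rightarrow> ('a, 'b, 'n) hopf_scheme \<Rightarrow> ('a, 'c, 'p) hopf_scheme \<Rightarrow> ('b \<Rightarrow> 'c) set"
  where "hopf_iso A H K = {\<phi> \<in> hopf_hom A H K. bij_betw \<phi> (carrier H) (carrier K)}"

definition quot_hopf ::
  "('a, 'm) ring_scheme \<Rightarrow> ('a, 'b, 'n) hopf_scheme \<Rightarrow> 'b set \<Rightarrow> ('a, 'b set) hopf"
  where "quot_hopf A H I = (let Q = quot_alg H I; \<pi> = (\<lambda>x. I +>\<^bsub>H\<^esub> x) in
    with_coalg Q
      (quot_lift (\<lambda>x. tensor_map A Q Q \<pi> \<pi> (comult H x)))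
      (quot_lift (counit H))
      (quot_lift (\<lambda>x. \<pi> (antipode H x))))"

text \<open>
  The structure induced on a subset \<open>K\<close> of \<open>H\<close>. The comultiplication takes values in
  \<open>K \<otimes>\<^sub>A K\<close>, which need not embed into \<open>H \<otimes>\<^sub>A H\<close> for a general subalgebra: the induced value is
  the unique preimage under the map \<open>K \<otimes>\<^sub>A K \<rightarrow> H \<otimes>\<^sub>A H\<close>.
\<close>

definition sub_hopf ::
  "('a, 'm) ring_scheme \<Rightarrow> ('a, 'b) hopf \<Rightarrow> 'b set \<Rightarrow> ('a, 'b) hopf"
  where "sub_hopf A H K = (let B = H\<lparr>carrier := K\<rparr> in
    with_coalg B
      (\<lambda>x. THE y. y \<in> carrier (tensor A B B) \<and>
        tensor_map A H H (\<lambda>u. u) (\<lambda>u. u) y = comult H x)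
      (counit H) (antipode H))"


section \<open>Constant group schemes\<close>

text \<open>
  The coordinate ring of the constant group scheme of a finite group \<open>\<Gamma>\<close> is the ring of functions
  \<open>\<Gamma> \<rightarrow> A\<close>. Its comultiplication is \<open>f \<mapsto> ((h, k) \<mapsto> f (h k))\<close>, where a function \<open>F\<close> on
  \<open>\<Gamma> \<times> \<Gamma>\<close> is read as the tensor \<open>\<Sum>\<^sub>h\<^sub>,\<^sub>k F (h, k) e\<^sub>h \<otimes> e\<^sub>k\<close>.
\<close>

definition const_alg :: "('a, 'm) ring_scheme \<Rightarrow> ('g, 'n) monoid_scheme \<Rightarrow> ('a, 'g \<Rightarrow> 'a) module"
  where "const_alg A \<Gamma> = \<lparr>carrier = carrier \<Gamma> \<rightarrow>\<^sub>E carrier A,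
    monoid.mult = (\<lambda>f f'. \<lambda>g\<in>carrier \<Gamma>. f g \<otimes>\<^bsub>A\<^esub> f' g),
    one = (\<lambda>g\<in>carrier \<Gamma>. \<one>\<^bsub>A\<^esub>),
    zero = (\<lambda>g\<in>carrier \<Gamma>. \<zero>\<^bsub>A\<^esub>),
    add = (\<lambda>f f'. \<lambda>g\<in>carrier \<Gamma>. f g \<oplus>\<^bsub>A\<^esub> f' g),
    smult = (\<lambda>a f. \<lambda>g\<in>carrier \<Gamma>. a \<otimes>\<^bsub>A\<^esub> f g)\<rparr>"

definition const_idem ::
  "('a, 'm) ring_scheme \<Rightarrow> ('g, 'n) monoid_scheme \<Rightarrow> 'g \<Rightarrow> 'g \<Rightarrow> 'a"
  where "const_idem A \<Gamma> h = (\<lambda>g\<in>carrier \<Gamma>. if g = h then \<one>\<^bsub>A\<^esub> else \<zero>\<^bsub>A\<^esub>)"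

definition const_hopf :: "('a, 'm) ring_scheme \<Rightarrow> ('g, 'n) monoid_scheme \<Rightarrow> ('a, 'g \<Rightarrow> 'a) hopf"
  where "const_hopf A \<Gamma> = (let B = const_alg A \<Gamma>; BB = tensor A B B in
    with_coalg B
      (\<lambda>f. \<Oplus>\<^bsub>BB\<^esub>p \<in> carrier \<Gamma> \<times> carrier \<Gamma>. f (fst p \<otimes>\<^bsub>\<Gamma>\<^esub> snd p) \<odot>\<^bsub>BB\<^esub>
        tensor_elt A B B (const_idem A \<Gamma> (fst p)) (const_idem A \<Gamma> (snd p)))
      (\<lambda>f. f \<one>\<^bsub>\<Gamma>\<^esub>)
      (\<lambda>f. \<lambda>g\<in>carrier \<Gamma>. f (inv\<^bsub>\<Gamma>\<^esub> g)))"


section \<open>The Hopf algebra \<open>A[z]/(z(1 - z))\<close>\<close>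

definition upvar :: "('a, 'm) ring_scheme \<Rightarrow> nat \<Rightarrow> 'a"
  where "upvar A = monom (UP A) \<one>\<^bsub>A\<^esub> 1"

definition idem_ideal :: "('a, 'm) ring_scheme \<Rightarrow> (nat \<Rightarrow> 'a) set"
  where "idem_ideal A =
    Idl\<^bsub>UP A\<^esub> {upvar A \<otimes>\<^bsub>UP A\<^esub> (\<one>\<^bsub>UP A\<^esub> \<ominus>\<^bsub>UP A\<^esub> upvar A)}"

definition idem_alg :: "('a, 'm) ring_scheme \<Rightarrow> ('a, (nat \<Rightarrow> 'a) set) module"
  where "idem_alg A = quot_alg (UP A) (idem_ideal A)"

definition idem_z :: "('a, 'm) ring_scheme \<Rightarrow> (nat \<Rightarrow> 'a) set"
  where "idem_z A = idem_ideal A +>\<^bsub>UP A\<^esub> upvar A"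

text \<open>The algebra homomorphism \<open>A[z]/(z(1 - z)) \<rightarrow> E\<close> with \<open>z \<mapsto> s\<close>.\<close>

definition idem_eval ::
  "('a, 'm) ring_scheme \<Rightarrow> ('a, 'e, 'n) module_scheme \<Rightarrow> 'e \<Rightarrow> (nat \<Rightarrow> 'a) set \<Rightarrow> 'e"
  where "idem_eval A E s = quot_lift (UnivPoly.eval A E (\<lambda>a. a \<odot>\<^bsub>E\<^esub> \<one>\<^bsub>E\<^esub>) s)"

definition idem_comult_z :: "('a, 'm) ring_scheme \<Rightarrow> ((nat \<Rightarrow> 'a) set \<times> (nat \<Rightarrow> 'a) set \<Rightarrow> 'a) set"
  where "idem_comult_z A =
    (let B = idem_alg A; BB = tensor A B B; t = tensor_elt A B B; z = idem_z A in
      \<one>\<^bsub>BB\<^esub> \<oplus>\<^bsub>BB\<^esub> [(2::nat)] \<cdot>\<^bsub>BB\<^esub> t z z \<ominus>\<^bsub>BB\<^esub> t \<one>\<^bsub>B\<^esub> z \<ominus>\<^bsub>BB\<^esub> t z \<one>\<^bsub>B\<^esub>)"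

definition idem_hopf :: "('a, 'm) ring_scheme \<Rightarrow> ('a, (nat \<Rightarrow> 'a) set) hopf"
  where "idem_hopf A = (let B = idem_alg A in
    with_coalg B
      (idem_eval A (tensor A B B) (idem_comult_z A))
      (idem_eval A (base_alg A) \<one>\<^bsub>A\<^esub>)
      (idem_eval A B (idem_z A)))"


section \<open>The group scheme \<open>GL\<^sub>2\<close>, its diagonal torus and the normalizer of the torus\<close>

text \<open>
  \<open>A[x\<^sub>i\<^sub>j, 1/D]\<close> is \<open>A[x\<^sub>i\<^sub>j, y]/(y D - 1)\<close>; the variable \<open>y\<close> is \<open>Dinv\<close>.
\<close>

datatype gl2_var = X11 | X12 | X21 | X22 | Dinv

definition gl2_ideal :: "('a, 'm) ring_scheme \<Rightarrow> ((gl2_var \<Rightarrow> nat) \<Rightarrow> 'a) set"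
  where "gl2_ideal A = (let P = mpoly A; x = mvar A in
    Idl\<^bsub>P\<^esub> {x Dinv \<otimes>\<^bsub>P\<^esub> (x X11 \<otimes>\<^bsub>P\<^esub> x X22 \<ominus>\<^bsub>P\<^esub> x X12 \<otimes>\<^bsub>P\<^esub> x X21) \<ominus>\<^bsub>P\<^esub> \<one>\<^bsub>P\<^esub>})"

definition gl2_alg :: "('a, 'm) ring_scheme \<Rightarrow> ('a, ((gl2_var \<Rightarrow> nat) \<Rightarrow> 'a) set) module"
  where "gl2_alg A = quot_alg (mpoly A) (gl2_ideal A)"

definition gl2_x :: "('a, 'm) ring_scheme \<Rightarrow> gl2_var \<Rightarrow> ((gl2_var \<Rightarrow> nat) \<Rightarrow> 'a) set"
  where "gl2_x A v = gl2_ideal A +>\<^bsub>mpoly A\<^esub> mvar A v"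

text \<open>The algebra homomorphism \<open>A[x\<^sub>i\<^sub>j, 1/D] \<rightarrow> E\<close> with \<open>v \<mapsto> s v\<close> for each generator \<open>v\<close>.\<close>

definition gl2_eval ::
  "('a, 'm) ring_scheme \<Rightarrow> ('a, 'e, 'n) module_scheme \<Rightarrow> (gl2_var \<Rightarrow> 'e) \<Rightarrow>
    ((gl2_var \<Rightarrow> nat) \<Rightarrow> 'a) set \<Rightarrow> 'e"
  where "gl2_eval A E s = quot_lift (mpoly_eval A E s)"

definition gl2_comult_gen ::
  "('a, 'm) ring_scheme \<Rightarrow> gl2_var \<Rightarrow>
    (((gl2_var \<Rightarrow> nat) \<Rightarrow> 'a) set \<times> ((gl2_var \<Rightarrow> nat) \<Rightarrow> 'a) set \<Rightarrow> 'a) set"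
  where "gl2_comult_gen A v =
    (let B = gl2_alg A; BB = tensor A B B; t = (\<lambda>u w. tensor_elt A B B (gl2_x A u) (gl2_x A w)) in
      case v of
        X11 \<Rightarrow> t X11 X11 \<oplus>\<^bsub>BB\<^esub> t X12 X21
      | X12 \<Rightarrow> t X11 X12 \<oplus>\<^bsub>BB\<^esub> t X12 X22
      | X21 \<Rightarrow> t X21 X11 \<oplus>\<^bsub>BB\<^esub> t X22 X21
      | X22 \<Rightarrow> t X21 X12 \<oplus>\<^bsub>BB\<^esub> t X22 X22
      | Dinv \<Rightarrow> t Dinv Dinv)"

definition gl2_counit_gen :: "('a, 'm) ring_scheme \<Rightarrow> gl2_var \<Rightarrow> 'a"
  where "gl2_counit_gen A v =
    (case v of X11 \<Rightarrow> \<one>\<^bsub>A\<^esub> | X12 \<Rightarrow> \<zero>\<^bsub>A\<^esub> | X21 \<Rightarrow> \<zero>\<^bsub>A\<^esub> | X22 \<Rightarrow> \<one>\<^bsub>A\<^esub> | Dinv \<Rightarrow> \<one>\<^bsub>A\<^esub>)"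

definition gl2_antipode_gen :: "('a, 'm) ring_scheme \<Rightarrow> gl2_var \<Rightarrow> ((gl2_var \<Rightarrow> nat) \<Rightarrow> 'a) set"
  where "gl2_antipode_gen A v = (let B = gl2_alg A; x = gl2_x A in
    case v of
      X11 \<Rightarrow> x Dinv \<otimes>\<^bsub>B\<^esub> x X22
    | X12 \<Rightarrow> \<ominus>\<^bsub>B\<^esub> (x Dinv \<otimes>\<^bsub>B\<^esub> x X12)
    | X21 \<Rightarrow> \<ominus>\<^bsub>B\<^esub> (x Dinv \<otimes>\<^bsub>B\<^esub> x X21)
    | X22 \<Rightarrow> x Dinv \<otimes>\<^bsub>B\<^esub> x X11
    | Dinv \<Rightarrow> x X11 \<otimes>\<^bsub>B\<^esub> x X22 \<ominus>\<^bsub>B\<^esub> x X12 \<otimes>\<^bsub>B\<^esub> x X21)"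

definition gl2_hopf :: "('a, 'm) ring_scheme \<Rightarrow> ('a, ((gl2_var \<Rightarrow> nat) \<Rightarrow> 'a) set) hopf"
  where "gl2_hopf A = (let B = gl2_alg A in
    with_coalg B
      (gl2_eval A (tensor A B B) (gl2_comult_gen A))
      (gl2_eval A (base_alg A) (gl2_counit_gen A))
      (gl2_eval A B (gl2_antipode_gen A)))"

definition torus_ideal :: "('a, 'm) ring_scheme \<Rightarrow> ((gl2_var \<Rightarrow> nat) \<Rightarrow> 'a) set set"
  where "torus_ideal A = Idl\<^bsub>gl2_hopf A\<^esub> {gl2_x A X12, gl2_x A X21}"

definition antitorus_ideal :: "('a, 'm) ring_scheme \<Rightarrow> ((gl2_var \<Rightarrow> nat) \<Rightarrow> 'a) set set"
  where "antitorus_ideal A = Idl\<^bsub>gl2_hopf A\<^esub> {gl2_x A X11, gl2_x A X22}"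

definition norm_ideal :: "('a, 'm) ring_scheme \<Rightarrow> ((gl2_var \<Rightarrow> nat) \<Rightarrow> 'a) set set"
  where "norm_ideal A = torus_ideal A \<cdot>\<^bsub>gl2_hopf A\<^esub> antitorus_ideal A"

definition torus_hopf :: "('a, 'm) ring_scheme \<Rightarrow> ('a, ((gl2_var \<Rightarrow> nat) \<Rightarrow> 'a) set set) hopf"
  where "torus_hopf A = quot_hopf A (gl2_hopf A) (torus_ideal A)"

definition norm_hopf :: "('a, 'm) ring_scheme \<Rightarrow> ('a, ((gl2_var \<Rightarrow> nat) \<Rightarrow> 'a) set set) hopf"
  where "norm_hopf A = quot_hopf A (gl2_hopf A) (norm_ideal A)"

text \<open>The restriction \<open>k[N] \<rightarrow> k[T]\<close> along the inclusion of \<open>T\<close> into \<open>N\<close>.\<close>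

definition norm_to_torus ::
  "('a, 'm) ring_scheme \<Rightarrow> ((gl2_var \<Rightarrow> nat) \<Rightarrow> 'a) set set \<Rightarrow> ((gl2_var \<Rightarrow> nat) \<Rightarrow> 'a) set set"
  where "norm_to_torus A = quot_lift (\<lambda>x. torus_ideal A +>\<^bsub>gl2_hopf A\<^esub> x)"

definition torus_coaction ::
  "('a, 'm) ring_scheme \<Rightarrow> ((gl2_var \<Rightarrow> nat) \<Rightarrow> 'a) set set \<Rightarrow>
    (((gl2_var \<Rightarrow> nat) \<Rightarrow> 'a) set set \<times> ((gl2_var \<Rightarrow> nat) \<Rightarrow> 'a) set set \<Rightarrow> 'a) set"
  where "torus_coaction A x =
    tensor_map A (norm_hopf A) (torus_hopf A) (\<lambda>y. y) (norm_to_torus A) (comult (norm_hopf A) x)"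

definition norm_mod_torus_carrier :: "('a, 'm) ring_scheme \<Rightarrow> ((gl2_var \<Rightarrow> nat) \<Rightarrow> 'a) set set set"
  where "norm_mod_torus_carrier A = {x \<in> carrier (norm_hopf A).
    torus_coaction A x = tensor_elt A (norm_hopf A) (torus_hopf A) x \<one>\<^bsub>torus_hopf A\<^esub>}"

definition norm_mod_torus_hopf ::
  "('a, 'm) ring_scheme \<Rightarrow> ('a, ((gl2_var \<Rightarrow> nat) \<Rightarrow> 'a) set set) hopf"
  where "norm_mod_torus_hopf A = sub_hopf A (norm_hopf A) (norm_mod_torus_carrier A)"

end

theory Submission
  imports Defs
begin

text \<open>
  Each of the three Hopf algebras is free as an \<open>A\<close>-module on \<open>z\<close> and \<open>1 - z\<close> for an idempotent \<open>z\<close>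
  with \<open>\<Delta> z = z \<otimes> z + (1 - z) \<otimes> (1 - z)\<close>, \<open>\<epsilon> z = 1\<close> and \<open>S z = z\<close>. Algebra homomorphisms on such an
  algebra are determined by the image of \<open>z\<close>, which may be any idempotent, so the Hopf axioms need to be
  checked only at \<open>z\<close>, and any two such Hopf algebras are isomorphic.

  For \<open>N/T\<close> the idempotent is \<open>x\<^sub>1\<^sub>1 x\<^sub>2\<^sub>2 / D\<close>, the indicator function of \<open>T\<close> in \<open>N = T \<squnion> w T\<close>. If
  \<open>f\<close> in \<open>k[N]\<close> is invariant, evaluating the left factor of \<open>\<sigma>\<^sub>T(f) = f \<otimes> 1\<close> at \<open>1\<close> and at \<open>w\<close>
  shows that \<open>f\<close> is the constant \<open>f(1)\<close> on \<open>T\<close> and the constant \<open>f(w)\<close> on \<open>w T\<close>; as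
  \<open>I\<^sub>1 + I\<^sub>2 = (1)\<close>, so that \<open>I\<^sub>1 \<inter> I\<^sub>2 = I\<^sub>1 I\<^sub>2\<close>, these restrictions determine \<open>f\<close>.
\<close>

section \<open>Algebra homomorphisms and monoid algebras\<close>

text \<open>The shape of the comultiplication comes from the group of order two: if z is the
  indicator of the neutral element, a product is neutral exactly when both factors are or neither
  is. Written as an operation \<open>xnor\<close> on z \<otimes> 1 and 1 \<otimes> z, it is carried
  along by every algebra homomorphism, and nothing requires 2 to be invertible. Two obstacles shape
  the rest. Maps out of quotients and tensor products are defined through representatives, so a
  universal property has to show that they are homomorphisms before their values can be computed.
  And the comultiplication of K = k[N/T] is a definite description: it picks a preimage in K
  \<otimes> K of an element of k[N] \<otimes> k[N], although for a general subalgebra over a general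
  A such a preimage need be neither present nor unique. The A-valued points 1 and w of N resolve
  this. They read off the two coordinates of an invariant, show that z and 1 - z are independent
  over A, and together give an algebra retraction of k[N] onto K. Both points exist over every A,
  since their determinants are 1 and -1.\<close>

lemma alg_homD:
  assumes "f \<in> alg_hom A B C"
  shows "f \<in> ring_hom B C"
    and "\<And>x. x \<in> carrier B \<Longrightarrow> f x \<in> carrier C"
    and "\<And>x y. x \<in> carrier B \<Longrightarrow> y \<in> carrier B \<Longrightarrow> f (x \<oplus>\<^bsub>B\<^esub> y) = f x \<oplus>\<^bsub>C\<^esub> f y"
    and "\<And>x y. x \<in> carrier B \<Longrightarrow> y \<in> carrier B \<Longrightarrow> f (x \<otimes>\<^bsub>B\<^esub> y) = f x \<otimes>\<^bsub>C\<^esub> f y"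
    and "f \<one>\<^bsub>B\<^esub> = \<one>\<^bsub>C\<^esub>"
    and "\<And>a x. a \<in> carrier A \<Longrightarrow> x \<in> carrier B \<Longrightarrow> f (a \<odot>\<^bsub>B\<^esub> x) = a \<odot>\<^bsub>C\<^esub> f x"
  using assms by (auto simp: alg_hom_def ring_hom_def)

lemma alg_homI:
  assumes "\<And>x. x \<in> carrier B \<Longrightarrow> f x \<in> carrier C"
    and "\<And>x y. x \<in> carrier B \<Longrightarrow> y \<in> carrier B \<Longrightarrow> f (x \<oplus>\<^bsub>B\<^esub> y) = f x \<oplus>\<^bsub>C\<^esub> f y"
    and "\<And>x y. x \<in> carrier B \<Longrightarrow> y \<in> carrier B \<Longrightarrow> f (x \<otimes>\<^bsub>B\<^esub> y) = f x \<otimes>\<^bsub>C\<^esub> f y"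
    and "f \<one>\<^bsub>B\<^esub> = \<one>\<^bsub>C\<^esub>"
    and "\<And>a x. a \<in> carrier A \<Longrightarrow> x \<in> carrier B \<Longrightarrow> f (a \<odot>\<^bsub>B\<^esub> x) = a \<odot>\<^bsub>C\<^esub> f x"
  shows "f \<in> alg_hom A B C"
  using assms by (auto simp: alg_hom_def ring_hom_def)

lemma alg_hom_cring:
  assumes "f \<in> alg_hom A B C" "algebra A B" "algebra A C"
  shows "ring_hom_cring B C f"
  using assms by (auto intro!: ring_hom_cring.intro ring_hom_cring_axioms.intro alg_homD(1) algebra.M_cring)

lemma alg_hom_zero_inv:
  assumes "f \<in> alg_hom A B C" "algebra A B" "algebra A C"
  shows "f \<zero>\<^bsub>B\<^esub> = \<zero>\<^bsub>C\<^esub>"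
    and "\<And>x. x \<in> carrier B \<Longrightarrow> f (\<ominus>\<^bsub>B\<^esub> x) = \<ominus>\<^bsub>C\<^esub> f x"
    and "\<And>x y. x \<in> carrier B \<Longrightarrow> y \<in> carrier B \<Longrightarrow> f (x \<ominus>\<^bsub>B\<^esub> y) = f x \<ominus>\<^bsub>C\<^esub> f y"
proof -
  interpret ring_hom_cring B C f using alg_hom_cring[OF assms] .
  show "f \<zero>\<^bsub>B\<^esub> = \<zero>\<^bsub>C\<^esub>" by simp
  show "\<And>x. x \<in> carrier B \<Longrightarrow> f (\<ominus>\<^bsub>B\<^esub> x) = \<ominus>\<^bsub>C\<^esub> f x" by simp
  show "\<And>x y. x \<in> carrier B \<Longrightarrow> y \<in> carrier B \<Longrightarrow> f (x \<ominus>\<^bsub>B\<^esub> y) = f x \<ominus>\<^bsub>C\<^esub> f y"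
    by (simp add: a_minus_def)
qed

lemma alg_hom_comp:
  assumes "f \<in> alg_hom A B C" "g \<in> alg_hom A C E"
  shows "(\<lambda>x. g (f x)) \<in> alg_hom A B E"
  by (rule alg_homI) (simp_all add: alg_homD[OF assms(1)] alg_homD[OF assms(2)])

lemma alg_hom_id: "(\<lambda>x. x) \<in> alg_hom A B B"
  by (rule alg_homI) auto

lemma alg_hom_cong:
  assumes "f \<in> alg_hom A B C" "algebra A B" "\<And>x. x \<in> carrier B \<Longrightarrow> g x = f x"
  shows "g \<in> alg_hom A B C"
proof -
  interpret algebra A B by fact
  show ?thesis
    by (rule alg_homI) (simp_all add: assms(3) alg_homD[OF assms(1)])
qed

lemma algebra_base_alg:
  assumes "cring A" shows "algebra A (base_alg A)"
proof -
  interpret cring A by fact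
  have ab: "abelian_group (base_alg A)"
  proof (rule abelian_groupI)
    show "\<exists>y\<in>carrier (base_alg A). y \<oplus>\<^bsub>base_alg A\<^esub> x = \<zero>\<^bsub>base_alg A\<^esub>"
      if "x \<in> carrier (base_alg A)" for x
      by (rule bexI[of _ "\<ominus>\<^bsub>A\<^esub> x"]) (use that in \<open>simp_all add: base_alg_def l_neg\<close>)
  qed (simp_all add: base_alg_def a_ac)
  have "cring (base_alg A)"
    by (rule cringI[OF ab]) (auto intro!: comm_monoidI simp: base_alg_def m_ac l_distr r_distr)
  then show ?thesis
    by (intro algebraI is_cring) (auto simp: base_alg_def m_ac l_distr r_distr)
qed

lemma alg_hom_unit:
  assumes "algebra A E" shows "(\<lambda>a. a \<odot>\<^bsub>E\<^esub> \<one>\<^bsub>E\<^esub>) \<in> alg_hom A (base_alg A) E"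
proof -
  interpret algebra A E by fact
  show ?thesis
    by (rule alg_homI) (simp_all add: base_alg_def smult_l_distr smult_assoc1 smult_assoc2)
qed

text \<open>Polynomial rings (exponent vectors under addition) and the free modules beneath tensor
  products (pairs under multiplication) are both instances, so the algebra axioms and the universal
  property are proved once.\<close>

locale mon_algebra = A?: cring A + M?: comm_monoid M for A (structure) and M (structure)
begin

abbreviation "F \<equiv> mon_alg A M"
abbreviation "\<delta> \<equiv> mon_basis A"
abbreviation "supp f \<equiv> {m. f m \<noteq> \<zero>}"

lemma mon_carrierD:
  assumes "f \<in> carrier F"
  shows "f m \<in> carrier A" "finite (supp f)" "supp f \<subseteq> carrier M" "m \<notin> carrier M \<Longrightarrow> f m = \<zero>"
proof -
  from assms show "finite (supp f)" "supp f \<subseteq> carrier M" "m \<notin> carrier M \<Longrightarrow> f m = \<zero>"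
    by (auto simp: mon_alg_def)
  from assms show "f m \<in> carrier A" by (cases "m \<in> carrier M") (auto simp: mon_alg_def)
qed

lemma mon_carrierI:
  assumes "\<And>m. f m \<in> carrier A" "finite S" "supp f \<subseteq> S" "S \<subseteq> carrier M"
  shows "f \<in> carrier F"
  using assms finite_subset by (fastforce simp: mon_alg_def)

lemma mon_ops:
  "\<zero>\<^bsub>F\<^esub> = (\<lambda>m. \<zero>)" "f \<oplus>\<^bsub>F\<^esub> g = (\<lambda>m. f m \<oplus> g m)" "a \<odot>\<^bsub>F\<^esub> f = (\<lambda>m. a \<otimes> f m)" "\<one>\<^bsub>F\<^esub> = \<delta> \<one>\<^bsub>M\<^esub>"
  by (auto simp: mon_alg_def mon_basis_def)

text \<open>The index set in the definition depends on \<open>f\<close>, \<open>g\<close> and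
  \<open>m\<close>. Summing over a fixed rectangle \<open>S \<times> T\<close> instead, with zeros
  off the fibre over \<open>m\<close>, lets sums for different arguments be added termwise.\<close>

lemma mon_mult:
  assumes "f \<in> carrier F" "g \<in> carrier F" "finite S" "finite T" "supp f \<subseteq> S" "supp g \<subseteq> T"
  shows "(f \<otimes>\<^bsub>F\<^esub> g) m =
    (\<Oplus>p\<in>S \<times> T. if fst p \<otimes>\<^bsub>M\<^esub> snd p = m then f (fst p) \<otimes> g (snd p) else \<zero>)"
proof -
  let ?D = "{(u, v). f u \<noteq> \<zero> \<and> g v \<noteq> \<zero> \<and> u \<otimes>\<^bsub>M\<^esub> v = m}"
  note [simp] = mon_carrierD[OF assms(1)] mon_carrierD[OF assms(2)]
  have "(f \<otimes>\<^bsub>F\<^esub> g) m = (\<Oplus>p\<in>?D. f (fst p) \<otimes> g (snd p))"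
    by (simp add: mon_alg_def)
  also have "\<dots> = (\<Oplus>p\<in>S \<times> T. if fst p \<otimes>\<^bsub>M\<^esub> snd p = m then f (fst p) \<otimes> g (snd p) else \<zero>)"
    using assms(3-6)
    by (intro A.add.finprod_mono_neutral_cong_left) auto
  finally show ?thesis .
qed

lemma mon_zero_closed: "\<zero>\<^bsub>F\<^esub> \<in> carrier F"
  by (auto simp: mon_alg_def)

lemma mon_add_closed: "f \<in> carrier F \<Longrightarrow> g \<in> carrier F \<Longrightarrow> f \<oplus>\<^bsub>F\<^esub> g \<in> carrier F"
  by (rule mon_carrierI[where S="supp f \<union> supp g"])
     (use mon_carrierD[of f] mon_carrierD[of g] in \<open>auto simp: mon_ops\<close>)

lemma mon_smult_closed: "a \<in> carrier A \<Longrightarrow> f \<in> carrier F \<Longrightarrow> a \<odot>\<^bsub>F\<^esub> f \<in> carrier F"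
  by (rule mon_carrierI[where S="supp f"])
     (use mon_carrierD[of f] in \<open>auto simp: mon_ops\<close>)

lemma mon_basis_closed: "u \<in> carrier M \<Longrightarrow> \<delta> u \<in> carrier F"
  by (rule mon_carrierI[where S="{u}"]) (auto simp: mon_basis_def)

lemma mon_mult_closed:
  assumes "f \<in> carrier F" "g \<in> carrier F"
  shows "f \<otimes>\<^bsub>F\<^esub> g \<in> carrier F"
proof (rule mon_carrierI)
  have cM: "u \<in> carrier M" if "f u \<noteq> \<zero> \<or> g u \<noteq> \<zero>" for u
    using that mon_carrierD(4)[OF assms(1)] mon_carrierD(4)[OF assms(2)] by blast
  note [simp] = mon_carrierD[OF assms(1)] mon_carrierD[OF assms(2)]
  note m = mon_mult[OF assms, of "supp f" "supp g", simplified]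
  show "(f \<otimes>\<^bsub>F\<^esub> g) m \<in> carrier A" for m
    unfolding m by (rule finsum_closed) auto
  let ?S = "(\<lambda>p. fst p \<otimes>\<^bsub>M\<^esub> snd p) ` (supp f \<times> supp g)"
  show "finite ?S" by simp
  show "?S \<subseteq> carrier M"
    using cM by auto
  show "supp (f \<otimes>\<^bsub>F\<^esub> g) \<subseteq> ?S"
  proof (rule, rule ccontr)
    fix m assume *: "m \<in> supp (f \<otimes>\<^bsub>F\<^esub> g)" "m \<notin> ?S"
    have "(f \<otimes>\<^bsub>F\<^esub> g) m = \<zero>"
      unfolding m using *(2) by (intro A.add.finprod_one_eqI) force
    with * show False by simp
  qed
qed

lemma mon_distrib:
  assumes "f \<in> carrier F" "f' \<in> carrier F" "g \<in> carrier F"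
  shows "(f \<oplus>\<^bsub>F\<^esub> f') \<otimes>\<^bsub>F\<^esub> g = f \<otimes>\<^bsub>F\<^esub> g \<oplus>\<^bsub>F\<^esub> f' \<otimes>\<^bsub>F\<^esub> g"
    and "g \<otimes>\<^bsub>F\<^esub> (f \<oplus>\<^bsub>F\<^esub> f') = g \<otimes>\<^bsub>F\<^esub> f \<oplus>\<^bsub>F\<^esub> g \<otimes>\<^bsub>F\<^esub> f'"
proof -
  note [simp] = mon_carrierD[OF assms(1)] mon_carrierD[OF assms(2)] mon_carrierD[OF assms(3)]
  let ?S = "supp f \<union> supp f'" and ?T = "supp g"
  have s: "supp (f \<oplus>\<^bsub>F\<^esub> f') \<subseteq> ?S" by (auto simp: mon_ops)
  note c = mon_add_closed[OF assms(1,2)]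
  have "((f \<oplus>\<^bsub>F\<^esub> f') \<otimes>\<^bsub>F\<^esub> g) m = (f \<otimes>\<^bsub>F\<^esub> g) m \<oplus> (f' \<otimes>\<^bsub>F\<^esub> g) m" for m
  proof -
    note c = mon_add_closed[OF assms(1,2)]
    have "((f \<oplus>\<^bsub>F\<^esub> f') \<otimes>\<^bsub>F\<^esub> g) m =
      (\<Oplus>p\<in>?S \<times> ?T. (if fst p \<otimes>\<^bsub>M\<^esub> snd p = m then f (fst p) \<otimes> g (snd p) else \<zero>) \<oplus>
        (if fst p \<otimes>\<^bsub>M\<^esub> snd p = m then f' (fst p) \<otimes> g (snd p) else \<zero>))"
      by (subst mon_mult[OF c assms(3) _ _ s order.refl], simp, simp, rule finsum_cong')
         (auto simp: l_distr mon_ops(2))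
    also have "\<dots> = (f \<otimes>\<^bsub>F\<^esub> g) m \<oplus> (f' \<otimes>\<^bsub>F\<^esub> g) m"
      by (subst finsum_addf)
         (auto simp: mon_mult[OF assms(1,3), of ?S ?T m] mon_mult[OF assms(2,3), of ?S ?T m])
    finally show ?thesis .
  qed
  then show "(f \<oplus>\<^bsub>F\<^esub> f') \<otimes>\<^bsub>F\<^esub> g = f \<otimes>\<^bsub>F\<^esub> g \<oplus>\<^bsub>F\<^esub> f' \<otimes>\<^bsub>F\<^esub> g" by (auto simp: mon_ops(2))
  have "(g \<otimes>\<^bsub>F\<^esub> (f \<oplus>\<^bsub>F\<^esub> f')) m = (g \<otimes>\<^bsub>F\<^esub> f) m \<oplus> (g \<otimes>\<^bsub>F\<^esub> f') m" for m
  proof -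
    note c = mon_add_closed[OF assms(1,2)]
    have "(g \<otimes>\<^bsub>F\<^esub> (f \<oplus>\<^bsub>F\<^esub> f')) m =
      (\<Oplus>p\<in>?T \<times> ?S. (if fst p \<otimes>\<^bsub>M\<^esub> snd p = m then g (fst p) \<otimes> f (snd p) else \<zero>) \<oplus>
        (if fst p \<otimes>\<^bsub>M\<^esub> snd p = m then g (fst p) \<otimes> f' (snd p) else \<zero>))"
      by (subst mon_mult[OF assms(3) c _ _ order.refl s], simp, simp, rule finsum_cong')
         (auto simp: r_distr mon_ops(2))
    also have "\<dots> = (g \<otimes>\<^bsub>F\<^esub> f) m \<oplus> (g \<otimes>\<^bsub>F\<^esub> f') m"
      by (subst finsum_addf)
         (auto simp: mon_mult[OF assms(3,1), of ?T ?S m] mon_mult[OF assms(3,2), of ?T ?S m])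
    finally show ?thesis .
  qed
  then show "g \<otimes>\<^bsub>F\<^esub> (f \<oplus>\<^bsub>F\<^esub> f') = g \<otimes>\<^bsub>F\<^esub> f \<oplus>\<^bsub>F\<^esub> g \<otimes>\<^bsub>F\<^esub> f'" by (auto simp: mon_ops(2))
qed

lemma mon_basis_mult:
  assumes "a \<in> carrier A" "b \<in> carrier A" "u \<in> carrier M" "v \<in> carrier M"
  shows "(a \<odot>\<^bsub>F\<^esub> \<delta> u) \<otimes>\<^bsub>F\<^esub> (b \<odot>\<^bsub>F\<^esub> \<delta> v) = (a \<otimes> b) \<odot>\<^bsub>F\<^esub> \<delta> (u \<otimes>\<^bsub>M\<^esub> v)"
proof
  fix m
  note c = mon_smult_closed[OF _ mon_basis_closed]
  have "supp (a \<odot>\<^bsub>F\<^esub> \<delta> u) \<subseteq> {u}" "supp (b \<odot>\<^bsub>F\<^esub> \<delta> v) \<subseteq> {v}"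
    using assms by (auto simp: mon_ops mon_basis_def)
  from mon_mult[OF c[OF assms(1,3)] c[OF assms(2,4)] _ _ this]
  show "((a \<odot>\<^bsub>F\<^esub> \<delta> u) \<otimes>\<^bsub>F\<^esub> (b \<odot>\<^bsub>F\<^esub> \<delta> v)) m = ((a \<otimes> b) \<odot>\<^bsub>F\<^esub> \<delta> (u \<otimes>\<^bsub>M\<^esub> v)) m"
    using assms by (auto simp: mon_ops mon_basis_def)
qed

text \<open>Every element is a finite sum of terms \<open>a \<odot> \<delta> u\<close>: the
  induction removes one point of the support at a time. Identities additive in each argument thereby
  reduce to single terms.\<close>

lemma mon_induct [consumes 1, case_names zero add basis]:
  assumes f: "f \<in> carrier F" and "P \<zero>\<^bsub>F\<^esub>"
    and add: "\<And>x y. x \<in> carrier F \<Longrightarrow> y \<in> carrier F \<Longrightarrow> P x \<Longrightarrow> P y \<Longrightarrow> P (x \<oplus>\<^bsub>F\<^esub> y)"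
    and basis: "\<And>a u. a \<in> carrier A \<Longrightarrow> u \<in> carrier M \<Longrightarrow> P (a \<odot>\<^bsub>F\<^esub> \<delta> u)"
  shows "P f"
proof -
  have "finite S \<Longrightarrow> f \<in> carrier F \<Longrightarrow> supp f \<subseteq> S \<Longrightarrow> P f" for S f
  proof (induction S arbitrary: f rule: finite_induct)
    case empty
    then have "f = \<zero>\<^bsub>F\<^esub>" by (auto simp: mon_ops)
    with assms(2) show ?case by simp
  next
    case (insert u S)
    note fD [simp] = mon_carrierD[OF insert.prems(1)]
    show ?case
    proof (cases "u \<in> carrier M")
      case False
      then have "f u = \<zero>" by simp
      with insert.prems have "supp f \<subseteq> S" by auto
      with insert show ?thesis by blast
    next
      case True
      define g where "g = f(u := \<zero>)"
      have "g \<in> carrier F"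
        by (rule mon_carrierI[where S="supp f"]) (auto simp: g_def fD(3))
      moreover have "f u \<odot>\<^bsub>F\<^esub> \<delta> u \<in> carrier F"
        using True by (simp add: mon_smult_closed mon_basis_closed)
      moreover have "supp g \<subseteq> S" using insert.prems by (auto simp: g_def)
      moreover have "f = g \<oplus>\<^bsub>F\<^esub> (f u \<odot>\<^bsub>F\<^esub> \<delta> u)"
        by (auto simp: mon_ops g_def mon_basis_def)
      ultimately show ?thesis using insert.IH[of g] basis[of "f u" u] add True
        by (metis fD(1))
    qed
  qed
  then show ?thesis using f mon_carrierD[OF f] by blast
qed

text \<open>By nested use of \<open>mon_induct\<close>, commutativity, associativity and the unit
  law reduce to the product of two terms, where they are laws of A and of M.\<close>

lemma mon_algebra: "algebra A F"
proof -
  note cl [simp] = mon_zero_closed mon_add_closed mon_smult_closed mon_basis_closed mon_mult_closed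
  note D [simp] = mon_carrierD(1)
  have z: "\<zero>\<^bsub>F\<^esub> = \<zero> \<odot>\<^bsub>F\<^esub> \<delta> \<one>\<^bsub>M\<^esub>"
    by (auto simp: mon_ops mon_basis_def)
  have addc: "x \<oplus>\<^bsub>F\<^esub> y = y \<oplus>\<^bsub>F\<^esub> x" if "x \<in> carrier F" "y \<in> carrier F" for x y
    using that by (simp add: mon_ops a_comm)
  have ab: "abelian_group F"
  proof (rule abelian_groupI)
    show "\<exists>y\<in>carrier F. y \<oplus>\<^bsub>F\<^esub> x = \<zero>\<^bsub>F\<^esub>" if "x \<in> carrier F" for x
      by (rule bexI[of _ "(\<ominus> \<one>) \<odot>\<^bsub>F\<^esub> x"])
         (use that in \<open>simp add: mon_ops l_minus l_neg\<close>, use that in simp)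
  qed (simp_all add: addc, simp_all add: mon_ops a_ac)
  interpret ab: abelian_group F by fact
  have sm: "(a \<odot>\<^bsub>F\<^esub> x) \<otimes>\<^bsub>F\<^esub> y = a \<odot>\<^bsub>F\<^esub> (x \<otimes>\<^bsub>F\<^esub> y)"
    if a: "a \<in> carrier A" and xy: "x \<in> carrier F" "y \<in> carrier F" for a x y
  proof
    fix m
    note [simp] = mon_carrierD[OF xy(1)] mon_carrierD[OF xy(2)]
    have s: "supp (a \<odot>\<^bsub>F\<^esub> x) \<subseteq> supp x" using a by (auto simp: mon_ops)
    have "((a \<odot>\<^bsub>F\<^esub> x) \<otimes>\<^bsub>F\<^esub> y) m = (\<Oplus>p\<in>supp x \<times> supp y.
        a \<otimes> (if fst p \<otimes>\<^bsub>M\<^esub> snd p = m then x (fst p) \<otimes> y (snd p) else \<zero>))"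
      using a by (subst mon_mult[OF mon_smult_closed[OF a xy(1)] xy(2) _ _ s order.refl], simp, simp,
        intro finsum_cong') (auto simp: A.m_assoc mon_ops(3))
    also have "\<dots> = a \<otimes> (x \<otimes>\<^bsub>F\<^esub> y) m"
      using a by (subst mon_mult[OF xy _ _ order.refl order.refl], simp, simp, subst finsum_rdistr) auto
    finally show "((a \<odot>\<^bsub>F\<^esub> x) \<otimes>\<^bsub>F\<^esub> y) m = (a \<odot>\<^bsub>F\<^esub> (x \<otimes>\<^bsub>F\<^esub> y)) m"
      by (simp add: mon_ops(3))
  qed
  \<comment> \<open>Ring laws are not yet available for F, so 0 x = 0 is obtained by cancelling in 0
    x = 0 x + 0 x.\<close>
  have l0: "\<zero>\<^bsub>F\<^esub> \<otimes>\<^bsub>F\<^esub> x = \<zero>\<^bsub>F\<^esub>" if "x \<in> carrier F" for x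
    using mon_distrib(1)[of "\<zero>\<^bsub>F\<^esub>" "\<zero>\<^bsub>F\<^esub>" x] that by (simp add: ab.add.l_cancel_one')
  have r0: "x \<otimes>\<^bsub>F\<^esub> \<zero>\<^bsub>F\<^esub> = \<zero>\<^bsub>F\<^esub>" if "x \<in> carrier F" for x
    using mon_distrib(2)[of "\<zero>\<^bsub>F\<^esub>" "\<zero>\<^bsub>F\<^esub>" x] that by (simp add: ab.add.l_cancel_one')
  have comm: "x \<otimes>\<^bsub>F\<^esub> y = y \<otimes>\<^bsub>F\<^esub> x" if x: "x \<in> carrier F" and y: "y \<in> carrier F" for x y
    using x
  proof (induction x rule: mon_induct)
    case (basis a u)
    from y show ?case
    proof (induction y rule: mon_induct)
      case (basis b v)
      then show ?case using \<open>a \<in> carrier A\<close> \<open>u \<in> carrier M\<close>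
        by (simp add: mon_basis_mult A.m_comm M.m_comm)
    qed (use basis in \<open>simp_all add: l0 r0 mon_distrib\<close>)
  qed (use y in \<open>simp_all add: l0 r0 mon_distrib\<close>)
  have assoc: "x \<otimes>\<^bsub>F\<^esub> y \<otimes>\<^bsub>F\<^esub> w = x \<otimes>\<^bsub>F\<^esub> (y \<otimes>\<^bsub>F\<^esub> w)"
    if x: "x \<in> carrier F" and y: "y \<in> carrier F" and w: "w \<in> carrier F" for x y w
    using x
  proof (induction x rule: mon_induct)
    case (basis a u)
    from y show ?case
    proof (induction y rule: mon_induct)
      case (basis b v)
      from w show ?case
      proof (induction w rule: mon_induct)
        case (basis c t)
        with \<open>a \<in> carrier A\<close> \<open>u \<in> carrier M\<close> \<open>b \<in> carrier A\<close> \<open>v \<in> carrier M\<close> show ?case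
          by (simp add: mon_basis_mult A.m_assoc M.m_assoc)
      qed (use basis \<open>a \<in> carrier A\<close> \<open>u \<in> carrier M\<close> in \<open>simp_all add: l0 r0 mon_distrib\<close>)
    qed (use basis w in \<open>simp_all add: l0 r0 mon_distrib\<close>)
  qed (use y w in \<open>simp_all add: l0 r0 mon_distrib\<close>)
  have one1: "\<one> \<odot>\<^bsub>F\<^esub> x = x" if "x \<in> carrier F" for x using that by (simp add: mon_ops)
  have one: "\<one>\<^bsub>F\<^esub> \<otimes>\<^bsub>F\<^esub> x = x" if x: "x \<in> carrier F" for x
    using x
  proof (induction x rule: mon_induct)
    case (basis a u)
    then have "(\<one> \<odot>\<^bsub>F\<^esub> \<delta> \<one>\<^bsub>M\<^esub>) \<otimes>\<^bsub>F\<^esub> (a \<odot>\<^bsub>F\<^esub> \<delta> u) = a \<odot>\<^bsub>F\<^esub> \<delta> u"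
      by (subst mon_basis_mult) auto
    then show ?case by (simp add: one1 mon_ops(4))
  qed (simp_all add: r0 mon_distrib mon_ops(4))
  have "\<one>\<^bsub>F\<^esub> \<in> carrier F" by (simp add: mon_ops(4))
  then have "cring F"
    by (intro cringI[OF ab] comm_monoidI) (simp_all add: one assoc mon_distrib, rule comm)
  then show ?thesis
    by (intro algebraI A.is_cring) (auto simp: sm, auto simp: mon_ops l_distr r_distr A.m_assoc)
qed

end

lemma (in mon_algebra) mon_basis_mult_one:
  assumes "u \<in> carrier M" "v \<in> carrier M"
  shows "\<delta> u \<otimes>\<^bsub>F\<^esub> \<delta> v = \<delta> (u \<otimes>\<^bsub>M\<^esub> v)"
proof -
  interpret F: algebra A F by (rule mon_algebra)
  show ?thesis using mon_basis_mult[OF A.one_closed A.one_closed assms] assms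
    by (simp add: mon_basis_closed)
qed

text \<open>Universal property of the monoid algebra: a monoid homomorphism into the multiplicative
  monoid of E extends linearly to an algebra homomorphism.\<close>

lemma mon_eval_alg_hom:
  assumes "mon_algebra A M" "algebra A E"
    and h: "\<And>u. u \<in> carrier M \<Longrightarrow> h u \<in> carrier E"
      "\<And>u v. u \<in> carrier M \<Longrightarrow> v \<in> carrier M \<Longrightarrow> h (u \<otimes>\<^bsub>M\<^esub> v) = h u \<otimes>\<^bsub>E\<^esub> h v"
      "h \<one>\<^bsub>M\<^esub> = \<one>\<^bsub>E\<^esub>"
  shows "mon_eval A E h \<in> alg_hom A (mon_alg A M) E"
    and "u \<in> carrier M \<Longrightarrow> mon_eval A E h (mon_basis A u) = h u"
proof -
  interpret mon_algebra A M by fact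
  interpret E: algebra A E by fact
  interpret F: algebra A F by (rule mon_algebra)
  \<comment> \<open>The sum may run over any finite set containing the support, so the evaluations
    of f, g and f + g can share one index set.\<close>
  have ev: "mon_eval A E h f = (\<Oplus>\<^bsub>E\<^esub>m\<in>S. f m \<odot>\<^bsub>E\<^esub> h m)"
    if "f \<in> carrier F" "finite S" "supp f \<subseteq> S" "S \<subseteq> carrier M" for f S
    unfolding mon_eval_def using that h(1) mon_carrierD[OF that(1)]
    by (intro E.M.add.finprod_mono_neutral_cong_left) auto
  have b: "mon_eval A E h (a \<odot>\<^bsub>F\<^esub> \<delta> u) = a \<odot>\<^bsub>E\<^esub> h u" if "a \<in> carrier A" "u \<in> carrier M" for a u
    using that h(1) by (subst ev[of _ "{u}"]) (auto simp: mon_smult_closed mon_basis_closed, auto simp: mon_ops mon_basis_def split: if_splits)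
  have b1: "mon_eval A E h (\<delta> u) = h u" if "u \<in> carrier M" for u
    using b[of "\<one>\<^bsub>A\<^esub>" u] that h(1) by (simp add: mon_basis_closed)
  then show "u \<in> carrier M \<Longrightarrow> mon_eval A E h (mon_basis A u) = h u" .
  have cl: "mon_eval A E h f \<in> carrier E" if "f \<in> carrier F" for f
    unfolding mon_eval_def using that h(1) mon_carrierD[OF that]
    by (intro E.finsum_closed) auto
  have add: "mon_eval A E h (f \<oplus>\<^bsub>F\<^esub> g) = mon_eval A E h f \<oplus>\<^bsub>E\<^esub> mon_eval A E h g"
    if f: "f \<in> carrier F" and g: "g \<in> carrier F" for f g
  proof -
    let ?S = "supp f \<union> supp g"
    note D = mon_carrierD[OF f] mon_carrierD[OF g]
    have S: "finite ?S" "?S \<subseteq> carrier M" "supp (f \<oplus>\<^bsub>F\<^esub> g) \<subseteq> ?S" using D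
      by (auto simp: mon_ops)
    then have hS: "h m \<in> carrier E" if "m \<in> ?S" for m using that h(1) by blast
    show ?thesis
      apply (subst ev[of "f \<oplus>\<^bsub>F\<^esub> g" ?S], simp_all only: S mon_add_closed f g)
      apply (subst ev[of f ?S], use S f in auto)
      apply (subst ev[of g ?S], use S g in auto)
      using hS mon_carrierD(1)[OF f] mon_carrierD(1)[OF g]
      by (subst E.finsum_addf[symmetric], blast, blast, intro E.finsum_cong')
         (auto simp: E.smult_l_distr mon_ops(2))
  qed
  have zero: "mon_eval A E h \<zero>\<^bsub>F\<^esub> = \<zero>\<^bsub>E\<^esub>" by (simp add: mon_eval_def mon_ops)
  have sm: "mon_eval A E h (a \<odot>\<^bsub>F\<^esub> f) = a \<odot>\<^bsub>E\<^esub> mon_eval A E h f"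
    if a: "a \<in> carrier A" and f: "f \<in> carrier F" for a f
    using f
  proof (induction f rule: mon_induct)
    case (basis b u)
    then show ?case using a h(1) by (simp add: b mon_basis_closed flip: F.smult_assoc1 E.smult_assoc1)
  qed (use a in \<open>simp_all add: zero F.smult_r_distr E.smult_r_distr add cl\<close>)
  have mult: "mon_eval A E h (f \<otimes>\<^bsub>F\<^esub> g) = mon_eval A E h f \<otimes>\<^bsub>E\<^esub> mon_eval A E h g"
    if f: "f \<in> carrier F" and g: "g \<in> carrier F" for f g
    using f
  proof (induction f rule: mon_induct)
    case (basis a u)
    from g show ?case
    proof (induction g rule: mon_induct)
      case (basis c v)
      with \<open>a \<in> carrier A\<close> \<open>u \<in> carrier M\<close> show ?case using h(1)
        by (simp add: mon_basis_mult b h(2) E.smult_assoc2 E.smult_assoc1 E.m_comm[of "h u"])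
    qed (use basis in \<open>simp_all add: mon_basis_closed zero F.r_distr E.r_distr add cl\<close>)
  qed (use g in \<open>simp_all add: zero F.l_distr E.l_distr add cl\<close>)
  show "mon_eval A E h \<in> alg_hom A F E"
    by (rule alg_homI) (simp_all add: cl add mult sm mon_ops(4) b1 h(3))
qed

lemma mon_alg_hom_eq:
  assumes "mon_algebra A M" "algebra A E" "f \<in> alg_hom A (mon_alg A M) E" "g \<in> alg_hom A (mon_alg A M) E"
    and "\<And>u. u \<in> carrier M \<Longrightarrow> f (mon_basis A u) = g (mon_basis A u)"
    and "x \<in> carrier (mon_alg A M)"
  shows "f x = g x"
proof -
  interpret mon_algebra A M by fact
  note a = mon_algebra
  show ?thesis
    using assms(6)
    by (induction x rule: mon_induct)
      (simp_all add: alg_homD[OF assms(3)] alg_homD[OF assms(4)] mon_basis_closed assms(5)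
        alg_hom_zero_inv[OF assms(3) a assms(2)] alg_hom_zero_inv[OF assms(4) a assms(2)])
qed

section \<open>Quotients and tensor products\<close>

lemma quot_alg_simps:
  "carrier (quot_alg B I) = a_rcosets\<^bsub>B\<^esub> I" "\<one>\<^bsub>quot_alg B I\<^esub> = I +>\<^bsub>B\<^esub> \<one>\<^bsub>B\<^esub>"
  "\<zero>\<^bsub>quot_alg B I\<^esub> = I" "X \<otimes>\<^bsub>quot_alg B I\<^esub> Y = rcoset_mult B I X Y"
  "X \<oplus>\<^bsub>quot_alg B I\<^esub> Y = X <+>\<^bsub>B\<^esub> Y"
  "a \<odot>\<^bsub>quot_alg B I\<^esub> X = (\<Union>x\<in>X. I +>\<^bsub>B\<^esub> (a \<odot>\<^bsub>B\<^esub> x))"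
  by (simp_all add: quot_alg_def FactRing_def)

lemma quot_carrier:
  "X \<in> carrier (quot_alg B I) \<longleftrightarrow> (\<exists>x\<in>carrier B. X = I +>\<^bsub>B\<^esub> x)"
  by (auto simp: quot_alg_simps A_RCOSETS_def')

lemma quot_eq_iff:
  assumes "algebra A B" "ideal I B" "x \<in> carrier B" "y \<in> carrier B"
  shows "I +>\<^bsub>B\<^esub> x = I +>\<^bsub>B\<^esub> y \<longleftrightarrow> x \<ominus>\<^bsub>B\<^esub> y \<in> I"
proof -
  interpret algebra A B by fact
  show ?thesis using quotient_eq_iff_same_a_r_cos[OF assms(2-4)] by auto
qed

text \<open>The union in the definition of the scalar action is a single coset: representatives of X
  differ by some i in I, and a i = (a 1) i lies in I again.\<close>

lemma quot_smult:
  assumes "algebra A B" "ideal I B" "a \<in> carrier A" "x \<in> carrier B"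
  shows "a \<odot>\<^bsub>quot_alg B I\<^esub> (I +>\<^bsub>B\<^esub> x) = I +>\<^bsub>B\<^esub> (a \<odot>\<^bsub>B\<^esub> x)"
proof -
  interpret algebra A B by fact
  interpret I: ideal I B by fact
  have "I +>\<^bsub>B\<^esub> (a \<odot>\<^bsub>B\<^esub> y) = I +>\<^bsub>B\<^esub> (a \<odot>\<^bsub>B\<^esub> x)" if y: "y \<in> I +>\<^bsub>B\<^esub> x" for y
  proof -
    obtain i where i: "i \<in> I" "y = i \<oplus>\<^bsub>B\<^esub> x" using y by (auto simp: a_r_coset_def')
    then have iB: "i \<in> carrier B" using I.a_subset by auto
    with i assms(4) have yB: "y \<in> carrier B" by simp
    have "(a \<odot>\<^bsub>B\<^esub> \<one>\<^bsub>B\<^esub>) \<otimes>\<^bsub>B\<^esub> i \<in> I" using assms(3) i by (intro I.I_l_closed) auto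
    also have "(a \<odot>\<^bsub>B\<^esub> \<one>\<^bsub>B\<^esub>) \<otimes>\<^bsub>B\<^esub> i = a \<odot>\<^bsub>B\<^esub> y \<ominus>\<^bsub>B\<^esub> a \<odot>\<^bsub>B\<^esub> x"
      using assms(3,4) iB by (simp add: i smult_assoc2 M.minus_eq smult_r_distr M.a_assoc M.r_neg)
    finally show ?thesis using quot_eq_iff[OF assms(1,2), of "a \<odot>\<^bsub>B\<^esub> y" "a \<odot>\<^bsub>B\<^esub> x"] assms(3,4) yB by simp
  qed
  moreover have "x \<in> I +>\<^bsub>B\<^esub> x" using assms(4) I.a_rcos_self by blast
  ultimately show ?thesis unfolding quot_alg_simps by blast
qed

lemma quot_algebra:
  assumes "algebra A B" "ideal I B"
  shows "algebra A (quot_alg B I)"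
    and "(\<lambda>x. I +>\<^bsub>B\<^esub> x) \<in> alg_hom A B (quot_alg B I)"
proof -
  interpret algebra A B by fact
  interpret I: ideal I B by fact
  have Q: "cring (B Quot I)" by (rule I.quotient_is_cring[OF M_cring])
  interpret Q: cring "B Quot I" by (rule Q)
  have "cring (quot_alg B I)"
  proof (rule cringI)
    show "abelian_group (quot_alg B I)"
    proof (rule abelian_groupI)
      show "\<exists>y\<in>carrier (quot_alg B I). y \<oplus>\<^bsub>quot_alg B I\<^esub> x = \<zero>\<^bsub>quot_alg B I\<^esub>"
        if "x \<in> carrier (quot_alg B I)" for x
        using that Q.l_neg Q.a_inv_closed by (auto simp: quot_alg_def)
    qed (auto simp: quot_alg_def Q.a_assoc intro: Q.a_comm[THEN equalityD1, THEN subsetD] Q.a_comm[THEN equalityD2, THEN subsetD])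
    show "comm_monoid (quot_alg B I)"
      by (rule comm_monoidI) (auto simp: quot_alg_def Q.m_assoc intro: Q.m_comm[THEN equalityD1, THEN subsetD] Q.m_comm[THEN equalityD2, THEN subsetD])
  qed (auto simp: quot_alg_def Q.l_distr)
  note mult = I.rcoset_mult_add and add = I.a_rcos_sum
  have repr: "\<exists>x\<in>carrier B. X = I +>\<^bsub>B\<^esub> x" if "X \<in> carrier (quot_alg B I)" for X
    using that by (simp add: quot_carrier)
  have cl: "I +>\<^bsub>B\<^esub> x \<in> carrier (quot_alg B I)" if "x \<in> carrier B" for x
    using that by (auto simp: quot_carrier)
  note sm = quot_smult[OF assms]
  show "algebra A (quot_alg B I)"
  proof (rule algebraI)
    show "cring A" by (rule R_cring)
    show "cring (quot_alg B I)" by fact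
    show "a \<odot>\<^bsub>quot_alg B I\<^esub> x \<in> carrier (quot_alg B I)"
      if "a \<in> carrier A" "x \<in> carrier (quot_alg B I)" for a x
      using repr[OF that(2)] that(1) by (auto simp: sm cl)
    show "(a \<oplus>\<^bsub>A\<^esub> b) \<odot>\<^bsub>quot_alg B I\<^esub> x = a \<odot>\<^bsub>quot_alg B I\<^esub> x \<oplus>\<^bsub>quot_alg B I\<^esub> b \<odot>\<^bsub>quot_alg B I\<^esub> x"
      if "a \<in> carrier A" "b \<in> carrier A" "x \<in> carrier (quot_alg B I)" for a b x
      using repr[OF that(3)] that(1,2) by (auto simp: sm quot_alg_simps(5) add smult_l_distr)
    show "a \<odot>\<^bsub>quot_alg B I\<^esub> (x \<oplus>\<^bsub>quot_alg B I\<^esub> y) = a \<odot>\<^bsub>quot_alg B I\<^esub> x \<oplus>\<^bsub>quot_alg B I\<^esub> a \<odot>\<^bsub>quot_alg B I\<^esub> y"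
      if "a \<in> carrier A" "x \<in> carrier (quot_alg B I)" "y \<in> carrier (quot_alg B I)" for a x y
      using repr[OF that(3)] repr[OF that(2)] that(1) by (auto simp: sm quot_alg_simps(5) add smult_r_distr)
    show "(a \<otimes>\<^bsub>A\<^esub> b) \<odot>\<^bsub>quot_alg B I\<^esub> x = a \<odot>\<^bsub>quot_alg B I\<^esub> (b \<odot>\<^bsub>quot_alg B I\<^esub> x)"
      if "a \<in> carrier A" "b \<in> carrier A" "x \<in> carrier (quot_alg B I)" for a b x
      using repr[OF that(3)] that(1,2) by (auto simp: sm smult_assoc1)
    show "\<one>\<^bsub>A\<^esub> \<odot>\<^bsub>quot_alg B I\<^esub> x = x" if "x \<in> carrier (quot_alg B I)" for x
      using repr[OF that] by (auto simp: sm)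
    show "(a \<odot>\<^bsub>quot_alg B I\<^esub> x) \<otimes>\<^bsub>quot_alg B I\<^esub> y = a \<odot>\<^bsub>quot_alg B I\<^esub> (x \<otimes>\<^bsub>quot_alg B I\<^esub> y)"
      if "a \<in> carrier A" "x \<in> carrier (quot_alg B I)" "y \<in> carrier (quot_alg B I)" for a x y
      using repr[OF that(3)] repr[OF that(2)] that(1) by (auto simp: sm quot_alg_simps(4) mult smult_assoc2)
  qed
  show "(\<lambda>x. I +>\<^bsub>B\<^esub> x) \<in> alg_hom A B (quot_alg B I)"
    by (rule alg_homI) (auto simp: cl sm quot_alg_simps(2,4,5) mult add)
qed

lemma quot_eq_zero_iff:
  assumes "algebra A B" "ideal I B" "x \<in> carrier B"
  shows "I +>\<^bsub>B\<^esub> x = \<zero>\<^bsub>quot_alg B I\<^esub> \<longleftrightarrow> x \<in> I"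
proof -
  interpret algebra A B by fact
  interpret I: ideal I B by fact
  show ?thesis
    using quot_eq_iff[OF assms zero_closed] a_rcos_zero[OF assms(2), of "\<zero>\<^bsub>B\<^esub>"] assms(3)
    by (simp add: quot_alg_simps(3) M.minus_eq)
qed

text \<open>A homomorphism killing I maps each coset to a singleton, which is what gives
  \<open>the_elem\<close> its meaning.\<close>

lemma quot_lift:
  assumes "algebra A B" "ideal I B" "algebra A C" "f \<in> alg_hom A B C"
    and "\<And>x. x \<in> I \<Longrightarrow> f x = \<zero>\<^bsub>C\<^esub>"
  shows "quot_lift f \<in> alg_hom A (quot_alg B I) C"
    and "\<And>x. x \<in> carrier B \<Longrightarrow> quot_lift f (I +>\<^bsub>B\<^esub> x) = f x"
proof -
  interpret algebra A B by fact
  interpret I: ideal I B by fact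
  interpret C: algebra A C by fact
  note fD = alg_homD[OF assms(4)]
  show L: "quot_lift f (I +>\<^bsub>B\<^esub> x) = f x" if x: "x \<in> carrier B" for x
  proof -
    have "f y = f x" if y: "y \<in> I +>\<^bsub>B\<^esub> x" for y
    proof -
      obtain i where i: "i \<in> I" "y = i \<oplus>\<^bsub>B\<^esub> x" using y by (auto simp: a_r_coset_def')
      then have "i \<in> carrier B" using I.a_subset by auto
      with i x show ?thesis by (simp add: fD assms(5))
    qed
    moreover have "x \<in> I +>\<^bsub>B\<^esub> x" using x I.a_rcos_self by blast
    ultimately have "f ` (I +>\<^bsub>B\<^esub> x) = {f x}" by blast
    then show ?thesis by (simp add: quot_lift_def)
  qed
  note q = alg_homD(3-6)[OF quot_algebra(2)[OF assms(1,2)], symmetric]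
  show "quot_lift f \<in> alg_hom A (quot_alg B I) C"
    by (rule alg_homI) (auto simp: quot_carrier q L fD)
qed

lemma alg_hom_genideal_zero:
  assumes "algebra A B" "algebra A C" "f \<in> alg_hom A B C"
    and "X \<subseteq> carrier B" "\<And>x. x \<in> X \<Longrightarrow> f x = \<zero>\<^bsub>C\<^esub>" "x \<in> Idl\<^bsub>B\<^esub> X"
  shows "f x = \<zero>\<^bsub>C\<^esub>"
proof -
  interpret algebra A B by fact
  interpret C: algebra A C by fact
  have "ring_hom_ring B C f"
    by (intro ring_hom_ringI2 alg_homD(1)[OF assms(3)] cring.axioms(1) M_cring C.M_cring)
  have "Idl\<^bsub>B\<^esub> X \<subseteq> a_kernel B C f"
    using assms(4,5) \<open>ring_hom_ring B C f\<close> by (intro genideal_minimal ring_hom_ring.kernel_is_ideal) (auto simp: a_kernel_def' )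
  with assms(6) show ?thesis by (auto simp: a_kernel_def')
qed

lemma (in algebra) smult_r_mult:
  "a \<in> carrier R \<Longrightarrow> x \<in> carrier M \<Longrightarrow> y \<in> carrier M \<Longrightarrow> x \<otimes>\<^bsub>M\<^esub> (a \<odot>\<^bsub>M\<^esub> y) = a \<odot>\<^bsub>M\<^esub> (x \<otimes>\<^bsub>M\<^esub> y)"
  by (simp add: m_comm[of x] smult_assoc2)

lemma tensor_mon_algebra:
  assumes "algebra A B" "algebra A C"
  shows "mon_algebra A (B \<times>\<times> C)"
proof -
  interpret B: algebra A B by fact
  interpret C: algebra A C by fact
  have "comm_monoid (B \<times>\<times> C)"
    by (rule comm_monoidI) (auto simp: DirProd_def B.m_assoc C.m_assoc intro: B.m_comm C.m_comm)
  then show ?thesis by (intro mon_algebra.intro B.R_cring)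
qed

context
  fixes A :: "('a, 'm) ring_scheme" and B :: "('a, 'b, 'n) module_scheme" and C :: "('a, 'c, 'p) module_scheme"
  assumes B: "algebra A B" and C: "algebra A C"
begin

interpretation B: algebra A B by (rule B)
interpretation C: algebra A C by (rule C)
interpretation F: mon_algebra A "B \<times>\<times> C" by (rule tensor_mon_algebra[OF B C])
interpretation F: algebra A "tensor_free A B C" unfolding tensor_free_def by (rule F.mon_algebra)

lemma tensor_basis_closed:
  "b \<in> carrier B \<Longrightarrow> c \<in> carrier C \<Longrightarrow> mon_basis A (b, c) \<in> carrier (tensor_free A B C)"
  by (simp add: tensor_free_def F.mon_basis_closed)

lemma tensor_ideal_ideal: "ideal (tensor_ideal A B C) (tensor_free A B C)"
  and tensor_rel_closed: "tensor_rel A B C \<subseteq> carrier (tensor_free A B C)"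
proof -
  show "tensor_rel A B C \<subseteq> carrier (tensor_free A B C)"
    unfolding tensor_rel_def Let_def by (auto intro!: F.minus_closed tensor_basis_closed)
  then show "ideal (tensor_ideal A B C) (tensor_free A B C)"
    unfolding tensor_ideal_def by (rule F.genideal_ideal)
qed

lemma tensor_algebra: "algebra A (tensor A B C)"
  unfolding tensor_def by (intro quot_algebra tensor_ideal_ideal F.algebra_axioms)

interpretation T: algebra A "tensor A B C" by (rule tensor_algebra)

lemma tensor_elt_closed [simp]:
  "b \<in> carrier B \<Longrightarrow> c \<in> carrier C \<Longrightarrow> tensor_elt A B C b c \<in> carrier (tensor A B C)"
  unfolding tensor_def tensor_elt_def quot_carrier using tensor_basis_closed by blast

lemma tensor_relation:
  assumes "p \<ominus>\<^bsub>tensor_free A B C\<^esub> q \<in> tensor_rel A B C" "p \<in> carrier (tensor_free A B C)" "q \<in> carrier (tensor_free A B C)"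
  shows "tensor_ideal A B C +>\<^bsub>tensor_free A B C\<^esub> p = tensor_ideal A B C +>\<^bsub>tensor_free A B C\<^esub> q"
  using F.genideal_self[OF tensor_rel_closed] assms
  by (subst quot_eq_iff[OF F.algebra_axioms tensor_ideal_ideal]) (auto simp: tensor_ideal_def)

lemma tensor_elt_bilinear:
  shows "\<And>b b' c. b \<in> carrier B \<Longrightarrow> b' \<in> carrier B \<Longrightarrow> c \<in> carrier C \<Longrightarrow>
      tensor_elt A B C (b \<oplus>\<^bsub>B\<^esub> b') c = tensor_elt A B C b c \<oplus>\<^bsub>tensor A B C\<^esub> tensor_elt A B C b' c"
    and "\<And>b c c'. b \<in> carrier B \<Longrightarrow> c \<in> carrier C \<Longrightarrow> c' \<in> carrier C \<Longrightarrow>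
      tensor_elt A B C b (c \<oplus>\<^bsub>C\<^esub> c') = tensor_elt A B C b c \<oplus>\<^bsub>tensor A B C\<^esub> tensor_elt A B C b c'"
    and "\<And>a b c. a \<in> carrier A \<Longrightarrow> b \<in> carrier B \<Longrightarrow> c \<in> carrier C \<Longrightarrow>
      tensor_elt A B C (a \<odot>\<^bsub>B\<^esub> b) c = a \<odot>\<^bsub>tensor A B C\<^esub> tensor_elt A B C b c"
    and "\<And>a b c. a \<in> carrier A \<Longrightarrow> b \<in> carrier B \<Longrightarrow> c \<in> carrier C \<Longrightarrow>
      tensor_elt A B C b (a \<odot>\<^bsub>C\<^esub> c) = a \<odot>\<^bsub>tensor A B C\<^esub> tensor_elt A B C b c"
  unfolding tensor_elt_def tensor_def
     alg_homD(3,6)[OF quot_algebra(2)[OF F.algebra_axioms tensor_ideal_ideal], symmetric]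
  subgoal for b b' c
    by (subst alg_homD(3)[OF quot_algebra(2)[OF F.algebra_axioms tensor_ideal_ideal], symmetric];
      (intro tensor_relation)?; (simp add: tensor_basis_closed)?)
      (unfold tensor_rel_def Let_def, blast)
  subgoal for b c c'
    by (subst alg_homD(3)[OF quot_algebra(2)[OF F.algebra_axioms tensor_ideal_ideal], symmetric];
      (intro tensor_relation)?; (simp add: tensor_basis_closed)?)
      (unfold tensor_rel_def Let_def, blast)
  subgoal for a b c
    by (subst alg_homD(6)[OF quot_algebra(2)[OF F.algebra_axioms tensor_ideal_ideal], symmetric];
      (intro tensor_relation)?; (simp add: tensor_basis_closed)?)
      (unfold tensor_rel_def Let_def, blast)
  subgoal for a b c
    by (subst alg_homD(6)[OF quot_algebra(2)[OF F.algebra_axioms tensor_ideal_ideal], symmetric];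
      (intro tensor_relation)?; (simp add: tensor_basis_closed)?)
      (unfold tensor_rel_def Let_def, blast)
  done

lemma tensor_elt_mult:
  assumes "b \<in> carrier B" "b' \<in> carrier B" "c \<in> carrier C" "c' \<in> carrier C"
  shows "tensor_elt A B C b c \<otimes>\<^bsub>tensor A B C\<^esub> tensor_elt A B C b' c' =
    tensor_elt A B C (b \<otimes>\<^bsub>B\<^esub> b') (c \<otimes>\<^bsub>C\<^esub> c')"
proof -
  have "mon_basis A (b, c) \<otimes>\<^bsub>tensor_free A B C\<^esub> mon_basis A (b', c') =
      mon_basis A (b \<otimes>\<^bsub>B\<^esub> b', c \<otimes>\<^bsub>C\<^esub> c')"
    using assms F.mon_basis_mult_one[of "(b, c)" "(b', c')"] by (simp add: tensor_free_def)
  then show ?thesis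
    using assms unfolding tensor_elt_def tensor_def
    by (subst alg_homD(4)[OF quot_algebra(2)[OF F.algebra_axioms tensor_ideal_ideal], symmetric])
      (simp_all add: tensor_basis_closed)
qed

lemma tensor_one: "\<one>\<^bsub>tensor A B C\<^esub> = tensor_elt A B C \<one>\<^bsub>B\<^esub> \<one>\<^bsub>C\<^esub>"
  unfolding tensor_elt_def tensor_def
  by (subst alg_homD(5)[OF quot_algebra(2)[OF F.algebra_axioms tensor_ideal_ideal], symmetric])
     (simp add: tensor_free_def F.mon_ops(4))

lemma tensor_inl: "(\<lambda>b. tensor_elt A B C b \<one>\<^bsub>C\<^esub>) \<in> alg_hom A B (tensor A B C)"
  by (rule alg_homI) (simp_all add: tensor_elt_bilinear tensor_elt_mult tensor_one)

lemma tensor_inr: "(\<lambda>c. tensor_elt A B C \<one>\<^bsub>B\<^esub> c) \<in> alg_hom A C (tensor A B C)"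
  by (rule alg_homI) (simp_all add: tensor_elt_bilinear tensor_elt_mult tensor_one)

lemma tensor_elt_split:
  assumes "b \<in> carrier B" "c \<in> carrier C"
  shows "tensor_elt A B C b c = tensor_elt A B C b \<one>\<^bsub>C\<^esub> \<otimes>\<^bsub>tensor A B C\<^esub> tensor_elt A B C \<one>\<^bsub>B\<^esub> c"
  using assms by (simp add: tensor_elt_mult)

text \<open>Since b \<otimes> c = (b \<otimes> 1)(1 \<otimes> c), agreement on the two factors gives
  agreement on all pure tensors. These are the images of the basis of the monoid algebra, to which
  both maps are pulled back.\<close>

lemma tensor_alg_hom_eq:
  assumes "algebra A E" "f \<in> alg_hom A (tensor A B C) E" "g \<in> alg_hom A (tensor A B C) E"
    and l: "\<And>b. b \<in> carrier B \<Longrightarrow> f (tensor_elt A B C b \<one>\<^bsub>C\<^esub>) = g (tensor_elt A B C b \<one>\<^bsub>C\<^esub>)"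
    and r: "\<And>c. c \<in> carrier C \<Longrightarrow> f (tensor_elt A B C \<one>\<^bsub>B\<^esub> c) = g (tensor_elt A B C \<one>\<^bsub>B\<^esub> c)"
    and x: "x \<in> carrier (tensor A B C)"
  shows "f x = g x"
proof -
  let ?p = "\<lambda>x. tensor_ideal A B C +>\<^bsub>tensor_free A B C\<^esub> x"
  have p: "?p \<in> alg_hom A (tensor_free A B C) (tensor A B C)"
    unfolding tensor_def by (rule quot_algebra[OF F.algebra_axioms tensor_ideal_ideal])
  have "f (?p y) = g (?p y)" if "y \<in> carrier (tensor_free A B C)" for y
  proof (rule mon_alg_hom_eq[OF tensor_mon_algebra[OF B C] assms(1)])
    show "(\<lambda>y. f (?p y)) \<in> alg_hom A (mon_alg A (B \<times>\<times> C)) E" "(\<lambda>y. g (?p y)) \<in> alg_hom A (mon_alg A (B \<times>\<times> C)) E"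
      using alg_hom_comp[OF p assms(2)] alg_hom_comp[OF p assms(3)] by (simp_all add: tensor_free_def)
    show "y \<in> carrier (mon_alg A (B \<times>\<times> C))" using that by (simp add: tensor_free_def)
    fix u assume "u \<in> carrier (B \<times>\<times> C)"
    then obtain b c where u: "u = (b, c)" "b \<in> carrier B" "c \<in> carrier C" by auto
    have "f (tensor_elt A B C b c) = g (tensor_elt A B C b c)"
      using u(2,3) unfolding tensor_elt_split[OF u(2,3)]
      by (simp add: alg_homD(4)[OF assms(2)] alg_homD(4)[OF assms(3)] l r)
    then show "f (?p (mon_basis A u)) = g (?p (mon_basis A u))" by (simp add: u(1) tensor_elt_def)
  qed
  then show ?thesis using x by (auto simp: tensor_def quot_carrier)
qed

text \<open>The tensor product is the coproduct of commutative algebras. Commutativity of E makes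
  (b, c) \<mapsto> f b g c multiplicative, and linearity of f and g kills the four families of
  relations.\<close>

lemma tensor_lift:
  assumes "algebra A E" "f \<in> alg_hom A B E" "g \<in> alg_hom A C E"
  shows "tensor_lift A E f g \<in> alg_hom A (tensor A B C) E"
    and "\<And>b c. b \<in> carrier B \<Longrightarrow> c \<in> carrier C \<Longrightarrow>
      tensor_lift A E f g (tensor_elt A B C b c) = f b \<otimes>\<^bsub>E\<^esub> g c"
proof -
  interpret E: algebra A E by fact
  note fD = alg_homD[OF assms(2)] and gD = alg_homD[OF assms(3)]
  let ?h = "\<lambda>p. f (fst p) \<otimes>\<^bsub>E\<^esub> g (snd p)"
  have ev: "mon_eval A E ?h \<in> alg_hom A (tensor_free A B C) E"
    "\<And>b c. b \<in> carrier B \<Longrightarrow> c \<in> carrier C \<Longrightarrow> mon_eval A E ?h (mon_basis A (b, c)) = f b \<otimes>\<^bsub>E\<^esub> g c"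
    unfolding tensor_free_def
    by (rule mon_eval_alg_hom[OF tensor_mon_algebra[OF B C] assms(1)];
      auto simp: DirProd_def fD gD E.m_ac)
      (subst mon_eval_alg_hom(2)[OF tensor_mon_algebra[OF B C] assms(1)];
      auto simp: DirProd_def fD gD E.m_ac)
  note z = alg_hom_zero_inv(3)[OF ev(1) F.algebra_axioms assms(1)]
  note evD = alg_homD[OF ev(1)]
  have "mon_eval A E ?h x = \<zero>\<^bsub>E\<^esub>" if "x \<in> tensor_ideal A B C" for x
  proof (rule alg_hom_genideal_zero[OF F.algebra_axioms assms(1) ev(1) tensor_rel_closed])
    show "x \<in> Idl\<^bsub>tensor_free A B C\<^esub> tensor_rel A B C" using that by (simp add: tensor_ideal_def)
    fix y assume "y \<in> tensor_rel A B C"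
    then show "mon_eval A E ?h y = \<zero>\<^bsub>E\<^esub>"
      unfolding tensor_rel_def Let_def
      by (auto simp: z evD ev(2) tensor_basis_closed fD gD E.l_distr E.r_distr E.smult_assoc2
          E.smult_r_mult E.minus_eq E.r_neg)
  qed
  note ql = quot_lift[OF F.algebra_axioms tensor_ideal_ideal assms(1) ev(1) this]
  show "tensor_lift A E f g \<in> alg_hom A (tensor A B C) E"
    unfolding tensor_lift_def tensor_def by (rule ql(1))
  show "\<And>b c. b \<in> carrier B \<Longrightarrow> c \<in> carrier C \<Longrightarrow>
      tensor_lift A E f g (tensor_elt A B C b c) = f b \<otimes>\<^bsub>E\<^esub> g c"
    unfolding tensor_lift_def tensor_elt_def by (subst ql(2)) (simp_all add: tensor_basis_closed ev(2))
qed

end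

lemma tensor_map:
  assumes "algebra A B" "algebra A C" "algebra A X" "algebra A Y" "f \<in> alg_hom A X B" "g \<in> alg_hom A Y C"
  shows "tensor_map A B C f g \<in> alg_hom A (tensor A X Y) (tensor A B C)"
    and "\<And>x y. x \<in> carrier X \<Longrightarrow> y \<in> carrier Y \<Longrightarrow>
      tensor_map A B C f g (tensor_elt A X Y x y) = tensor_elt A B C (f x) (g y)"
proof -
  note T = tensor_algebra[OF assms(1,2)]
  note h = alg_hom_comp[OF assms(5) tensor_inl[OF assms(1,2)]]
    alg_hom_comp[OF assms(6) tensor_inr[OF assms(1,2)]]
  note L = tensor_lift[OF assms(3,4) T h]
  show "tensor_map A B C f g \<in> alg_hom A (tensor A X Y) (tensor A B C)"
    unfolding tensor_map_def by (rule L(1))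
  show "\<And>x y. x \<in> carrier X \<Longrightarrow> y \<in> carrier Y \<Longrightarrow>
      tensor_map A B C f g (tensor_elt A X Y x y) = tensor_elt A B C (f x) (g y)"
    unfolding tensor_map_def L(2)
    by (rule tensor_elt_split[symmetric]) (simp_all add: assms(1,2) alg_homD(2)[OF assms(5)] alg_homD(2)[OF assms(6)])
qed

lemma tensor_assoc:
  assumes "algebra A B" "algebra A C" "algebra A D"
  shows "tensor_assoc A B C D \<in> alg_hom A (tensor A (tensor A B C) D) (tensor A B (tensor A C D))"
    and "\<And>x y z. x \<in> carrier B \<Longrightarrow> y \<in> carrier C \<Longrightarrow> z \<in> carrier D \<Longrightarrow>
      tensor_assoc A B C D (tensor_elt A (tensor A B C) D (tensor_elt A B C x y) z) =
      tensor_elt A B (tensor A C D) x (tensor_elt A C D y z)"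
proof -
  let ?BC = "tensor A B C" and ?CD = "tensor A C D"
  let ?E = "tensor A B ?CD"
  note BC = tensor_algebra[OF assms(1,2)] and CD = tensor_algebra[OF assms(2,3)]
  note E = tensor_algebra[OF assms(1) CD]
  note c = alg_hom_comp[OF tensor_inl[OF assms(2,3)] tensor_inr[OF assms(1) CD]]
    alg_hom_comp[OF tensor_inr[OF assms(2,3)] tensor_inr[OF assms(1) CD]]
  note L1 = tensor_lift[OF assms(1,2) E tensor_inl[OF assms(1) CD] c(1)]
  note L2 = tensor_lift[OF BC assms(3) E L1(1) c(2)]
  show "tensor_assoc A B C D \<in> alg_hom A (tensor A (tensor A B C) D) (tensor A B (tensor A C D))"
    unfolding tensor_assoc_def Let_def by (rule L2(1))
  interpret B: algebra A B by fact
  interpret C: algebra A C by fact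
  interpret D: algebra A D by fact
  interpret CD: algebra A ?CD by (rule CD)
  show "tensor_assoc A B C D (tensor_elt A ?BC D (tensor_elt A B C x y) z) =
      tensor_elt A B ?CD x (tensor_elt A C D y z)"
    if "x \<in> carrier B" "y \<in> carrier C" "z \<in> carrier D" for x y z
    using that unfolding tensor_assoc_def Let_def
    by (subst L2(2)) (simp_all add: L1(2) tensor_elt_mult tensor_elt_closed tensor_algebra assms)
qed

section \<open>Hopf algebras generated by an idempotent\<close>

text \<open>
  On idempotents, regarded as functions with values \<open>0\<close> and \<open>1\<close>, this is the truth value of \<open>x = y\<close>, that
  is, the group law of \<open>\<int>/2\<close> with neutral element \<open>1\<close>.
\<close>

definition xnor :: "('b, 'n) ring_scheme \<Rightarrow> 'b \<Rightarrow> 'b \<Rightarrow> 'b" where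
  "xnor R x y = \<one>\<^bsub>R\<^esub> \<oplus>\<^bsub>R\<^esub> [(2::nat)] \<cdot>\<^bsub>R\<^esub> (x \<otimes>\<^bsub>R\<^esub> y) \<ominus>\<^bsub>R\<^esub> y \<ominus>\<^bsub>R\<^esub> x"

context cring begin
lemma add_pow_two: "x \<in> carrier R \<Longrightarrow> add_pow R (2::nat) x = x \<oplus> x"
  by (simp add: numeral_2_eq_2)

lemma xnor_closed [simp]: "x \<in> carrier R \<Longrightarrow> y \<in> carrier R \<Longrightarrow> xnor R x y \<in> carrier R"
  by (simp add: xnor_def)

text \<open>The reading "both or neither". Together with "exactly one" in \<open>xnor_compl\<close>
  it turns later computations into bookkeeping with the pairs x, 1 - x.\<close>

lemma xnor_alt:
  assumes "x \<in> carrier R" "y \<in> carrier R"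
  shows "xnor R x y = x \<otimes> y \<oplus> (\<one> \<ominus> x) \<otimes> (\<one> \<ominus> y)"
  using assms unfolding xnor_def by (simp add: add_pow_two) algebra

lemma xnor_compl:
  assumes "x \<in> carrier R" "y \<in> carrier R"
  shows "\<one> \<ominus> xnor R x y = x \<otimes> (\<one> \<ominus> y) \<oplus> (\<one> \<ominus> x) \<otimes> y"
  using assms unfolding xnor_def by (simp add: add_pow_two) algebra

lemma xnor_one [simp]: "x \<in> carrier R \<Longrightarrow> xnor R \<one> x = x" "x \<in> carrier R \<Longrightarrow> xnor R x \<one> = x"
  by (simp_all add: xnor_alt r_neg minus_eq)

lemma xnor_assoc:
  assumes "x \<in> carrier R" "y \<in> carrier R" "w \<in> carrier R"
  shows "xnor R (xnor R x y) w = xnor R x (xnor R y w)"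
proof -
  \<comment> \<open>The complements are treated as independent variables x', y', w'. Both sides are
    then the sum of the four products with an even number of primed factors.\<close>
  have *: "(x \<otimes> y \<oplus> x' \<otimes> y') \<otimes> w \<oplus> (x \<otimes> y' \<oplus> x' \<otimes> y) \<otimes> w' = x \<otimes> (y \<otimes> w \<oplus> y' \<otimes> w') \<oplus> x' \<otimes> (y \<otimes> w' \<oplus> y' \<otimes> w)"
    if "x' \<in> carrier R" "y' \<in> carrier R" "w' \<in> carrier R" for x' y' w'
    using assms that by algebra
  show ?thesis
    unfolding xnor_alt[OF xnor_closed[OF assms(1,2)] assms(3)] xnor_alt[OF assms(1) xnor_closed[OF assms(2,3)]]
      xnor_compl[OF assms(1,2)] xnor_compl[OF assms(2,3)]
    unfolding xnor_alt[OF assms(1,2)] xnor_alt[OF assms(2,3)]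
    using assms by (intro *) auto
qed

lemma compl_idem:
  assumes "x \<in> carrier R" "x \<otimes> x = x"
  shows "x \<otimes> (\<one> \<ominus> x) = \<zero>" "(\<one> \<ominus> x) \<otimes> x = \<zero>" "(\<one> \<ominus> x) \<otimes> (\<one> \<ominus> x) = \<one> \<ominus> x" "x \<oplus> (\<one> \<ominus> x) = \<one>"
proof -
  show *: "x \<otimes> (\<one> \<ominus> x) = \<zero>" using assms by (simp add: minus_eq r_distr r_minus r_neg)
  then show "(\<one> \<ominus> x) \<otimes> x = \<zero>" using assms by (simp add: m_comm)
  have "(\<one> \<ominus> x) \<otimes> (\<one> \<ominus> x) = (\<one> \<ominus> x) \<ominus> x \<otimes> (\<one> \<ominus> x)"
    using assms(1) by algebra
  then show "(\<one> \<ominus> x) \<otimes> (\<one> \<ominus> x) = \<one> \<ominus> x"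
    using assms(1) unfolding * by (simp add: minus_eq)
  show "x \<oplus> (\<one> \<ominus> x) = \<one>" using assms(1) by algebra
qed

lemma xnor_self:
  assumes "x \<in> carrier R" "x \<otimes> x = x"
  shows "xnor R x x = \<one>"
  using assms by (simp add: xnor_alt compl_idem)

lemma xnor_idem:
  assumes "x \<in> carrier R" "y \<in> carrier R" and i: "x \<otimes> x = x" "y \<otimes> y = y"
  shows "xnor R x y \<otimes> xnor R x y = xnor R x y"
proof -
  \<comment> \<open>Again x', y' stand for the complements: x y and x' y' are orthogonal
    idempotents, as every cross term contains x x'.\<close>
  have *: "(x \<otimes> y \<oplus> x' \<otimes> y') \<otimes> (x \<otimes> y \<oplus> x' \<otimes> y') =
    (x \<otimes> x) \<otimes> (y \<otimes> y) \<oplus> (x \<otimes> x') \<otimes> (y \<otimes> y') \<oplus> (x \<otimes> x') \<otimes> (y \<otimes> y') \<oplus> (x' \<otimes> x') \<otimes> (y' \<otimes> y')"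
    if "x' \<in> carrier R" "y' \<in> carrier R" for x' y'
    using assms(1,2) that by algebra
  show ?thesis
    unfolding xnor_alt[OF assms(1,2)] using assms(1,2)
    by (subst *) (simp_all add: i compl_idem)
qed
end

lemma alg_hom_xnor:
  assumes "f \<in> alg_hom A B C" "algebra A B" "algebra A C" "x \<in> carrier B" "y \<in> carrier B"
  shows "f (xnor B x y) = xnor C (f x) (f y)"
proof -
  interpret B: algebra A B by fact
  interpret C: algebra A C by fact
  show ?thesis using assms(4,5)
    by (simp add: xnor_def B.add_pow_two C.add_pow_two alg_homD[OF assms(1)] alg_hom_zero_inv(3)[OF assms(1-3)])
qed

text \<open>Regarding z as an indicator function, this is the function with value a where z is 1 and
  b where z is 0.\<close>

definition idem_comb :: "('a, 'b, 'n) module_scheme \<Rightarrow> 'b \<Rightarrow> 'a \<Rightarrow> 'a \<Rightarrow> 'b" where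
  "idem_comb H z a b = a \<odot>\<^bsub>H\<^esub> z \<oplus>\<^bsub>H\<^esub> b \<odot>\<^bsub>H\<^esub> (\<one>\<^bsub>H\<^esub> \<ominus>\<^bsub>H\<^esub> z)"

context algebra begin

lemma idem_comb_closed [simp]:
  "z \<in> carrier M \<Longrightarrow> a \<in> carrier R \<Longrightarrow> b \<in> carrier R \<Longrightarrow> idem_comb M z a b \<in> carrier M"
  by (simp add: idem_comb_def)

text \<open>The cross terms contain z (1 - z) = 0. With the next lemmas this makes (a, b) \<mapsto>
  \<open>idem_comb M z a b\<close> an algebra homomorphism from A \<times> A, with (1, 0) \<mapsto>
  z.\<close>

lemma idem_comb_mult:
  assumes "z \<in> carrier M" "z \<otimes>\<^bsub>M\<^esub> z = z"
    and "a \<in> carrier R" "b \<in> carrier R" "c \<in> carrier R" "d \<in> carrier R"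
  shows "idem_comb M z a b \<otimes>\<^bsub>M\<^esub> idem_comb M z c d = idem_comb M z (a \<otimes> c) (b \<otimes> d)"
  using assms unfolding idem_comb_def
  by (simp add: l_distr r_distr smult_assoc2 smult_r_mult compl_idem R.m_comm flip: smult_assoc1)

lemma idem_comb_add:
  assumes "z \<in> carrier M" "a \<in> carrier R" "b \<in> carrier R" "c \<in> carrier R" "d \<in> carrier R"
  shows "idem_comb M z a b \<oplus>\<^bsub>M\<^esub> idem_comb M z c d = idem_comb M z (a \<oplus> c) (b \<oplus> d)"
  using assms unfolding idem_comb_def
  by (simp add: smult_l_distr M.a_ac)

lemma idem_comb_smult:
  assumes "z \<in> carrier M" "a \<in> carrier R" "b \<in> carrier R" "c \<in> carrier R"
  shows "c \<odot>\<^bsub>M\<^esub> idem_comb M z a b = idem_comb M z (c \<otimes> a) (c \<otimes> b)"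
  using assms unfolding idem_comb_def
  by (simp add: smult_r_distr smult_assoc1)

lemma idem_comb_one:
  "z \<in> carrier M \<Longrightarrow> z \<otimes>\<^bsub>M\<^esub> z = z \<Longrightarrow> idem_comb M z \<one> \<one> = \<one>\<^bsub>M\<^esub>"
  by (simp add: idem_comb_def compl_idem)

lemma idem_comb_self: "z \<in> carrier M \<Longrightarrow> idem_comb M z \<one> \<zero> = z"
  by (simp add: idem_comb_def)

lemma idem_comb_unit: "a \<in> carrier R \<Longrightarrow> b \<in> carrier R \<Longrightarrow> idem_comb M \<one>\<^bsub>M\<^esub> a b = a \<odot>\<^bsub>M\<^esub> \<one>\<^bsub>M\<^esub>"
  by (simp add: idem_comb_def M.minus_eq M.r_neg)

end

lemma alg_hom_idem_comb:
  assumes "f \<in> alg_hom A B C" "algebra A B" "algebra A C" "x \<in> carrier B" "a \<in> carrier A" "b \<in> carrier A"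
  shows "f (idem_comb B x a b) = idem_comb C (f x) a b"
proof -
  interpret B: algebra A B by fact
  show ?thesis using assms(4-6)
    by (simp add: idem_comb_def alg_homD[OF assms(1)] alg_hom_zero_inv(3)[OF assms(1-3)])
qed

text \<open>H is A \<times> A with z in the place of (1, 0). Existence and uniqueness of the
  coordinates are stated separately because they are proved by different means; over the zero ring
  both are trivially satisfied.\<close>

locale split_algebra = algebra A H for A :: "('a, 'm) ring_scheme" and H :: "('a, 'b, 'n) module_scheme" +
  fixes z :: 'b
  assumes z_closed [simp]: "z \<in> carrier H"
    and z_idem: "z \<otimes>\<^bsub>H\<^esub> z = z"
    and split_ex: "x \<in> carrier H \<Longrightarrow> \<exists>a\<in>carrier A. \<exists>b\<in>carrier A. x = idem_comb H z a b"
    and split_inj: "\<lbrakk>a \<in> carrier A; b \<in> carrier A; c \<in> carrier A; d \<in> carrier A;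
      idem_comb H z a b = idem_comb H z c d\<rbrakk> \<Longrightarrow> a = c \<and> b = d"
begin

text \<open>Both H and the combinations of w and 1 - w in E follow the componentwise rules of A
  \<times> A, so keeping the coordinates and replacing z by w is a homomorphism.\<close>

lemma split_hom_ex:
  assumes "algebra A E" "w \<in> carrier E" "w \<otimes>\<^bsub>E\<^esub> w = w"
  shows "\<exists>f \<in> alg_hom A H E. \<forall>a\<in>carrier A. \<forall>b\<in>carrier A. f (idem_comb H z a b) = idem_comb E w a b"
proof -
  interpret E: algebra A E by fact
  \<comment> \<open>The coordinates of an element are chosen; \<open>split_inj\<close> makes the
    value of \<open>f\<close> independent of the choice.\<close>
  define P where "P = (\<lambda>x p. fst p \<in> carrier A \<and> snd p \<in> carrier A \<and> x = idem_comb H z (fst p) (snd p))"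
  define f where "f = (\<lambda>x. let p = (SOME p. P x p) in idem_comb E w (fst p) (snd p))"
  have f: "f (idem_comb H z a b) = idem_comb E w a b" if ab: "a \<in> carrier A" "b \<in> carrier A" for a b
  proof -
    define q where "q = (SOME p. P (idem_comb H z a b) p)"
    have "P (idem_comb H z a b) (a, b)" using ab by (simp add: P_def)
    then have "P (idem_comb H z a b) q" unfolding q_def by (rule someI)
    then have "a = fst q \<and> b = snd q" using split_inj[OF ab, of "fst q" "snd q"] by (simp add: P_def)
    then show ?thesis unfolding f_def q_def[symmetric] Let_def by simp
  qed
  have "f \<in> alg_hom A H E"
  proof (rule alg_homI)
    fix x assume x: "x \<in> carrier H"
    obtain a b where ab: "a \<in> carrier A" "b \<in> carrier A" "x = idem_comb H z a b" using split_ex[OF x] by blast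
    show "f x \<in> carrier E" using ab assms by (simp add: f)
    show "f (c \<odot>\<^bsub>H\<^esub> x) = c \<odot>\<^bsub>E\<^esub> f x" if "c \<in> carrier A" for c
      using ab assms that by (simp add: f idem_comb_smult E.idem_comb_smult)
    fix y assume y: "y \<in> carrier H"
    obtain c d where cd: "c \<in> carrier A" "d \<in> carrier A" "y = idem_comb H z c d" using split_ex[OF y] by blast
    show "f (x \<oplus>\<^bsub>H\<^esub> y) = f x \<oplus>\<^bsub>E\<^esub> f y" using ab cd assms by (simp add: f idem_comb_add E.idem_comb_add)
    show "f (x \<otimes>\<^bsub>H\<^esub> y) = f x \<otimes>\<^bsub>E\<^esub> f y"
      using ab cd assms z_idem by (simp add: f idem_comb_mult E.idem_comb_mult)
  next
    show "f \<one>\<^bsub>H\<^esub> = \<one>\<^bsub>E\<^esub>"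
      using f[of "\<one>\<^bsub>A\<^esub>" "\<one>\<^bsub>A\<^esub>"] assms z_idem by (simp add: idem_comb_one E.idem_comb_one)
  qed
  with f show ?thesis by blast
qed

lemma split_hom_eq:
  assumes "algebra A E" "f \<in> alg_hom A H E" "g \<in> alg_hom A H E" "f z = g z" "x \<in> carrier H"
  shows "f x = g x"
proof -
  obtain a b where ab: "a \<in> carrier A" "b \<in> carrier A" "x = idem_comb H z a b" using split_ex[OF assms(5)] by blast
  then show ?thesis
    using assms(1,4) algebra_axioms
    by (simp add: alg_hom_idem_comb[OF assms(2)] alg_hom_idem_comb[OF assms(3)])
qed

end

text \<open>Because the three structure maps are algebra homomorphisms, their values at z determine
  them.\<close>

locale split_hopf = split_algebra A H z
  for A :: "('a, 'm) ring_scheme" and H :: "('a, 'b, 'n) hopf_scheme" and z +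
  assumes comult_hom: "comult H \<in> alg_hom A H (tensor A H H)"
    and comult_z: "comult H z =
      xnor (tensor A H H) (tensor_elt A H H z \<one>\<^bsub>H\<^esub>) (tensor_elt A H H \<one>\<^bsub>H\<^esub> z)"
    and counit_hom: "counit H \<in> alg_hom A H (base_alg A)"
    and counit_z: "counit H z = \<one>\<^bsub>A\<^esub>"
    and antipode_hom: "antipode H \<in> alg_hom A H H"
    and antipode_z: "antipode H z = z"
begin

text \<open>Each axiom equates two algebra homomorphisms out of H, so z alone is tested. There
  coassociativity is associativity of \<open>xnor\<close>, the counit laws are neutrality of 1, and
  the antipode laws are \<open>xnor z z = 1\<close>.\<close>

lemma hopf_algebra: "hopf_algebra A H"
proof -
  note H = algebra_axioms
  let ?T = "tensor A H H"
  note T = tensor_algebra[OF H H]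
  interpret T: algebra A ?T by (rule T)
  note H_T = tensor_algebra[OF H T] and T_H = tensor_algebra[OF T H]
  note elt = tensor_elt_closed[OF H H]
  have unit: "(\<lambda>y. counit H y \<odot>\<^bsub>H\<^esub> \<one>\<^bsub>H\<^esub>) \<in> alg_hom A H H"
    by (rule alg_hom_comp[OF counit_hom alg_hom_unit[OF H]])
  \<comment> \<open>The convolution of f and g: an algebra homomorphism whose value at z is the
    \<open>xnor\<close> of the values of f and g.\<close>
  have lift: "(\<lambda>x. tensor_lift A H f g (comult H x)) \<in> alg_hom A H H"
      "tensor_lift A H f g (comult H z) = xnor H (f z) (g z)"
    if fg: "f \<in> alg_hom A H H" "g \<in> alg_hom A H H" for f g
  proof -
    note L = tensor_lift[OF H H H fg]
    show "(\<lambda>x. tensor_lift A H f g (comult H x)) \<in> alg_hom A H H"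
      by (rule alg_hom_comp[OF comult_hom L(1)])
    show "tensor_lift A H f g (comult H z) = xnor H (f z) (g z)"
      by (simp add: comult_z alg_hom_xnor[OF L(1) T H] elt L(2) alg_homD[OF fg(1)] alg_homD[OF fg(2)])
  qed
  have coassoc: "tensor_assoc A H H H (tensor_map A ?T H (comult H) (\<lambda>y. y) (comult H x)) =
        tensor_map A H ?T (\<lambda>y. y) (comult H) (comult H x)" if x: "x \<in> carrier H" for x
  proof -
    note m1 = tensor_map[OF T H H H comult_hom alg_hom_id] and m2 = tensor_map[OF H T H H alg_hom_id comult_hom]
    note as = tensor_assoc[OF H H H]
    note inl = tensor_inl[OF T H] and inr = tensor_inr[OF H T]
    note E = elt tensor_elt_closed[OF H T] tensor_elt_closed[OF T H]
    show ?thesis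
    proof (rule split_hom_eq[OF H_T alg_hom_comp[OF alg_hom_comp[OF comult_hom m1(1)] as(1)]
           alg_hom_comp[OF comult_hom m2(1)] _ x])
      have 1: "tensor_elt A ?T H (comult H z) \<one>\<^bsub>H\<^esub> = xnor (tensor A ?T H)
          (tensor_elt A ?T H (tensor_elt A H H z \<one>\<^bsub>H\<^esub>) \<one>\<^bsub>H\<^esub>) (tensor_elt A ?T H (tensor_elt A H H \<one>\<^bsub>H\<^esub> z) \<one>\<^bsub>H\<^esub>)"
        unfolding comult_z by (rule alg_hom_xnor[OF inl T T_H]) (simp_all add: elt)
      have 2: "tensor_elt A H ?T \<one>\<^bsub>H\<^esub> (comult H z) = xnor (tensor A H ?T)
          (tensor_elt A H ?T \<one>\<^bsub>H\<^esub> (tensor_elt A H H z \<one>\<^bsub>H\<^esub>)) (tensor_elt A H ?T \<one>\<^bsub>H\<^esub> (tensor_elt A H H \<one>\<^bsub>H\<^esub> z))"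
        unfolding comult_z by (rule alg_hom_xnor[OF inr T H_T]) (simp_all add: elt)
      have c1: "comult H \<one>\<^bsub>H\<^esub> = \<one>\<^bsub>?T\<^esub>" by (rule alg_homD(5)[OF comult_hom])
      have cz: "comult H z \<in> carrier ?T" by (simp add: alg_homD(2)[OF comult_hom])
      interpret H_T: algebra A "tensor A H ?T" by (rule H_T)
      interpret T_H: algebra A "tensor A ?T H" by (rule T_H)
      have "tensor_map A ?T H (comult H) (\<lambda>y. y) (comult H z) =
        xnor (tensor A ?T H) (tensor_elt A ?T H (comult H z) \<one>\<^bsub>H\<^esub>) (tensor_elt A ?T H \<one>\<^bsub>?T\<^esub> z)"
        by (subst (1) comult_z) (simp add: alg_hom_xnor[OF m1(1) T T_H] elt m1(2) c1)
      then have l: "tensor_assoc A H H H (tensor_map A ?T H (comult H) (\<lambda>y. y) (comult H z)) =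
        xnor (tensor A H ?T) (xnor (tensor A H ?T) (tensor_elt A H ?T z \<one>\<^bsub>?T\<^esub>)
          (tensor_elt A H ?T \<one>\<^bsub>H\<^esub> (tensor_elt A H H z \<one>\<^bsub>H\<^esub>)))
          (tensor_elt A H ?T \<one>\<^bsub>H\<^esub> (tensor_elt A H H \<one>\<^bsub>H\<^esub> z))"
        by (simp add: 1 alg_hom_xnor[OF as(1) T_H H_T] E tensor_one[OF H H] as(2))
      have r: "tensor_map A H ?T (\<lambda>y. y) (comult H) (comult H z) =
        xnor (tensor A H ?T) (tensor_elt A H ?T z \<one>\<^bsub>?T\<^esub>) (tensor_elt A H ?T \<one>\<^bsub>H\<^esub> (comult H z))"
        by (subst (1) comult_z) (simp add: alg_hom_xnor[OF m2(1) T H_T] elt m2(2) c1)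
      show "tensor_assoc A H H H (tensor_map A ?T H (comult H) (\<lambda>y. y) (comult H z)) =
        tensor_map A H ?T (\<lambda>y. y) (comult H) (comult H z)"
        unfolding l r 2 by (rule H_T.xnor_assoc) (simp_all add: E)
    qed
  qed
  show ?thesis
    unfolding hopf_algebra_def
  proof (intro conjI ballI H comult_hom counit_hom antipode_hom coassoc)
    fix x assume x: "x \<in> carrier H"
    note eq = split_hom_eq[OF H _ _ _ x]
    show "tensor_lift A H (\<lambda>y. counit H y \<odot>\<^bsub>H\<^esub> \<one>\<^bsub>H\<^esub>) (\<lambda>y. y) (comult H x) = x"
      by (rule eq[OF lift(1)[OF unit alg_hom_id] alg_hom_id]) (simp add: lift(2) unit alg_hom_id counit_z)
    show "tensor_lift A H (\<lambda>y. y) (\<lambda>y. counit H y \<odot>\<^bsub>H\<^esub> \<one>\<^bsub>H\<^esub>) (comult H x) = x"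
      by (rule eq[OF lift(1)[OF alg_hom_id unit] alg_hom_id]) (simp add: lift(2) unit alg_hom_id counit_z)
    show "tensor_lift A H (antipode H) (\<lambda>y. y) (comult H x) = counit H x \<odot>\<^bsub>H\<^esub> \<one>\<^bsub>H\<^esub>"
      by (rule eq[OF lift(1)[OF antipode_hom alg_hom_id] unit])
         (simp add: lift(2) antipode_hom alg_hom_id antipode_z xnor_self z_idem counit_z)
    show "tensor_lift A H (\<lambda>y. y) (antipode H) (comult H x) = counit H x \<odot>\<^bsub>H\<^esub> \<one>\<^bsub>H\<^esub>"
      by (rule eq[OF lift(1)[OF alg_hom_id antipode_hom] unit])
         (simp add: lift(2) antipode_hom alg_hom_id antipode_z xnor_self z_idem counit_z)
  qed
qed

end

text \<open>The algebra map with z \<mapsto> y respects the structure maps because both sides agree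
  at z. It keeps coordinates, hence is bijective.\<close>

lemma split_hopf_iso:
  assumes "split_hopf A H z" "split_hopf A K y"
  shows "\<exists>\<phi>. \<phi> \<in> hopf_iso A H K"
proof -
  interpret H: split_hopf A H z by fact
  interpret K: split_hopf A K y by fact
  note Ha = H.algebra_axioms and Ka = K.algebra_axioms
  note HH = tensor_algebra[OF Ha Ha] and KK = tensor_algebra[OF Ka Ka]
  obtain f where f: "f \<in> alg_hom A H K"
    "\<And>a b. a \<in> carrier A \<Longrightarrow> b \<in> carrier A \<Longrightarrow> f (idem_comb H z a b) = idem_comb K y a b"
    using H.split_hom_ex[OF Ka K.z_closed K.z_idem] by blast
  have fz: "f z = y" using f(2)[of "\<one>\<^bsub>A\<^esub>" "\<zero>\<^bsub>A\<^esub>"] by (simp add: H.idem_comb_self K.idem_comb_self)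
  note ff = tensor_map[OF Ka Ka Ha Ha f(1) f(1)]
  have "f \<in> hopf_hom A H K"
    unfolding hopf_hom_def
  proof (intro CollectI conjI ballI f(1))
    fix x assume x: "x \<in> carrier H"
    show "comult K (f x) = tensor_map A K K f f (comult H x)"
      by (rule H.split_hom_eq[OF KK alg_hom_comp[OF f(1) K.comult_hom] alg_hom_comp[OF H.comult_hom ff(1)] _ x])
         (simp add: fz H.comult_z K.comult_z alg_hom_xnor[OF ff(1) HH KK] ff(2) tensor_elt_closed[OF Ha Ha] alg_homD(5)[OF f(1)])
    show "counit K (f x) = counit H x"
      by (rule H.split_hom_eq[OF algebra_base_alg[OF H.R_cring] alg_hom_comp[OF f(1) K.counit_hom] H.counit_hom _ x])
         (simp add: fz H.counit_z K.counit_z)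
    show "antipode K (f x) = f (antipode H x)"
      by (rule H.split_hom_eq[OF Ka alg_hom_comp[OF f(1) K.antipode_hom] alg_hom_comp[OF H.antipode_hom f(1)] _ x])
         (simp add: fz H.antipode_z K.antipode_z)
  qed
  moreover have "bij_betw f (carrier H) (carrier K)"
  proof (rule bij_betw_imageI)
    show "inj_on f (carrier H)"
    proof (rule inj_onI)
      fix x x' assume xx: "x \<in> carrier H" "x' \<in> carrier H" "f x = f x'"
      obtain a b c d where *: "a \<in> carrier A" "b \<in> carrier A" "c \<in> carrier A" "d \<in> carrier A"
        "x = idem_comb H z a b" "x' = idem_comb H z c d"
        using H.split_ex[OF xx(1)] H.split_ex[OF xx(2)] by blast
      then show "x = x'" using xx(3) K.split_inj[of a b c d] by (simp add: f(2))
    qed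
    show "f ` carrier H = carrier K"
    proof
      show "f ` carrier H \<subseteq> carrier K" using alg_homD(2)[OF f(1)] by blast
      show "carrier K \<subseteq> f ` carrier H"
      proof
        fix x assume "x \<in> carrier K"
        then obtain a b where *: "a \<in> carrier A" "b \<in> carrier A" "x = idem_comb K y a b"
          using K.split_ex by blast
        then have "x = f (idem_comb H z a b)" by (simp add: f(2))
        moreover have "idem_comb H z a b \<in> carrier H" using * by simp
          ultimately show "x \<in> f ` carrier H" by blast
      qed
    qed
  qed
  ultimately show ?thesis unfolding hopf_iso_def by blast
qed

text \<open>The composite B \<rightarrow> A \<times> A \<rightarrow> E of the points p, q of B with
  the map given by an idempotent w. It later supplies the retraction of k[N] onto the
  invariants.\<close>

lemma idem_comb_alg_hom:
  assumes E: "algebra A E" and w: "w \<in> carrier E" "w \<otimes>\<^bsub>E\<^esub> w = w"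
    and p: "p \<in> alg_hom A B (base_alg A)" and q: "q \<in> alg_hom A B (base_alg A)"
  shows "(\<lambda>x. idem_comb E w (p x) (q x)) \<in> alg_hom A B E"
proof -
  interpret E: algebra A E by fact
  have c: "p x \<in> carrier A" "q x \<in> carrier A" if "x \<in> carrier B" for x
    using alg_homD(2)[OF p that] alg_homD(2)[OF q that] by (simp_all add: base_alg_def)
  show ?thesis
    by (rule alg_homI)
       (use w c in \<open>simp_all add: alg_homD[OF p] alg_homD[OF q] base_alg_def
          E.idem_comb_add E.idem_comb_mult E.idem_comb_one E.idem_comb_smult\<close>)
qed

lemma (in cring) eq_minusI:
  assumes "x \<in> carrier R" "y \<in> carrier R" "x \<oplus> y = u"
  shows "y = u \<ominus> x"
proof -
  have "y = (x \<oplus> y) \<ominus> x" using assms(1,2) by algebra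
  then show ?thesis by (simp only: assms(3))
qed

lemma (in cring) idem_if_compl:
  assumes "x \<in> carrier R" "x \<otimes> (\<one> \<ominus> x) = \<zero>"
  shows "x \<otimes> x = x"
proof -
  have "x = x \<otimes> x \<oplus> x \<otimes> (\<one> \<ominus> x)" using assms(1) by algebra
  then show ?thesis using assms by simp
qed

lemma with_coalg_simps [simp]:
  "carrier (with_coalg B d e s) = carrier B" "\<one>\<^bsub>with_coalg B d e s\<^esub> = \<one>\<^bsub>B\<^esub>"
  "\<zero>\<^bsub>with_coalg B d e s\<^esub> = \<zero>\<^bsub>B\<^esub>" "x \<otimes>\<^bsub>with_coalg B d e s\<^esub> y = x \<otimes>\<^bsub>B\<^esub> y"
  "x \<oplus>\<^bsub>with_coalg B d e s\<^esub> y = x \<oplus>\<^bsub>B\<^esub> y" "a \<odot>\<^bsub>with_coalg B d e s\<^esub> y = a \<odot>\<^bsub>B\<^esub> y"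
  "comult (with_coalg B d e s) = d" "counit (with_coalg B d e s) = e" "antipode (with_coalg B d e s) = s"
  "\<ominus>\<^bsub>with_coalg B d e s\<^esub> x = \<ominus>\<^bsub>B\<^esub> x" "x \<ominus>\<^bsub>with_coalg B d e s\<^esub> y = x \<ominus>\<^bsub>B\<^esub> y"
  by (simp_all add: with_coalg_def a_minus_def a_inv_def m_inv_def)

text \<open>Tensor products read only the algebra fields, so adding a comultiplication, counit and
  antipode does not change them.\<close>

lemma tensor_with_coalg [simp]:
  "tensor A (with_coalg B d e s) C = tensor A B C"
  "tensor A B (with_coalg C d' e' s') = tensor A B C"
  "tensor_elt A (with_coalg B d e s) C = tensor_elt A B C"
  "tensor_elt A B (with_coalg C d' e' s') = tensor_elt A B C"
proof -
  have F: "tensor_free A (with_coalg B d e s) C = tensor_free A B C"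
    "tensor_free A B (with_coalg C d' e' s') = tensor_free A B C"
    by (simp_all add: tensor_free_def DirProd_def)
  have I: "tensor_ideal A (with_coalg B d e s) C = tensor_ideal A B C"
    "tensor_ideal A B (with_coalg C d' e' s') = tensor_ideal A B C"
    by (simp_all add: tensor_ideal_def tensor_rel_def F)
  show "tensor A (with_coalg B d e s) C = tensor A B C"
    "tensor A B (with_coalg C d' e' s') = tensor A B C"
    by (simp_all add: tensor_def F I)
  show "tensor_elt A (with_coalg B d e s) C = tensor_elt A B C"
    "tensor_elt A B (with_coalg C d' e' s') = tensor_elt A B C"
    by (intro ext, simp add: tensor_elt_def F I)+
qed

lemma alg_hom_with_coalg [simp]:
  "alg_hom A (with_coalg B d e s) C = alg_hom A B C"
  "alg_hom A B (with_coalg C d' e' s') = alg_hom A B C"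
  by (simp_all add: alg_hom_def ring_hom_def)

lemma idem_comb_with_coalg [simp]: "idem_comb (with_coalg B d e s) = idem_comb B"
  by (intro ext) (simp add: idem_comb_def)

lemma algebra_with_coalg:
  assumes "algebra A B"
  shows "algebra A (with_coalg B d e s)"
proof -
  interpret B: algebra A B by fact
  have "cring (with_coalg B d e s)"
  proof (rule cringI)
    show "abelian_group (with_coalg B d e s)"
    proof (rule abelian_groupI)
      show "\<exists>y\<in>carrier (with_coalg B d e s). y \<oplus>\<^bsub>with_coalg B d e s\<^esub> x = \<zero>\<^bsub>with_coalg B d e s\<^esub>"
        if "x \<in> carrier (with_coalg B d e s)" for x
        by (rule bexI[of _ "\<ominus>\<^bsub>B\<^esub> x"]) (use that in \<open>simp_all add: B.M.l_neg\<close>)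
    qed (simp_all add: B.M.a_ac)
    show "comm_monoid (with_coalg B d e s)"
      by (rule comm_monoidI) (simp_all add: B.m_ac)
  qed (simp add: B.l_distr)
  then show ?thesis
    by (intro algebraI B.R_cring)
      (simp_all add: B.smult_l_distr B.smult_r_distr B.smult_assoc1 B.smult_assoc2)
qed

lemma split_algebra_with_coalg:
  assumes "split_algebra A B z" shows "split_algebra A (with_coalg B d e s) z"
proof -
  interpret split_algebra A B z by fact
  show ?thesis
    using z_idem split_ex split_inj
    by (intro split_algebra.intro split_algebra_axioms.intro algebra_with_coalg algebra_axioms) auto
qed

text \<open>Uniqueness of coordinates comes from two A-valued points: p with p z = 1 returns a, and
  q with q z = 0 returns b.\<close>

lemma split_algebraI:
  assumes H: "algebra A H" and z: "z \<in> carrier H" "z \<otimes>\<^bsub>H\<^esub> z = z"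
    and ex: "\<And>x. x \<in> carrier H \<Longrightarrow> \<exists>a\<in>carrier A. \<exists>b\<in>carrier A. x = idem_comb H z a b"
    and p: "p \<in> alg_hom A H (base_alg A)" "p z = \<one>\<^bsub>A\<^esub>"
    and q: "q \<in> alg_hom A H (base_alg A)" "q z = \<zero>\<^bsub>A\<^esub>"
  shows "split_algebra A H z"
proof -
  interpret algebra A H by fact
  have BA: "algebra A (base_alg A)" by (rule algebra_base_alg[OF R_cring])
  interpret BA: algebra A "base_alg A" by (rule BA)
  have pq: "p (idem_comb H z a b) = a" "q (idem_comb H z a b) = b" if "a \<in> carrier A" "b \<in> carrier A" for a b
  proof -
    have "p (idem_comb H z a b) = idem_comb (base_alg A) \<one>\<^bsub>base_alg A\<^esub> a b"
      using alg_hom_idem_comb[OF p(1) H BA z(1) that] p(2) by (simp add: base_alg_def)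
    then show "p (idem_comb H z a b) = a"
      unfolding BA.idem_comb_unit[OF that] using that by (simp add: base_alg_def)
    have "q (idem_comb H z a b) = idem_comb (base_alg A) \<zero>\<^bsub>base_alg A\<^esub> a b"
      using alg_hom_idem_comb[OF q(1) H BA z(1) that] q(2) by (simp add: base_alg_def)
    also have "\<dots> = b \<odot>\<^bsub>base_alg A\<^esub> \<one>\<^bsub>base_alg A\<^esub>"
      using that by (simp add: idem_comb_def BA.minus_eq)
    finally show "q (idem_comb H z a b) = b" using that by (simp add: base_alg_def)
  qed
  show ?thesis
  proof (intro split_algebra.intro split_algebra_axioms.intro H z ex)
    fix a b c d assume "a \<in> carrier A" "b \<in> carrier A" "c \<in> carrier A" "d \<in> carrier A"
      "idem_comb H z a b = idem_comb H z c d"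
    then show "a = c \<and> b = d" using pq by metis
  qed
qed

section \<open>Functions on a group of order two and the algebra of an idempotent\<close>

lemma cring_UP_algebra: "cring A \<Longrightarrow> algebra A (UP A)"
  by (intro UP_cring.UP_algebra UP_cring.intro)

lemma UP_eval:
  assumes "algebra A E" "s \<in> carrier E"
  shows "UnivPoly.eval A E (\<lambda>a. a \<odot>\<^bsub>E\<^esub> \<one>\<^bsub>E\<^esub>) s \<in> alg_hom A (UP A) E"
    and "UnivPoly.eval A E (\<lambda>a. a \<odot>\<^bsub>E\<^esub> \<one>\<^bsub>E\<^esub>) s (upvar A) = s"
proof -
  interpret E: algebra A E by fact
  let ?h = "\<lambda>a. a \<odot>\<^bsub>E\<^esub> \<one>\<^bsub>E\<^esub>"
  have h: "?h \<in> ring_hom A E"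
    by (rule ring_hom_memI) (simp_all add: E.smult_l_distr E.smult_assoc1 E.smult_assoc2)
  interpret UP_univ_prop A E ?h "UP A" s "eval A E ?h s"
    by (intro UP_univ_prop.intro UP_univ_prop_axioms.intro UP_pre_univ_prop.intro
        ring_hom_cring.intro ring_hom_cring_axioms.intro UP_cring.intro E.R_cring E.M_cring h assms(2) reflexive)
  show "eval A E ?h s (upvar A) = s"
    unfolding upvar_def by (rule eval_monom1[OF assms(2)])
  show "eval A E ?h s \<in> alg_hom A (UP A) E"
    by (rule alg_homI) (simp_all add: Eval_smult E.smult_assoc2)
qed

section \<open>The algebra A[z]/(z(1 - z))\<close>

context
  fixes A :: "('a, 'm) ring_scheme"
  assumes A: "cring A"
begin

interpretation A: cring A by (rule A)
interpretation UP_cring A "UP A" by (rule UP_cring.intro[OF A])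

lemma upvar_closed [simp]: "upvar A \<in> carrier (UP A)"
  by (simp add: upvar_def)

lemma idem_ideal: "ideal (idem_ideal A) (UP A)"
  unfolding idem_ideal_def by (rule P.genideal_ideal) simp

lemma idem_alg: "algebra A (idem_alg A)"
  and idem_proj: "(\<lambda>x. idem_ideal A +>\<^bsub>UP A\<^esub> x) \<in> alg_hom A (UP A) (idem_alg A)"
  unfolding idem_alg_def by (rule quot_algebra[OF cring_UP_algebra[OF A] idem_ideal])+

interpretation Q: algebra A "idem_alg A" by (rule idem_alg)

lemma idem_eval:
  assumes E: "algebra A E" and s: "s \<in> carrier E" "s \<otimes>\<^bsub>E\<^esub> s = s"
  shows "idem_eval A E s \<in> alg_hom A (idem_alg A) E" "idem_eval A E s (idem_z A) = s"
proof -
  interpret E: algebra A E by fact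
  note ev = UP_eval[OF E s(1)]
  have "eval A E (\<lambda>a. a \<odot>\<^bsub>E\<^esub> \<one>\<^bsub>E\<^esub>) s x = \<zero>\<^bsub>E\<^esub>" if "x \<in> idem_ideal A" for x
    using that unfolding idem_ideal_def
    by (rule alg_hom_genideal_zero[OF cring_UP_algebra[OF A] E ev(1), rotated 2])
       (use s in \<open>auto simp: alg_homD[OF ev(1)] alg_hom_zero_inv[OF ev(1) cring_UP_algebra[OF A] E] ev(2) E.compl_idem\<close>)
  note L = quot_lift[OF cring_UP_algebra[OF A] idem_ideal E ev(1) this]
  show "idem_eval A E s \<in> alg_hom A (idem_alg A) E"
    unfolding idem_eval_def idem_alg_def by (rule L(1))
  show "idem_eval A E s (idem_z A) = s"
    unfolding idem_eval_def idem_z_def by (simp add: L(2) ev(2))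
qed

lemma idem_z_closed: "idem_z A \<in> carrier (idem_alg A)"
  unfolding idem_z_def by (rule alg_homD(2)[OF idem_proj upvar_closed])

lemma idem_z_idem: "idem_z A \<otimes>\<^bsub>idem_alg A\<^esub> idem_z A = idem_z A"
proof -
  have "idem_z A \<otimes>\<^bsub>idem_alg A\<^esub> (\<one>\<^bsub>idem_alg A\<^esub> \<ominus>\<^bsub>idem_alg A\<^esub> idem_z A) =
    idem_ideal A +>\<^bsub>UP A\<^esub> (upvar A \<otimes>\<^bsub>UP A\<^esub> (\<one>\<^bsub>UP A\<^esub> \<ominus>\<^bsub>UP A\<^esub> upvar A))"
    by (simp add: idem_z_def alg_homD[OF idem_proj] alg_hom_zero_inv[OF idem_proj cring_UP_algebra[OF A] idem_alg])
  also have "\<dots> = \<zero>\<^bsub>idem_alg A\<^esub>"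
    unfolding idem_alg_def
    by (subst quot_eq_zero_iff[OF cring_UP_algebra[OF A] idem_ideal]; simp add: idem_ideal_def P.genideal_self')
  finally show ?thesis using Q.idem_if_compl idem_z_closed by blast
qed

text \<open>Modulo z(1 - z) all positive powers of z equal z, so every monomial has coordinates, and
  a polynomial is a finite sum of monomials.\<close>

lemma idem_alg_comb:
  assumes "x \<in> carrier (idem_alg A)"
  shows "\<exists>a\<in>carrier A. \<exists>b\<in>carrier A. x = idem_comb (idem_alg A) (idem_z A) a b"
proof -
  let ?p = "\<lambda>x. idem_ideal A +>\<^bsub>UP A\<^esub> x"
  let ?P = "\<lambda>x. \<exists>a\<in>carrier A. \<exists>b\<in>carrier A. x = idem_comb (idem_alg A) (idem_z A) a b"
  note pD = alg_homD[OF idem_proj]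
  have add: "?P (x \<oplus>\<^bsub>idem_alg A\<^esub> y)" if "?P x" "?P y" for x y
  proof -
    from that obtain a b c d where "a \<in> carrier A" "b \<in> carrier A" "c \<in> carrier A" "d \<in> carrier A"
      "x = idem_comb (idem_alg A) (idem_z A) a b" "y = idem_comb (idem_alg A) (idem_z A) c d" by blast
    then show ?thesis using idem_z_closed
      by (intro bexI[of _ "a \<oplus>\<^bsub>A\<^esub> c"] bexI[of _ "b \<oplus>\<^bsub>A\<^esub> d"]) (simp_all add: Q.idem_comb_add)
  qed
  have pow: "?p (monom (UP A) \<one>\<^bsub>A\<^esub> n) = (if n = 0 then \<one>\<^bsub>idem_alg A\<^esub> else idem_z A)" for n
  proof (induction n)
    case 0
    then show ?case using pD(5) by (simp add: monom_one)
  next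
    case (Suc n)
    then show ?case
      using idem_z_closed idem_z_idem
      by (subst monom_one_Suc) (simp add: pD(4) idem_z_def upvar_def split: if_splits)
  qed
  have mon: "?P (?p (monom (UP A) a n))" if a: "a \<in> carrier A" for a n
  proof -
    have "monom (UP A) a n = a \<odot>\<^bsub>UP A\<^esub> monom (UP A) \<one>\<^bsub>A\<^esub> n"
      using monom_mult_smult[OF a A.one_closed] a by simp
    then have "?p (monom (UP A) a n) = a \<odot>\<^bsub>idem_alg A\<^esub> (if n = 0 then \<one>\<^bsub>idem_alg A\<^esub> else idem_z A)"
      using a by (simp add: pD(6) flip: pow)
    \<comment> \<open>A constant a is a z + a (1 - z), with coordinates (a, a); a monomial of
      positive degree is a z, with coordinates (a, 0).\<close>
    also have "\<dots> = idem_comb (idem_alg A) (idem_z A) a (if n = 0 then a else \<zero>\<^bsub>A\<^esub>)"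
    proof (cases "n = 0")
      case True
      have "a \<odot>\<^bsub>idem_alg A\<^esub> \<one>\<^bsub>idem_alg A\<^esub> = a \<odot>\<^bsub>idem_alg A\<^esub> idem_comb (idem_alg A) (idem_z A) \<one>\<^bsub>A\<^esub> \<one>\<^bsub>A\<^esub>"
        by (simp add: Q.idem_comb_one idem_z_closed idem_z_idem)
      with True a show ?thesis by (simp add: Q.idem_comb_smult idem_z_closed)
    next
      case False
      then show ?thesis using a idem_z_closed by (simp add: idem_comb_def)
    qed
    finally show ?thesis using a by auto
  qed
  have sum: "?P (?p (\<Oplus>\<^bsub>UP A\<^esub>i\<in>S. f i))"
    if "finite S" "f \<in> S \<rightarrow> carrier (UP A)" "\<And>i. i \<in> S \<Longrightarrow> ?P (?p (f i))" for S :: "nat set" and f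
    using that
  proof (induction S rule: finite_induct)
    case empty
    have "?p \<zero>\<^bsub>UP A\<^esub> = idem_comb (idem_alg A) (idem_z A) \<zero>\<^bsub>A\<^esub> \<zero>\<^bsub>A\<^esub>"
      using idem_z_closed by (simp add: idem_comb_def alg_hom_zero_inv[OF idem_proj cring_UP_algebra[OF A] idem_alg])
    then show ?case by auto
  next
    case (insert i S)
    then have "?P (?p (f i) \<oplus>\<^bsub>idem_alg A\<^esub> ?p (\<Oplus>\<^bsub>UP A\<^esub>i\<in>S. f i))"
      by (intro add) auto
    also have "?p (f i) \<oplus>\<^bsub>idem_alg A\<^esub> ?p (\<Oplus>\<^bsub>UP A\<^esub>i\<in>S. f i) = ?p (\<Oplus>\<^bsub>UP A\<^esub>i\<in>insert i S. f i)"
      using insert by (simp add: pD(3) P.finsum_insert Pi_def)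
    finally show ?case .
  qed
  obtain p where p: "p \<in> carrier (UP A)" "x = ?p p" using assms by (auto simp: idem_alg_def quot_carrier)
  have "?P (?p (\<Oplus>\<^bsub>UP A\<^esub> i \<in> {..deg A p}. monom (UP A) (coeff (UP A) p i) i))"
    using p(1) by (intro sum) (auto intro: mon)
  then show ?thesis unfolding up_repr[OF p(1)] p(2) .
qed

lemma idem_split: "split_algebra A (idem_alg A) (idem_z A)"
proof -
  have BA: "algebra A (base_alg A)" by (rule algebra_base_alg[OF A])
  have "\<one>\<^bsub>A\<^esub> \<in> carrier (base_alg A)" "\<one>\<^bsub>A\<^esub> \<otimes>\<^bsub>base_alg A\<^esub> \<one>\<^bsub>A\<^esub> = \<one>\<^bsub>A\<^esub>"
    "\<zero>\<^bsub>A\<^esub> \<in> carrier (base_alg A)" "\<zero>\<^bsub>A\<^esub> \<otimes>\<^bsub>base_alg A\<^esub> \<zero>\<^bsub>A\<^esub> = \<zero>\<^bsub>A\<^esub>"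
    by (simp_all add: base_alg_def)
  \<comment> \<open>The points z \<mapsto> 1 and z \<mapsto> 0; they are well defined because 1 and
    0 are idempotent.\<close>
  note 1 = idem_eval[OF BA this(1,2)] and 0 = idem_eval[OF BA this(3,4)]
  show ?thesis by (rule split_algebraI[OF idem_alg idem_z_closed idem_z_idem idem_alg_comb 1 0])
qed

lemma idem_comult_z:
  "idem_comult_z A = xnor (tensor A (idem_alg A) (idem_alg A))
    (tensor_elt A (idem_alg A) (idem_alg A) (idem_z A) \<one>\<^bsub>idem_alg A\<^esub>)
    (tensor_elt A (idem_alg A) (idem_alg A) \<one>\<^bsub>idem_alg A\<^esub> (idem_z A))"
  using tensor_elt_split[OF idem_alg idem_alg idem_z_closed idem_z_closed]
  by (simp add: idem_comult_z_def xnor_def Let_def)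

lemma idem_split_hopf: "split_hopf A (idem_hopf A) (idem_z A)"
proof -
  let ?B = "idem_alg A"
  note T = tensor_algebra[OF idem_alg idem_alg]
  interpret T: algebra A "tensor A ?B ?B" by (rule T)
  note inl = tensor_inl[OF idem_alg idem_alg] and inr = tensor_inr[OF idem_alg idem_alg]
  \<comment> \<open>The prescribed value of the comultiplication at z has to be idempotent for
    \<open>idem_eval\<close> to be a homomorphism.\<close>
  have c: "idem_comult_z A \<in> carrier (tensor A ?B ?B)"
    "idem_comult_z A \<otimes>\<^bsub>tensor A ?B ?B\<^esub> idem_comult_z A = idem_comult_z A"
    unfolding idem_comult_z using idem_z_closed
    by (simp_all add: T.xnor_idem tensor_elt_closed[OF idem_alg idem_alg] idem_z_idem
        flip: alg_homD(4)[OF inl] alg_homD(4)[OF inr])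
  have BA: "algebra A (base_alg A)" by (rule algebra_base_alg[OF A])
  have b: "\<one>\<^bsub>A\<^esub> \<in> carrier (base_alg A)" "\<one>\<^bsub>A\<^esub> \<otimes>\<^bsub>base_alg A\<^esub> \<one>\<^bsub>A\<^esub> = \<one>\<^bsub>A\<^esub>"
    by (simp_all add: base_alg_def)
  note ev = idem_eval[OF T c] idem_eval[OF BA b] idem_eval[OF idem_alg idem_z_closed idem_z_idem]
  show ?thesis
    unfolding idem_hopf_def Let_def
    by (intro split_hopf.intro split_hopf_axioms.intro split_algebra_with_coalg idem_split)
       (simp_all add: ev, simp add: idem_comult_z)
qed

end

section \<open>Functions on a group with two elements\<close>

context
  fixes A :: "('a, 'm) ring_scheme" and \<Gamma> :: "('g, 'n) monoid_scheme" and g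
  assumes A: "cring A" and \<Gamma>: "group \<Gamma>" and c\<Gamma>: "carrier \<Gamma> = {\<one>\<^bsub>\<Gamma>\<^esub>, g}" "g \<noteq> \<one>\<^bsub>\<Gamma>\<^esub>"
begin

interpretation A: cring A by (rule A)
interpretation \<Gamma>: group \<Gamma> by (rule \<Gamma>)

lemma const_simps:
  "carrier (const_alg A \<Gamma>) = carrier \<Gamma> \<rightarrow>\<^sub>E carrier A"
  "f \<otimes>\<^bsub>const_alg A \<Gamma>\<^esub> f' = (\<lambda>g\<in>carrier \<Gamma>. f g \<otimes>\<^bsub>A\<^esub> f' g)"
  "f \<oplus>\<^bsub>const_alg A \<Gamma>\<^esub> f' = (\<lambda>g\<in>carrier \<Gamma>. f g \<oplus>\<^bsub>A\<^esub> f' g)"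
  "\<one>\<^bsub>const_alg A \<Gamma>\<^esub> = (\<lambda>g\<in>carrier \<Gamma>. \<one>\<^bsub>A\<^esub>)"
  "\<zero>\<^bsub>const_alg A \<Gamma>\<^esub> = (\<lambda>g\<in>carrier \<Gamma>. \<zero>\<^bsub>A\<^esub>)"
  "a \<odot>\<^bsub>const_alg A \<Gamma>\<^esub> f = (\<lambda>g\<in>carrier \<Gamma>. a \<otimes>\<^bsub>A\<^esub> f g)"
  by (simp_all add: const_alg_def)

lemma const_algebra: "algebra A (const_alg A \<Gamma>)"
proof -
  have ext: "x = y" if "x \<in> carrier (const_alg A \<Gamma>)" "y \<in> carrier (const_alg A \<Gamma>)"
    "\<And>g. g \<in> carrier \<Gamma> \<Longrightarrow> x g = y g" for x y
    using that unfolding const_simps by (rule PiE_ext)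
  have mem: "f g \<in> carrier A" if "f \<in> carrier (const_alg A \<Gamma>)" "g \<in> carrier \<Gamma>" for f g
    using that by (auto simp: const_simps)
  have cl: "(\<lambda>g\<in>carrier \<Gamma>. f g) \<in> carrier (const_alg A \<Gamma>)"
    if "\<And>g. g \<in> carrier \<Gamma> \<Longrightarrow> f g \<in> carrier A" for f
    using that by (auto simp: const_simps)
  note ops = const_simps(2-6)
  have "cring (const_alg A \<Gamma>)"
  proof (rule cringI)
    show "abelian_group (const_alg A \<Gamma>)"
    proof (rule abelian_groupI)
      show "\<exists>y\<in>carrier (const_alg A \<Gamma>). y \<oplus>\<^bsub>const_alg A \<Gamma>\<^esub> x = \<zero>\<^bsub>const_alg A \<Gamma>\<^esub>"
        if "x \<in> carrier (const_alg A \<Gamma>)" for x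
      proof
        show "(\<lambda>g\<in>carrier \<Gamma>. \<ominus>\<^bsub>A\<^esub> x g) \<oplus>\<^bsub>const_alg A \<Gamma>\<^esub> x = \<zero>\<^bsub>const_alg A \<Gamma>\<^esub>"
          using that by (intro ext) (simp_all add: ops cl mem A.l_neg)
        show "(\<lambda>g\<in>carrier \<Gamma>. \<ominus>\<^bsub>A\<^esub> x g) \<in> carrier (const_alg A \<Gamma>)" using that by (intro cl) (simp add: mem)
      qed
    qed ((intro ext)?; simp add: ops cl mem A.a_ac)+
    show "comm_monoid (const_alg A \<Gamma>)"
      by (rule comm_monoidI; (intro ext)?; simp add: ops cl mem A.m_ac)
  qed ((intro ext)?; simp add: ops cl mem A.l_distr)
  then show ?thesis
    by (intro algebraI A) ((intro ext)?; simp add: ops cl mem A.l_distr A.r_distr A.m_ac)+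
qed

interpretation C: algebra A "const_alg A \<Gamma>" by (rule const_algebra)

lemma const_idem_closed: "const_idem A \<Gamma> h \<in> carrier (const_alg A \<Gamma>)"
  by (auto simp: const_simps const_idem_def)

lemma const_idem_other: "const_idem A \<Gamma> g = \<one>\<^bsub>const_alg A \<Gamma>\<^esub> \<ominus>\<^bsub>const_alg A \<Gamma>\<^esub> (const_idem A \<Gamma> \<one>\<^bsub>\<Gamma>\<^esub>)"
proof -
  have "(const_idem A \<Gamma> \<one>\<^bsub>\<Gamma>\<^esub>) \<oplus>\<^bsub>const_alg A \<Gamma>\<^esub> const_idem A \<Gamma> g = \<one>\<^bsub>const_alg A \<Gamma>\<^esub>"
    using c\<Gamma> c\<Gamma>(2)[symmetric] by (auto simp: const_simps const_idem_def)
  then show ?thesis using const_idem_closed by (intro C.eq_minusI)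
qed

lemma const_comb:
  assumes "f \<in> carrier (const_alg A \<Gamma>)"
  shows "f = idem_comb (const_alg A \<Gamma>) (const_idem A \<Gamma> \<one>\<^bsub>\<Gamma>\<^esub>) (f \<one>\<^bsub>\<Gamma>\<^esub>) (f g)"
  using assms c\<Gamma> unfolding idem_comb_def const_idem_other[symmetric]
  by (auto simp: const_simps const_idem_def PiE_iff extensional_def fun_eq_iff)

lemma const_eval: "h \<in> carrier \<Gamma> \<Longrightarrow> (\<lambda>f. f h) \<in> alg_hom A (const_alg A \<Gamma>) (base_alg A)"
  by (rule alg_homI) (auto simp: const_simps base_alg_def)

lemma const_split: "split_algebra A (const_alg A \<Gamma>) (const_idem A \<Gamma> \<one>\<^bsub>\<Gamma>\<^esub>)"
proof (rule split_algebraI[OF const_algebra const_idem_closed _ _ const_eval[of "\<one>\<^bsub>\<Gamma>\<^esub>"] _ const_eval[of g]])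
  show "(const_idem A \<Gamma> \<one>\<^bsub>\<Gamma>\<^esub>) \<otimes>\<^bsub>const_alg A \<Gamma>\<^esub> (const_idem A \<Gamma> \<one>\<^bsub>\<Gamma>\<^esub>) = (const_idem A \<Gamma> \<one>\<^bsub>\<Gamma>\<^esub>)" by (auto simp: const_simps const_idem_def)
  show "\<exists>a\<in>carrier A. \<exists>b\<in>carrier A. x = idem_comb (const_alg A \<Gamma>) (const_idem A \<Gamma> \<one>\<^bsub>\<Gamma>\<^esub>) a b"
    if "x \<in> carrier (const_alg A \<Gamma>)" for x
    using const_comb[OF that] that c\<Gamma> by (auto simp: const_simps)
qed (use c\<Gamma> in \<open>auto simp: const_idem_def\<close>)

text \<open>The indicator of the neutral element plays the role of z. What needs work is that the
  explicit sum over \<Gamma> \<times> \<Gamma> is an algebra homomorphism; it is identified with one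
  built from \<open>xnor\<close>.\<close>

lemma const_split_hopf: "split_hopf A (const_hopf A \<Gamma>) (const_idem A \<Gamma> \<one>\<^bsub>\<Gamma>\<^esub>)"
proof -
  let ?B = "const_alg A \<Gamma>"
  let ?T = "tensor A ?B ?B"
  interpret S: split_algebra A ?B "const_idem A \<Gamma> \<one>\<^bsub>\<Gamma>\<^esub>" by (rule const_split)
  note T = tensor_algebra[OF const_algebra const_algebra]
  interpret T: algebra A ?T by (rule T)
  let ?t = "tensor_elt A ?B ?B"
  note inl = tensor_inl[OF const_algebra const_algebra] and inr = tensor_inr[OF const_algebra const_algebra]
  define x where "x = ?t (const_idem A \<Gamma> \<one>\<^bsub>\<Gamma>\<^esub>) \<one>\<^bsub>?B\<^esub>"
  define y where "y = ?t \<one>\<^bsub>?B\<^esub> (const_idem A \<Gamma> \<one>\<^bsub>\<Gamma>\<^esub>)"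
  have xy [simp]: "x \<in> carrier ?T" "y \<in> carrier ?T" "x \<otimes>\<^bsub>?T\<^esub> x = x" "y \<otimes>\<^bsub>?T\<^esub> y = y"
    by (simp_all add: x_def y_def const_idem_closed S.z_idem tensor_elt_closed[OF const_algebra const_algebra]
        flip: alg_homD(4)[OF inl] alg_homD(4)[OF inr])
  have l: "?t (const_idem A \<Gamma> g) \<one>\<^bsub>?B\<^esub> = \<one>\<^bsub>?T\<^esub> \<ominus>\<^bsub>?T\<^esub> x"
    unfolding const_idem_other x_def
    by (simp add: const_idem_closed alg_hom_zero_inv[OF inl const_algebra T] alg_homD(5)[OF inl])
  have r: "?t \<one>\<^bsub>?B\<^esub> (const_idem A \<Gamma> g) = \<one>\<^bsub>?T\<^esub> \<ominus>\<^bsub>?T\<^esub> y"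
    unfolding const_idem_other y_def
    by (simp add: const_idem_closed alg_hom_zero_inv[OF inr const_algebra T] alg_homD(5)[OF inr])
  note sp = tensor_elt_split[OF const_algebra const_algebra const_idem_closed const_idem_closed]
  have t: "?t (const_idem A \<Gamma> \<one>\<^bsub>\<Gamma>\<^esub>) (const_idem A \<Gamma> \<one>\<^bsub>\<Gamma>\<^esub>) = x \<otimes>\<^bsub>?T\<^esub> y" "?t (const_idem A \<Gamma> \<one>\<^bsub>\<Gamma>\<^esub>) (const_idem A \<Gamma> g) = x \<otimes>\<^bsub>?T\<^esub> (\<one>\<^bsub>?T\<^esub> \<ominus>\<^bsub>?T\<^esub> y)"
    "?t (const_idem A \<Gamma> g) (const_idem A \<Gamma> \<one>\<^bsub>\<Gamma>\<^esub>) = (\<one>\<^bsub>?T\<^esub> \<ominus>\<^bsub>?T\<^esub> x) \<otimes>\<^bsub>?T\<^esub> y"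
    "?t (const_idem A \<Gamma> g) (const_idem A \<Gamma> g) = (\<one>\<^bsub>?T\<^esub> \<ominus>\<^bsub>?T\<^esub> x) \<otimes>\<^bsub>?T\<^esub> (\<one>\<^bsub>?T\<^esub> \<ominus>\<^bsub>?T\<^esub> y)"
    unfolding sp[of "\<one>\<^bsub>\<Gamma>\<^esub>"] sp[of g] l r x_def[symmetric] y_def[symmetric] by (rule refl)+
  \<comment> \<open>The only alternative, g g = g, would make g neutral.\<close>
  have gg: "g \<otimes>\<^bsub>\<Gamma>\<^esub> g = \<one>\<^bsub>\<Gamma>\<^esub>"
    using c\<Gamma> \<Gamma>.m_closed[of g g] \<Gamma>.l_cancel_one[of g g] by auto
  have ginv: "inv\<^bsub>\<Gamma>\<^esub> g = g" using c\<Gamma> gg by (intro \<Gamma>.inv_equality) auto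
  obtain \<Delta> where \<Delta>: "\<Delta> \<in> alg_hom A ?B ?T"
    "\<And>a b. a \<in> carrier A \<Longrightarrow> b \<in> carrier A \<Longrightarrow> \<Delta> (idem_comb ?B (const_idem A \<Gamma> \<one>\<^bsub>\<Gamma>\<^esub>) a b) = idem_comb ?T (xnor ?T x y) a b"
    using S.split_hom_ex[OF T, of "xnor ?T x y"] T.xnor_idem[OF xy] by auto
  have comult: "(\<Oplus>\<^bsub>?T\<^esub>p \<in> carrier \<Gamma> \<times> carrier \<Gamma>. f (fst p \<otimes>\<^bsub>\<Gamma>\<^esub> snd p) \<odot>\<^bsub>?T\<^esub>
        ?t (const_idem A \<Gamma> (fst p)) (const_idem A \<Gamma> (snd p))) = \<Delta> f"
    if f: "f \<in> carrier ?B" for f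
  proof -
    have fA: "f \<one>\<^bsub>\<Gamma>\<^esub> \<in> carrier A" "f g \<in> carrier A" using f c\<Gamma> by (auto simp: const_simps)
    \<comment> \<open>The pairs are grouped by their product: (1, 1) and (g, g) contribute x y + (1
      - x)(1 - y) with coefficient f 1, the other two contribute its complement with coefficient f
      g.\<close>
    have G: "carrier \<Gamma> \<times> carrier \<Gamma> = {(\<one>\<^bsub>\<Gamma>\<^esub>, \<one>\<^bsub>\<Gamma>\<^esub>), (g, g), (\<one>\<^bsub>\<Gamma>\<^esub>, g), (g, \<one>\<^bsub>\<Gamma>\<^esub>)}"
      using c\<Gamma> by auto
    have gc: "g \<in> carrier \<Gamma>" using c\<Gamma> by simp
    show ?thesis
      using c\<Gamma>(2) fA gc const_comb[OF f] \<Delta>(2)[OF fA] unfolding G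
      by (simp add: t gg idem_comb_def T.xnor_compl)
         (simp add: T.xnor_alt T.smult_r_distr T.M.a_ac)
  qed
  have comult_hom: "(\<lambda>f. \<Oplus>\<^bsub>?T\<^esub>p \<in> carrier \<Gamma> \<times> carrier \<Gamma>. f (fst p \<otimes>\<^bsub>\<Gamma>\<^esub> snd p) \<odot>\<^bsub>?T\<^esub>
        ?t (const_idem A \<Gamma> (fst p)) (const_idem A \<Gamma> (snd p))) \<in> alg_hom A ?B ?T"
    by (rule alg_hom_cong[OF \<Delta>(1) const_algebra comult])
  have \<Delta>z: "\<Delta> (const_idem A \<Gamma> \<one>\<^bsub>\<Gamma>\<^esub>) = xnor ?T x y"
    using \<Delta>(2)[of "\<one>\<^bsub>A\<^esub>" "\<zero>\<^bsub>A\<^esub>"] by (simp add: C.idem_comb_self T.idem_comb_self)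
  have inv: "(\<lambda>h\<in>carrier \<Gamma>. f (inv\<^bsub>\<Gamma>\<^esub> h)) = f" if "f \<in> carrier ?B" for f
    using that c\<Gamma>(1) ginv by (auto simp: const_simps PiE_iff extensional_def fun_eq_iff)
  have antipode_hom: "(\<lambda>f. \<lambda>h\<in>carrier \<Gamma>. f (inv\<^bsub>\<Gamma>\<^esub> h)) \<in> alg_hom A ?B ?B"
    by (rule alg_hom_cong[OF alg_hom_id const_algebra inv])
  have one: "const_idem A \<Gamma> \<one>\<^bsub>\<Gamma>\<^esub> \<one>\<^bsub>\<Gamma>\<^esub> = \<one>\<^bsub>A\<^esub>" by (simp add: const_idem_def)
  show ?thesis
    unfolding const_hopf_def Let_def
    by (intro split_hopf.intro split_hopf_axioms.intro split_algebra_with_coalg const_split)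
       (simp_all add: comult_hom antipode_hom const_eval comult inv const_idem_closed one \<Delta>z,
        simp add: x_def y_def)
qed

end

lemma sym_group_2: "carrier (sym_group 2) = {\<one>\<^bsub>sym_group 2\<^esub>, transpose 1 2}" "transpose 1 2 \<noteq> \<one>\<^bsub>sym_group 2\<^esub>"
proof -
  have "{1..2::nat} = {1, 2}" by auto
  then show "carrier (sym_group 2) = {\<one>\<^bsub>sym_group 2\<^esub>, transpose 1 2}"
    by (auto simp: sym_group_def permutes_doubleton_iff)
  show "transpose 1 2 \<noteq> \<one>\<^bsub>sym_group 2\<^esub>"
    by (auto simp: sym_group_def fun_eq_iff transpose_def)
qed

section \<open>Multivariate polynomials\<close>

lemma exponents_mon_algebra: "cring A \<Longrightarrow> mon_algebra A exponents"
proof (intro mon_algebra.intro comm_monoidI)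
  show "x \<otimes>\<^bsub>exponents\<^esub> y \<in> carrier exponents"
    if "x \<in> carrier exponents" "y \<in> carrier exponents" for x y :: "'v \<Rightarrow> nat"
    using finite_UnI[of "{v. x v \<noteq> 0}" "{v. y v \<noteq> 0}"] that
    by (auto simp: exponents_def intro: finite_subset[rotated])
qed (auto simp: exponents_def)

lemma mpoly_algebra: "cring A \<Longrightarrow> algebra A (mpoly A)"
  unfolding mpoly_def by (intro mon_algebra.mon_algebra exponents_mon_algebra)

lemma single_exponent: "(\<lambda>w. if w = v then n else 0) \<in> carrier exponents"
  by (simp add: exponents_def)

lemma mvar_closed: "cring A \<Longrightarrow> mvar A v \<in> carrier (mpoly A)"
  unfolding mvar_def mpoly_def
  by (intro mon_algebra.mon_basis_closed exponents_mon_algebra single_exponent)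

text \<open>Evaluating monomials is a monoid homomorphism from exponent vectors to E, so the
  universal property of the monoid algebra applies.\<close>

lemma mpoly_eval:
  assumes "algebra A E" and s: "\<And>v. s v \<in> carrier E"
  shows "mpoly_eval A E s \<in> alg_hom A (mpoly A) E" "mpoly_eval A E s (mvar A v) = s v"
proof -
  interpret E: algebra A E by fact
  let ?h = "\<lambda>e :: _ \<Rightarrow> nat. \<Otimes>\<^bsub>E\<^esub>v \<in> {v. e v \<noteq> 0}. s v [^]\<^bsub>E\<^esub> e v"
  have c: "?h e \<in> carrier E" for e using s by (intro E.finprod_closed) auto
  have m: "?h (e \<otimes>\<^bsub>exponents\<^esub> e') = ?h e \<otimes>\<^bsub>E\<^esub> ?h e'"
    if e: "e \<in> carrier exponents" and e': "e' \<in> carrier exponents" for e e'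
  proof -
    let ?S = "{v. e v \<noteq> 0} \<union> {v. e' v \<noteq> 0}"
    have fin: "finite ?S" using e e' by (simp add: exponents_def)
    \<comment> \<open>Variables with exponent 0 contribute the factor 1, so both products can run
      over the union of the two supports.\<close>
    have ext: "?h f = (\<Otimes>\<^bsub>E\<^esub>v \<in> ?S. s v [^]\<^bsub>E\<^esub> f v)" if "{v. f v \<noteq> 0} \<subseteq> ?S" for f
      using fin that s by (intro E.finprod_mono_neutral_cong_left) auto
    have "?h (e \<otimes>\<^bsub>exponents\<^esub> e') = (\<Otimes>\<^bsub>E\<^esub>v \<in> ?S. s v [^]\<^bsub>E\<^esub> e v \<otimes>\<^bsub>E\<^esub> s v [^]\<^bsub>E\<^esub> e' v)"
      using s by (subst ext) (auto simp: exponents_def E.nat_pow_mult intro!: E.finprod_cong')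
    also have "\<dots> = ?h e \<otimes>\<^bsub>E\<^esub> ?h e'"
      unfolding ext[of e, OF Un_upper1] ext[of e', OF Un_upper2] using s
      by (subst E.finprod_multf) auto
    finally show ?thesis .
  qed
  have o: "?h \<one>\<^bsub>exponents\<^esub> = \<one>\<^bsub>E\<^esub>" by (simp add: exponents_def)
  note ev = mon_eval_alg_hom[OF exponents_mon_algebra[OF E.R_cring] assms(1), of ?h, OF c m o]
  show "mpoly_eval A E s \<in> alg_hom A (mpoly A) E"
    unfolding mpoly_eval_def mpoly_def by (rule ev(1))
  show "mpoly_eval A E s (mvar A v) = s v"
    unfolding mpoly_eval_def mvar_def using s[of v] by (subst ev(2)) (simp_all add: single_exponent)
qed

text \<open>The unit vectors generate the monoid of exponent vectors. Agreement spreads from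
  variables to powers of one variable and then, by induction on the support, to all
  monomials.\<close>

lemma mpoly_alg_hom_eq:
  fixes A :: "('a, 'm) ring_scheme" and E :: "('a, 'b, 'n) module_scheme"
    and f g :: "(('v \<Rightarrow> nat) \<Rightarrow> 'a) \<Rightarrow> 'b"
  assumes "algebra A E" and f: "f \<in> alg_hom A (mpoly A) E" and g: "g \<in> alg_hom A (mpoly A) E"
    and v: "\<And>v. f (mvar A v) = g (mvar A v)" and x: "x \<in> carrier (mpoly A)"
  shows "f x = g x"
proof -
  interpret E: algebra A E by fact
  interpret mon_algebra A "exponents :: ('v \<Rightarrow> nat) monoid" by (rule exponents_mon_algebra[OF E.R_cring])
  note fD = alg_homD[OF f[unfolded mpoly_def]] and gD = alg_homD[OF g[unfolded mpoly_def]]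
  have mult: "f (\<delta> (e \<otimes>\<^bsub>exponents\<^esub> e')) = g (\<delta> (e \<otimes>\<^bsub>exponents\<^esub> e'))"
    if "e \<in> carrier exponents" "e' \<in> carrier exponents" "f (\<delta> e) = g (\<delta> e)" "f (\<delta> e') = g (\<delta> e')" for e e'
    using that by (simp add: fD gD mon_basis_closed flip: mon_basis_mult_one)
  have one: "f (\<delta> \<one>\<^bsub>exponents\<^esub>) = g (\<delta> \<one>\<^bsub>exponents\<^esub>)"
    using fD(5) gD(5) by (simp add: mon_ops(4))
  have single: "f (\<delta> (\<lambda>w. if w = v then n else 0)) = g (\<delta> (\<lambda>w. if w = v then n else 0))" for v n
  proof (induction n)
    case 0
    then show ?case using one by (simp add: exponents_def)
  next
    case (Suc n)
    have "(\<lambda>w. if w = v then Suc n else 0) =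
      (\<lambda>w. if w = v then n else 0) \<otimes>\<^bsub>exponents\<^esub> (\<lambda>w. if w = v then 1 else 0)"
      by (auto simp: exponents_def)
    then show ?case using mult[OF single_exponent single_exponent Suc] assms(4)[of v]
      by (simp add: mvar_def)
  qed
  have all: "finite S \<Longrightarrow> {v. e v \<noteq> 0} \<subseteq> S \<Longrightarrow> f (\<delta> e) = g (\<delta> e)" for S e
  proof (induction S arbitrary: e rule: finite_induct)
    case empty
    then have "e = \<one>\<^bsub>exponents\<^esub>" by (auto simp: exponents_def)
    then show ?case using one by simp
  next
    case (insert v S)
    have e: "e = e(v := 0) \<otimes>\<^bsub>exponents\<^esub> (\<lambda>w. if w = v then e v else 0)"
      by (auto simp: exponents_def)
    have c: "e(v := 0) \<in> carrier exponents"
      using insert.prems insert.hyps by (auto simp: exponents_def intro: finite_subset[of _ S])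
    show ?case
      by (subst (1 2) e) (use insert in \<open>intro mult c single_exponent single insert.IH; auto\<close>)
  qed
  show ?thesis
  proof (rule mon_alg_hom_eq[OF mon_algebra_axioms assms(1) f[unfolded mpoly_def] g[unfolded mpoly_def] _ x[unfolded mpoly_def]])
    fix u :: "'v \<Rightarrow> nat" assume "u \<in> carrier exponents"
    then show "f (\<delta> u) = g (\<delta> u)" by (intro all[of "{v. u v \<noteq> 0}"]) (auto simp: exponents_def)
  qed
qed

section \<open>Ideals, quotients and subalgebras of Hopf algebras\<close>

lemma tensor_map_with_coalg [simp]:
  "tensor_map A (with_coalg B d e s) C = tensor_map A B C"
  "tensor_map A B (with_coalg C d' e' s') = tensor_map A B C"
  by (intro ext, simp add: tensor_map_def)+

text \<open>For fixed c the x with f x c = 0 form an ideal, so it suffices to test generators. This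
  is applied twice: first with c the image of a generator from Y, then with c the image of an
  arbitrary element of the ideal of X.\<close>

lemma alg_hom_ideal_prod_zero:
  assumes B: "algebra A B" and C: "algebra A C" and f: "f \<in> alg_hom A B C"
    and X: "X \<subseteq> carrier B" and Y: "Y \<subseteq> carrier B"
    and XY: "\<And>x y. x \<in> X \<Longrightarrow> y \<in> Y \<Longrightarrow> f x \<otimes>\<^bsub>C\<^esub> f y = \<zero>\<^bsub>C\<^esub>"
    and z: "z \<in> (Idl\<^bsub>B\<^esub> X) \<cdot>\<^bsub>B\<^esub> (Idl\<^bsub>B\<^esub> Y)"
  shows "f z = \<zero>\<^bsub>C\<^esub>"
proof -
  interpret B: algebra A B by fact
  interpret C: algebra A C by fact
  note fD = alg_homD[OF f]
  have ann: "f x \<otimes>\<^bsub>C\<^esub> c = \<zero>\<^bsub>C\<^esub>"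
    if c: "c \<in> carrier C" and W: "W \<subseteq> carrier B" and 0: "\<And>w. w \<in> W \<Longrightarrow> f w \<otimes>\<^bsub>C\<^esub> c = \<zero>\<^bsub>C\<^esub>"
      and x: "x \<in> Idl\<^bsub>B\<^esub> W" for c W x
  proof -
    let ?J = "{x \<in> carrier B. f x \<otimes>\<^bsub>C\<^esub> c = \<zero>\<^bsub>C\<^esub>}"
    have "ideal ?J B"
    proof (rule idealI)
      show "ring B" by (rule cring.axioms(1)[OF B.M_cring])
      show "subgroup ?J (add_monoid B)"
        by (rule subgroup.intro)
           (use c in \<open>auto simp: fD C.l_distr C.l_minus alg_hom_zero_inv[OF f B C] simp flip: a_inv_def\<close>)
      show "a \<otimes>\<^bsub>B\<^esub> x \<in> ?J" "x \<otimes>\<^bsub>B\<^esub> a \<in> ?J" if "x \<in> ?J" "a \<in> carrier B" for a x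
      proof -
        have "f (a \<otimes>\<^bsub>B\<^esub> x) \<otimes>\<^bsub>C\<^esub> c = f a \<otimes>\<^bsub>C\<^esub> (f x \<otimes>\<^bsub>C\<^esub> c)" using that c by (simp add: fD C.m_assoc)
        then show "a \<otimes>\<^bsub>B\<^esub> x \<in> ?J" using that c by (simp add: fD)
        then show "x \<otimes>\<^bsub>B\<^esub> a \<in> ?J" using that by (simp add: B.m_comm)
      qed
    qed
    then have "Idl\<^bsub>B\<^esub> W \<subseteq> ?J" using W 0 by (intro B.genideal_minimal) auto
    with x show ?thesis by blast
  qed
  have IX: "ideal (Idl\<^bsub>B\<^esub> X) B" and IY: "ideal (Idl\<^bsub>B\<^esub> Y) B" using X Y by (auto intro: B.genideal_ideal)
  have cX: "x \<in> carrier B" if "x \<in> Idl\<^bsub>B\<^esub> X" for x using ideal.Icarr[OF IX that] .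
  have cY: "y \<in> carrier B" if "y \<in> Idl\<^bsub>B\<^esub> Y" for y using ideal.Icarr[OF IY that] .
  have xy: "f i \<otimes>\<^bsub>C\<^esub> f j = \<zero>\<^bsub>C\<^esub>" if i: "i \<in> Idl\<^bsub>B\<^esub> X" and j: "j \<in> Idl\<^bsub>B\<^esub> Y" for i j
  proof -
    have "f w \<otimes>\<^bsub>C\<^esub> f i = \<zero>\<^bsub>C\<^esub>" if w: "w \<in> Y" for w
    proof -
      have wB: "w \<in> carrier B" using w Y by blast
      have "f i \<otimes>\<^bsub>C\<^esub> f w = \<zero>\<^bsub>C\<^esub>" using wB w by (intro ann[OF _ X _ i]) (auto simp: fD XY)
      then show ?thesis using wB cX[OF i] by (simp add: C.m_comm fD)
    qed
    then have "f j \<otimes>\<^bsub>C\<^esub> f i = \<zero>\<^bsub>C\<^esub>" using cX[OF i] by (intro ann[OF _ Y _ j]) (simp_all add: fD)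
    then show ?thesis using cX[OF i] cY[OF j] by (simp add: C.m_comm fD)
  qed
  have "z \<in> carrier B \<and> f z = \<zero>\<^bsub>C\<^esub>" using z
    by (induction z rule: ideal_prod.induct) (auto simp: fD xy cX cY)
  then show ?thesis ..
qed

text \<open>The conditions of a Hopf ideal, in the form needed for factoring through the quotient:
  the comultiplication followed by the projection of both factors kills I.\<close>

lemma quot_hopf:
  assumes H: "algebra A H" and I: "ideal I H"
    and hom: "comult H \<in> alg_hom A H (tensor A H H)" "counit H \<in> alg_hom A H (base_alg A)"
      "antipode H \<in> alg_hom A H H"
    and kill: "\<And>x. x \<in> I \<Longrightarrow> tensor_map A (quot_hopf A H I) (quot_hopf A H I)
        (\<lambda>x. I +>\<^bsub>H\<^esub> x) (\<lambda>x. I +>\<^bsub>H\<^esub> x) (comult H x) = \<zero>\<^bsub>tensor A (quot_hopf A H I) (quot_hopf A H I)\<^esub>"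
      "\<And>x. x \<in> I \<Longrightarrow> counit H x = \<zero>\<^bsub>A\<^esub>" "\<And>x. x \<in> I \<Longrightarrow> antipode H x \<in> I"
  defines "K \<equiv> quot_hopf A H I" and "\<pi> \<equiv> \<lambda>x. I +>\<^bsub>H\<^esub> x"
  shows "comult K \<in> alg_hom A K (tensor A K K)" "counit K \<in> alg_hom A K (base_alg A)" "antipode K \<in> alg_hom A K K"
    and "\<And>x. x \<in> carrier H \<Longrightarrow> comult K (\<pi> x) = tensor_map A K K \<pi> \<pi> (comult H x)"
    "\<And>x. x \<in> carrier H \<Longrightarrow> counit K (\<pi> x) = counit H x"
    "\<And>x. x \<in> carrier H \<Longrightarrow> antipode K (\<pi> x) = \<pi> (antipode H x)"
proof -
  let ?Q = "quot_alg H I"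
  have K: "K = with_coalg ?Q (quot_lift (\<lambda>x. tensor_map A ?Q ?Q \<pi> \<pi> (comult H x)))
      (quot_lift (counit H)) (quot_lift (\<lambda>x. \<pi> (antipode H x)))"
    by (simp add: K_def quot_hopf_def Let_def \<pi>_def)
  note Q = quot_algebra[OF H I, folded \<pi>_def]
  note QQ = tensor_algebra[OF Q(1) Q(1)]
  note BA = algebra_base_alg[OF algebra.R_cring[OF H]]
  note mm = tensor_map[OF Q(1) Q(1) H H Q(2) Q(2)]
  have k1: "tensor_map A ?Q ?Q \<pi> \<pi> (comult H x) = \<zero>\<^bsub>tensor A ?Q ?Q\<^esub>" if "x \<in> I" for x
    using kill(1)[OF that, folded K_def \<pi>_def] by (simp add: K)
  have k2: "counit H x = \<zero>\<^bsub>base_alg A\<^esub>" if "x \<in> I" for x using kill(2)[OF that] by (simp add: base_alg_def)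
  have k3: "\<pi> (antipode H x) = \<zero>\<^bsub>?Q\<^esub>" if "x \<in> I" for x
    unfolding \<pi>_def using kill(3)[OF that] ideal.Icarr[OF I kill(3)[OF that]]
    by (simp add: quot_eq_zero_iff[OF H I])
  note l1 = quot_lift[OF H I QQ alg_hom_comp[OF hom(1) mm(1)] k1, folded \<pi>_def]
  note l2 = quot_lift[OF H I BA hom(2) k2, folded \<pi>_def]
  note l3 = quot_lift[OF H I Q(1) alg_hom_comp[OF hom(3) Q(2)] k3, folded \<pi>_def]
  show "comult K \<in> alg_hom A K (tensor A K K)" "counit K \<in> alg_hom A K (base_alg A)" "antipode K \<in> alg_hom A K K"
    using l1(1) l2(1) l3(1) by (simp_all add: K)
  show "comult K (\<pi> x) = tensor_map A K K \<pi> \<pi> (comult H x)" "counit K (\<pi> x) = counit H x"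
    "antipode K (\<pi> x) = \<pi> (antipode H x)" if "x \<in> carrier H" for x
    using that by (simp_all add: K l1(2) l2(2) l3(2))
qed

lemma quot_hopf_algebra:
  assumes "algebra A H" "ideal I H"
  shows "algebra A (quot_hopf A H I)" "(\<lambda>x. I +>\<^bsub>H\<^esub> x) \<in> alg_hom A H (quot_hopf A H I)"
    and "\<And>x. x \<in> carrier H \<Longrightarrow> I +>\<^bsub>H\<^esub> x = \<zero>\<^bsub>quot_hopf A H I\<^esub> \<longleftrightarrow> x \<in> I"
    and "\<And>X. X \<in> carrier (quot_hopf A H I) \<longleftrightarrow> (\<exists>x\<in>carrier H. X = I +>\<^bsub>H\<^esub> x)"
  using quot_algebra[OF assms] quot_eq_zero_iff[OF assms]
  by (simp_all add: quot_hopf_def Let_def algebra_with_coalg quot_carrier)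

text \<open>Closure under scalars yields zero as 0 1 and negatives as (-1) x.\<close>

lemma subalgebra:
  assumes H: "algebra A H" and K: "K \<subseteq> carrier H" "\<one>\<^bsub>H\<^esub> \<in> K"
    and add: "\<And>x y. x \<in> K \<Longrightarrow> y \<in> K \<Longrightarrow> x \<oplus>\<^bsub>H\<^esub> y \<in> K"
    and mult: "\<And>x y. x \<in> K \<Longrightarrow> y \<in> K \<Longrightarrow> x \<otimes>\<^bsub>H\<^esub> y \<in> K"
    and smult: "\<And>a x. a \<in> carrier A \<Longrightarrow> x \<in> K \<Longrightarrow> a \<odot>\<^bsub>H\<^esub> x \<in> K"
  shows "algebra A (H\<lparr>carrier := K\<rparr>)"
proof -
  interpret H: algebra A H by fact
  have [simp]: "x \<in> carrier H" if "x \<in> K" for x using K(1) that by blast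
  have z: "\<zero>\<^bsub>H\<^esub> \<in> K" using smult[OF H.R.zero_closed K(2)] by simp
  have "cring (H\<lparr>carrier := K\<rparr>)"
  proof (rule cringI)
    show "abelian_group (H\<lparr>carrier := K\<rparr>)"
    proof (rule abelian_groupI)
      show "\<exists>y\<in>carrier (H\<lparr>carrier := K\<rparr>). y \<oplus>\<^bsub>H\<lparr>carrier := K\<rparr>\<^esub> x = \<zero>\<^bsub>H\<lparr>carrier := K\<rparr>\<^esub>"
        if x: "x \<in> carrier (H\<lparr>carrier := K\<rparr>)" for x
      proof
        show "(\<ominus>\<^bsub>A\<^esub> \<one>\<^bsub>A\<^esub>) \<odot>\<^bsub>H\<^esub> x \<oplus>\<^bsub>H\<lparr>carrier := K\<rparr>\<^esub> x = \<zero>\<^bsub>H\<lparr>carrier := K\<rparr>\<^esub>"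
          using x by (simp add: H.smult_l_minus H.M.l_neg)
        show "(\<ominus>\<^bsub>A\<^esub> \<one>\<^bsub>A\<^esub>) \<odot>\<^bsub>H\<^esub> x \<in> carrier (H\<lparr>carrier := K\<rparr>)" using x by (simp add: smult)
      qed
    qed (simp_all add: add z H.M.a_ac)
    show "comm_monoid (H\<lparr>carrier := K\<rparr>)"
      by (rule comm_monoidI) (simp_all add: K(2) mult H.m_ac)
  qed (simp add: H.l_distr)
  then show ?thesis
    by (intro algebraI H.R_cring)
       (simp_all add: smult H.smult_l_distr H.smult_r_distr H.smult_assoc1 H.smult_assoc2)
qed

section \<open>The normalizer of the diagonal torus\<close>

context cring
begin

lemma det_mult:
  assumes [simp]: "a11 \<in> carrier R" "a12 \<in> carrier R" "a21 \<in> carrier R" "a22 \<in> carrier R"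
    "b11 \<in> carrier R" "b12 \<in> carrier R" "b21 \<in> carrier R" "b22 \<in> carrier R"
  shows "(a11 \<otimes> b11 \<oplus> a12 \<otimes> b21) \<otimes> (a21 \<otimes> b12 \<oplus> a22 \<otimes> b22) \<ominus>
      (a11 \<otimes> b12 \<oplus> a12 \<otimes> b22) \<otimes> (a21 \<otimes> b11 \<oplus> a22 \<otimes> b21) =
      (a11 \<otimes> a22 \<ominus> a12 \<otimes> a21) \<otimes> (b11 \<otimes> b22 \<ominus> b12 \<otimes> b21)"
proof -
  \<comment> \<open>The two products on the left expand to p + c and q + c with the same mixed part
    c; p - q is the expanded product of the determinants.\<close>
  define p where "p = (a11 \<otimes> a22) \<otimes> (b11 \<otimes> b22) \<oplus> (a12 \<otimes> a21) \<otimes> (b12 \<otimes> b21)"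
  define q where "q = (a11 \<otimes> a22) \<otimes> (b12 \<otimes> b21) \<oplus> (a12 \<otimes> a21) \<otimes> (b11 \<otimes> b22)"
  define c where "c = (a11 \<otimes> a21) \<otimes> (b11 \<otimes> b12) \<oplus> (a12 \<otimes> a22) \<otimes> (b21 \<otimes> b22)"
  have pqc: "p \<in> carrier R" "q \<in> carrier R" "c \<in> carrier R" by (simp_all add: p_def q_def c_def)
  have "(a11 \<otimes> b11 \<oplus> a12 \<otimes> b21) \<otimes> (a21 \<otimes> b12 \<oplus> a22 \<otimes> b22) = p \<oplus> c"
    "(a11 \<otimes> b12 \<oplus> a12 \<otimes> b22) \<otimes> (a21 \<otimes> b11 \<oplus> a22 \<otimes> b21) = q \<oplus> c"
    unfolding p_def q_def c_def by (simp_all add: l_distr r_distr m_ac a_ac)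
  moreover have "(p \<oplus> c) \<ominus> (q \<oplus> c) = p \<ominus> q" using pqc by algebra
  moreover have "(u \<ominus> v) \<otimes> (s \<ominus> t) = (u \<otimes> s \<oplus> v \<otimes> t) \<ominus> (u \<otimes> t \<oplus> v \<otimes> s)"
    if "u \<in> carrier R" "v \<in> carrier R" "s \<in> carrier R" "t \<in> carrier R" for u v s t
    using that by algebra
  ultimately show ?thesis by (simp add: p_def q_def)
qed

text \<open>The relation (1/D) D = 1 for a matrix product: what makes the comultiplication of k[G]
  well defined.\<close>

lemma det_unit_mult:
  assumes [simp]: "y \<in> carrier R" "y' \<in> carrier R"
    "a11 \<in> carrier R" "a12 \<in> carrier R" "a21 \<in> carrier R" "a22 \<in> carrier R"
    "b11 \<in> carrier R" "b12 \<in> carrier R" "b21 \<in> carrier R" "b22 \<in> carrier R"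
    and u: "y \<otimes> (a11 \<otimes> a22 \<ominus> a12 \<otimes> a21) = \<one>" "y' \<otimes> (b11 \<otimes> b22 \<ominus> b12 \<otimes> b21) = \<one>"
  shows "(y \<otimes> y') \<otimes> ((a11 \<otimes> b11 \<oplus> a12 \<otimes> b21) \<otimes> (a21 \<otimes> b12 \<oplus> a22 \<otimes> b22) \<ominus>
      (a11 \<otimes> b12 \<oplus> a12 \<otimes> b22) \<otimes> (a21 \<otimes> b11 \<oplus> a22 \<otimes> b21)) = \<one>"
proof -
  have "(y \<otimes> y') \<otimes> (s \<otimes> t) = (y \<otimes> s) \<otimes> (y' \<otimes> t)" if "s \<in> carrier R" "t \<in> carrier R" for s t
    using that by (simp add: m_ac)
  then show ?thesis using u by (simp add: det_mult)
qed

text \<open>The first part makes the antipode of k[G] well defined, since the adjugate divided by D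
  has determinant 1/D. The second says that the antipode fixes x11 x22 / D.\<close>

lemma det_unit_adjugate:
  assumes [simp]: "y \<in> carrier R"
    "a11 \<in> carrier R" "a12 \<in> carrier R" "a21 \<in> carrier R" "a22 \<in> carrier R"
    and u: "y \<otimes> (a11 \<otimes> a22 \<ominus> a12 \<otimes> a21) = \<one>"
  shows "(a11 \<otimes> a22 \<ominus> a12 \<otimes> a21) \<otimes> ((y \<otimes> a22) \<otimes> (y \<otimes> a11) \<ominus> \<ominus> (y \<otimes> a12) \<otimes> \<ominus> (y \<otimes> a21)) = \<one>"
    and "(a11 \<otimes> a22 \<ominus> a12 \<otimes> a21) \<otimes> (y \<otimes> a22) \<otimes> (y \<otimes> a11) = y \<otimes> a11 \<otimes> a22"
proof -
  have *: "(y \<otimes> a22) \<otimes> (y \<otimes> a11) \<ominus> \<ominus> (y \<otimes> a12) \<otimes> \<ominus> (y \<otimes> a21) = y \<otimes> (y \<otimes> (a11 \<otimes> a22 \<ominus> a12 \<otimes> a21))"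
    by (simp add: minus_eq r_distr l_minus r_minus m_ac)
  show "(a11 \<otimes> a22 \<ominus> a12 \<otimes> a21) \<otimes> ((y \<otimes> a22) \<otimes> (y \<otimes> a11) \<ominus> \<ominus> (y \<otimes> a12) \<otimes> \<ominus> (y \<otimes> a21)) = \<one>"
    unfolding * u using u by (simp add: m_comm)
  have "d \<otimes> (y \<otimes> a22) \<otimes> (y \<otimes> a11) = (y \<otimes> d) \<otimes> (y \<otimes> a11 \<otimes> a22)" if "d \<in> carrier R" for d
    using that by (simp add: m_ac)
  then show "(a11 \<otimes> a22 \<ominus> a12 \<otimes> a21) \<otimes> (y \<otimes> a22) \<otimes> (y \<otimes> a11) = y \<otimes> a11 \<otimes> a22"
    using u by simp
qed

lemma det_unit_compl:
  assumes [simp]: "y \<in> carrier R"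
    "a11 \<in> carrier R" "a12 \<in> carrier R" "a21 \<in> carrier R" "a22 \<in> carrier R"
    and u: "y \<otimes> (a11 \<otimes> a22 \<ominus> a12 \<otimes> a21) = \<one>"
  shows "\<one> \<ominus> y \<otimes> a11 \<otimes> a22 = \<ominus> (y \<otimes> a12 \<otimes> a21)"
proof -
  have "y \<otimes> a11 \<otimes> a22 \<oplus> \<ominus> (y \<otimes> a12 \<otimes> a21) = \<one>"
    using u by (simp add: minus_eq r_distr r_minus m_assoc)
  then show ?thesis using eq_minusI[of "y \<otimes> a11 \<otimes> a22" "\<ominus> (y \<otimes> a12 \<otimes> a21)" \<one>] by simp
qed

lemma det_unit_idem:
  assumes [simp]: "y \<in> carrier R"
    "a11 \<in> carrier R" "a12 \<in> carrier R" "a21 \<in> carrier R" "a22 \<in> carrier R"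
    and u: "y \<otimes> (a11 \<otimes> a22 \<ominus> a12 \<otimes> a21) = \<one>" and z: "a12 \<otimes> a11 = \<zero>"
  shows "(y \<otimes> a11 \<otimes> a22) \<otimes> (y \<otimes> a11 \<otimes> a22) = y \<otimes> a11 \<otimes> a22"
proof -
  have "(y \<otimes> a11 \<otimes> a22) \<otimes> \<ominus> (y \<otimes> a12 \<otimes> a21) = \<ominus> ((a12 \<otimes> a11) \<otimes> (y \<otimes> a22 \<otimes> y \<otimes> a21))"
    by (simp add: r_minus m_ac)
  then show ?thesis
    by (intro idem_if_compl) (simp_all add: det_unit_compl[OF _ _ _ _ _ u] z)
qed

text \<open>Of the four terms of the expansion the mixed ones contain a21 a11 or a12 a22. The others
  are e e' and (1 - e)(1 - e'), the two signs from \<open>det_unit_compl\<close> cancelling.\<close>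

lemma det_unit_xnor:
  assumes [simp]: "y \<in> carrier R" "y' \<in> carrier R"
    "a11 \<in> carrier R" "a12 \<in> carrier R" "a21 \<in> carrier R" "a22 \<in> carrier R"
    "b11 \<in> carrier R" "b12 \<in> carrier R" "b21 \<in> carrier R" "b22 \<in> carrier R"
    and u: "y \<otimes> (a11 \<otimes> a22 \<ominus> a12 \<otimes> a21) = \<one>" "y' \<otimes> (b11 \<otimes> b22 \<ominus> b12 \<otimes> b21) = \<one>"
    and z: "a21 \<otimes> a11 = \<zero>" "a12 \<otimes> a22 = \<zero>"
  shows "(y \<otimes> y') \<otimes> (a11 \<otimes> b11 \<oplus> a12 \<otimes> b21) \<otimes> (a21 \<otimes> b12 \<oplus> a22 \<otimes> b22) =
      xnor R (y \<otimes> a11 \<otimes> a22) (y' \<otimes> b11 \<otimes> b22)"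
proof -
  have "(y \<otimes> y') \<otimes> (a11 \<otimes> b11 \<oplus> a12 \<otimes> b21) \<otimes> (a21 \<otimes> b12 \<oplus> a22 \<otimes> b22) =
    (y \<otimes> a11 \<otimes> a22) \<otimes> (y' \<otimes> b11 \<otimes> b22) \<oplus> (y \<otimes> a12 \<otimes> a21) \<otimes> (y' \<otimes> b12 \<otimes> b21) \<oplus>
    ((a21 \<otimes> a11) \<otimes> (y \<otimes> y' \<otimes> b11 \<otimes> b12) \<oplus> (a12 \<otimes> a22) \<otimes> (y \<otimes> y' \<otimes> b21 \<otimes> b22))"
    by (simp add: l_distr r_distr m_ac a_ac)
  then show ?thesis
    by (simp add: z xnor_alt det_unit_compl[OF _ _ _ _ _ u(1)] det_unit_compl[OF _ _ _ _ _ u(2)] l_minus r_minus)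
qed

end

section \<open>The coordinate ring of GL_2 and its structure maps\<close>

locale gl2 = A: cring A for A :: "('a, 'm) ring_scheme"
begin

abbreviation "P \<equiv> mpoly A :: ('a, (gl2_var \<Rightarrow> nat) \<Rightarrow> 'a) module"
abbreviation "G \<equiv> gl2_hopf A"
abbreviation "x \<equiv> gl2_x A"

lemma mpoly_gl2_algebra: "algebra A P" by (rule mpoly_algebra[OF A.is_cring])

interpretation P: algebra A P by (rule mpoly_gl2_algebra)

abbreviation "gl2_rel E s \<equiv>
  s Dinv \<otimes>\<^bsub>E\<^esub> (s X11 \<otimes>\<^bsub>E\<^esub> s X22 \<ominus>\<^bsub>E\<^esub> s X12 \<otimes>\<^bsub>E\<^esub> s X21)"

lemma mvar_gl2_closed [simp]: "mvar A v \<in> carrier P" by (rule mvar_closed[OF A.is_cring])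

lemma gl2_ideal: "ideal (gl2_ideal A) P"
  unfolding gl2_ideal_def Let_def by (rule P.genideal_ideal) simp

lemma gl2_algebra: "algebra A G"
  and G_proj: "(\<lambda>p. gl2_ideal A +>\<^bsub>P\<^esub> p) \<in> alg_hom A P G"
  using quot_algebra[OF mpoly_gl2_algebra gl2_ideal]
  by (simp_all add: gl2_hopf_def gl2_alg_def Let_def algebra_with_coalg)

interpretation G: algebra A G by (rule gl2_algebra)

lemma x_closed [simp]: "x v \<in> carrier G"
  unfolding gl2_x_def by (rule alg_homD(2)[OF G_proj]) simp

lemma x_rel: "gl2_rel G x = \<one>\<^bsub>G\<^esub>"
proof -
  let ?r = "gl2_rel P (mvar A)"
  have "gl2_rel G x = gl2_ideal A +>\<^bsub>P\<^esub> ?r"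
    by (simp add: gl2_x_def alg_homD[OF G_proj] alg_hom_zero_inv[OF G_proj mpoly_gl2_algebra gl2_algebra])
  also have "\<dots> = gl2_ideal A +>\<^bsub>P\<^esub> \<one>\<^bsub>P\<^esub>"
    by (subst quot_eq_iff[OF mpoly_gl2_algebra gl2_ideal]) (simp_all add: gl2_ideal_def Let_def P.genideal_self')
  finally show ?thesis by (simp add: alg_homD[OF G_proj])
qed

text \<open>Homomorphisms out of k[G] are invertible matrices: \<open>r\<close> says that
  \<open>s Dinv\<close> inverts the determinant, which is exactly what kills the defining
  ideal.\<close>

lemma gl2_eval:
  assumes E: "algebra A E" and s: "\<And>v. s v \<in> carrier E" and r: "gl2_rel E s = \<one>\<^bsub>E\<^esub>"
  shows "gl2_eval A E s \<in> alg_hom A G E" "gl2_eval A E s (x v) = s v"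
proof -
  interpret E: algebra A E by fact
  note ev = mpoly_eval[OF E s, of id, unfolded id_def]
  note zi = alg_hom_zero_inv[OF ev(1) mpoly_gl2_algebra E]
  have "mpoly_eval A E s p = \<zero>\<^bsub>E\<^esub>" if "p \<in> gl2_ideal A" for p
    using that unfolding gl2_ideal_def Let_def
    by (rule alg_hom_genideal_zero[OF mpoly_gl2_algebra E ev(1), rotated 2])
       (use s r in \<open>auto simp: alg_homD[OF ev(1)] zi ev(2) E.minus_eq E.r_neg\<close>)
  \<comment> \<open>Despite its local name, this fact is the factorization through the quotient by
    the defining ideal.\<close>
  note left_translation = quot_lift[OF mpoly_gl2_algebra gl2_ideal E ev(1) this]
  show "gl2_eval A E s \<in> alg_hom A G E"
    unfolding gl2_eval_def using left_translation(1) by (simp add: gl2_hopf_def gl2_alg_def Let_def)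
  show "gl2_eval A E s (x v) = s v"
    unfolding gl2_eval_def gl2_x_def by (simp add: left_translation(2) ev(2))
qed

lemma gl2_hom_eq:
  assumes E: "algebra A E" and f: "f \<in> alg_hom A G E" and g: "g \<in> alg_hom A G E"
    and v: "\<And>v. f (x v) = g (x v)" and p: "p \<in> carrier G"
  shows "f p = g p"
proof -
  obtain q where q: "q \<in> carrier P" "p = gl2_ideal A +>\<^bsub>P\<^esub> q"
    using p by (auto simp: gl2_hopf_def gl2_alg_def Let_def quot_carrier)
  show ?thesis unfolding q(2)
    by (rule mpoly_alg_hom_eq[OF E alg_hom_comp[OF G_proj f] alg_hom_comp[OF G_proj g] _ q(1)])
       (rule v[unfolded gl2_x_def])
qed

abbreviation "GG \<equiv> tensor A G G"

lemma gl2_tensor_algebra: "algebra A GG" by (rule tensor_algebra[OF gl2_algebra gl2_algebra])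

interpretation GG: algebra A GG by (rule gl2_tensor_algebra)

abbreviation "t u w \<equiv> tensor_elt A G G (x u) (x w)"

lemma comult_gen:
  "gl2_comult_gen A X11 = t X11 X11 \<oplus>\<^bsub>GG\<^esub> t X12 X21"
  "gl2_comult_gen A X12 = t X11 X12 \<oplus>\<^bsub>GG\<^esub> t X12 X22"
  "gl2_comult_gen A X21 = t X21 X11 \<oplus>\<^bsub>GG\<^esub> t X22 X21"
  "gl2_comult_gen A X22 = t X21 X12 \<oplus>\<^bsub>GG\<^esub> t X22 X22"
  "gl2_comult_gen A Dinv = t Dinv Dinv"
  by (simp_all add: gl2_comult_gen_def gl2_hopf_def Let_def)

lemma t_split: "t u w = tensor_elt A G G (x u) \<one>\<^bsub>G\<^esub> \<otimes>\<^bsub>GG\<^esub> tensor_elt A G G \<one>\<^bsub>G\<^esub> (x w)"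
  by (rule tensor_elt_split[OF gl2_algebra gl2_algebra]) simp_all

lemma hom_rel:
  assumes "algebra A E" "f \<in> alg_hom A G E"
  shows "gl2_rel E (\<lambda>v. f (x v)) = \<one>\<^bsub>E\<^esub>"
  using arg_cong[OF x_rel, of f]
  by (simp add: alg_homD[OF assms(2)] alg_hom_zero_inv[OF assms(2) gl2_algebra assms(1)])

text \<open>The comultiplied generators form the product of the matrices x \<otimes> 1 and 1
  \<otimes> x, each inheriting the relation for 1/D from k[G].\<close>

lemma comult_gen_rel: "gl2_rel GG (gl2_comult_gen A) = \<one>\<^bsub>GG\<^esub>"
  unfolding comult_gen t_split
  by (rule GG.det_unit_mult)
     (simp_all add: tensor_elt_closed[OF gl2_algebra gl2_algebra] hom_rel[OF gl2_tensor_algebra tensor_inl[OF gl2_algebra gl2_algebra]] hom_rel[OF gl2_tensor_algebra tensor_inr[OF gl2_algebra gl2_algebra]])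

lemma comult_gen_closed: "gl2_comult_gen A v \<in> carrier GG"
  by (cases v) (simp_all add: comult_gen tensor_elt_closed[OF gl2_algebra gl2_algebra])

lemma gl2_comult: "comult G \<in> alg_hom A G GG" "comult G (x v) = gl2_comult_gen A v"
proof -
  have "comult G = gl2_eval A GG (gl2_comult_gen A)"
    by (simp add: gl2_hopf_def Let_def)
  then show "comult G \<in> alg_hom A G GG" "comult G (x v) = gl2_comult_gen A v"
    using gl2_eval[OF gl2_tensor_algebra comult_gen_closed comult_gen_rel] by simp_all
qed

lemma base_algebra: "algebra A (base_alg A)" by (rule algebra_base_alg[OF A.is_cring])

lemma base_simps [simp]: "carrier (base_alg A) = carrier A" "\<one>\<^bsub>base_alg A\<^esub> = \<one>\<^bsub>A\<^esub>"
  "\<zero>\<^bsub>base_alg A\<^esub> = \<zero>\<^bsub>A\<^esub>" "a \<otimes>\<^bsub>base_alg A\<^esub> b = a \<otimes>\<^bsub>A\<^esub> b" "a \<oplus>\<^bsub>base_alg A\<^esub> b = a \<oplus>\<^bsub>A\<^esub> b"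
  "a \<ominus>\<^bsub>base_alg A\<^esub> b = a \<ominus>\<^bsub>A\<^esub> b" "a \<odot>\<^bsub>base_alg A\<^esub> b = a \<otimes>\<^bsub>A\<^esub> b"
  by (simp_all add: base_alg_def a_minus_def a_inv_def m_inv_def)

lemma gl2_counit: "counit G \<in> alg_hom A G (base_alg A)" "counit G (x v) = gl2_counit_gen A v"
proof -
  have "counit G = gl2_eval A (base_alg A) (gl2_counit_gen A)"
    by (simp add: gl2_hopf_def Let_def)
  moreover have "gl2_counit_gen A v \<in> carrier (base_alg A)" for v
    by (cases v) (simp_all add: gl2_counit_gen_def)
  moreover have "gl2_rel (base_alg A) (gl2_counit_gen A) = \<one>\<^bsub>base_alg A\<^esub>"
    by (simp add: gl2_counit_gen_def A.minus_eq)
  ultimately show "counit G \<in> alg_hom A G (base_alg A)" "counit G (x v) = gl2_counit_gen A v"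
    using gl2_eval[OF base_algebra] by simp_all
qed

lemma antipode_gen:
  "gl2_antipode_gen A X11 = x Dinv \<otimes>\<^bsub>G\<^esub> x X22"
  "gl2_antipode_gen A X12 = \<ominus>\<^bsub>G\<^esub> (x Dinv \<otimes>\<^bsub>G\<^esub> x X12)"
  "gl2_antipode_gen A X21 = \<ominus>\<^bsub>G\<^esub> (x Dinv \<otimes>\<^bsub>G\<^esub> x X21)"
  "gl2_antipode_gen A X22 = x Dinv \<otimes>\<^bsub>G\<^esub> x X11"
  "gl2_antipode_gen A Dinv = x X11 \<otimes>\<^bsub>G\<^esub> x X22 \<ominus>\<^bsub>G\<^esub> x X12 \<otimes>\<^bsub>G\<^esub> x X21"
  by (simp_all add: gl2_antipode_gen_def gl2_hopf_def Let_def)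

lemma gl2_antipode: "antipode G \<in> alg_hom A G G" "antipode G (x v) = gl2_antipode_gen A v"
proof -
  have alg: "algebra A (gl2_alg A)"
    unfolding gl2_alg_def by (rule quot_algebra(1)[OF mpoly_gl2_algebra gl2_ideal])
  have "gl2_antipode_gen A v \<in> carrier G" for v
    by (cases v) (simp_all add: antipode_gen)
  then have closed: "gl2_antipode_gen A v \<in> carrier (gl2_alg A)" for v
    by (simp add: gl2_hopf_def Let_def)
  have "gl2_rel G (gl2_antipode_gen A) = \<one>\<^bsub>G\<^esub>"
    unfolding antipode_gen by (rule G.det_unit_adjugate(1)) (simp_all add: x_rel)
  then have "gl2_rel (gl2_alg A) (gl2_antipode_gen A) = \<one>\<^bsub>gl2_alg A\<^esub>"
    by (simp add: gl2_hopf_def Let_def)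
  note ev = gl2_eval[OF alg closed this]
  have S: "antipode G = gl2_eval A (gl2_alg A) (gl2_antipode_gen A)"
    by (simp add: gl2_hopf_def Let_def)
  show "antipode G (x v) = gl2_antipode_gen A v" unfolding S by (rule ev(2))
  show "antipode G \<in> alg_hom A G G"
    unfolding S using ev(1) by (simp add: gl2_hopf_def Let_def)
qed

text \<open>Left translation by the permutation matrix \<open>w\<close>; the determinant of \<open>w\<close> is \<open>-1\<close>.\<close>

definition row_swap :: "gl2_var \<Rightarrow> ((gl2_var \<Rightarrow> nat) \<Rightarrow> 'a) set" where
  "row_swap v = (case v of X11 \<Rightarrow> x X21 | X12 \<Rightarrow> x X22 | X21 \<Rightarrow> x X11 | X22 \<Rightarrow> x X12
    | Dinv \<Rightarrow> \<ominus>\<^bsub>G\<^esub> x Dinv)"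

abbreviation "L \<equiv> gl2_eval A G row_swap"

lemma left_translation: "L \<in> alg_hom A G G" "L (x v) = row_swap v"
proof -
  have "row_swap v \<in> carrier G" for v by (cases v) (simp_all add: row_swap_def)
  moreover have "gl2_rel G row_swap = gl2_rel G x"
    by (simp add: row_swap_def G.minus_eq G.r_distr G.l_minus G.r_minus G.m_ac G.a_ac)
  ultimately show "L \<in> alg_hom A G G" "L (x v) = row_swap v"
    using gl2_eval[OF gl2_algebra] by (simp_all add: x_rel)
qed

lemma left_translation_involutive: "g \<in> carrier G \<Longrightarrow> L (L g) = g"
proof (rule gl2_hom_eq[OF gl2_algebra alg_hom_comp[OF left_translation(1) left_translation(1)] alg_hom_id])
  show "L (L (x v)) = x v" for v
    by (cases v) (simp_all add: left_translation(2) row_swap_def alg_hom_zero_inv[OF left_translation(1) gl2_algebra gl2_algebra])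
qed

section \<open>The subgroups T and N and the Hopf structure of k[N]\<close>

abbreviation "I\<^sub>1 \<equiv> torus_ideal A"
abbreviation "I\<^sub>2 \<equiv> antitorus_ideal A"
abbreviation "I\<^sub>N \<equiv> norm_ideal A"

lemma ideals: "ideal I\<^sub>1 G" "ideal I\<^sub>2 G" "ideal I\<^sub>N G"
  and ideal_gens: "x X12 \<in> I\<^sub>1" "x X21 \<in> I\<^sub>1" "x X11 \<in> I\<^sub>2" "x X22 \<in> I\<^sub>2"
proof -
  show 1: "ideal I\<^sub>1 G" unfolding torus_ideal_def by (rule G.genideal_ideal) simp
  show 2: "ideal I\<^sub>2 G" unfolding antitorus_ideal_def by (rule G.genideal_ideal) simp
  show "ideal I\<^sub>N G" unfolding norm_ideal_def by (rule G.ideal_prod_is_ideal[OF 1 2])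
  show "x X12 \<in> I\<^sub>1" "x X21 \<in> I\<^sub>1" "x X11 \<in> I\<^sub>2" "x X22 \<in> I\<^sub>2"
    unfolding torus_ideal_def antitorus_ideal_def by (rule subsetD[OF G.genideal_self]; simp)+
qed

lemma norm_ideal_zero:
  assumes "algebra A E" "f \<in> alg_hom A G E"
    and "f (x X12) \<otimes>\<^bsub>E\<^esub> f (x X11) = \<zero>\<^bsub>E\<^esub>" "f (x X12) \<otimes>\<^bsub>E\<^esub> f (x X22) = \<zero>\<^bsub>E\<^esub>"
    "f (x X21) \<otimes>\<^bsub>E\<^esub> f (x X11) = \<zero>\<^bsub>E\<^esub>" "f (x X21) \<otimes>\<^bsub>E\<^esub> f (x X22) = \<zero>\<^bsub>E\<^esub>"
    and "g \<in> I\<^sub>N"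
  shows "f g = \<zero>\<^bsub>E\<^esub>"
  using assms(7) unfolding norm_ideal_def torus_ideal_def antitorus_ideal_def
  by (rule alg_hom_ideal_prod_zero[OF gl2_algebra assms(1,2), rotated 3]) (use assms(3-6) in auto)

lemma norm_ideal_prod: "i \<in> I\<^sub>1 \<Longrightarrow> j \<in> I\<^sub>2 \<Longrightarrow> i \<otimes>\<^bsub>G\<^esub> j \<in> I\<^sub>N"
  unfolding norm_ideal_def by (rule ideal_prod.prod)

abbreviation "N \<equiv> norm_hopf A"
abbreviation "T \<equiv> torus_hopf A"
abbreviation "\<pi>\<^sub>N g \<equiv> I\<^sub>N +>\<^bsub>G\<^esub> g"
abbreviation "\<pi>\<^sub>T g \<equiv> I\<^sub>1 +>\<^bsub>G\<^esub> g"

lemmas norm_quotient = quot_hopf_algebra[OF gl2_algebra ideals(3), folded norm_hopf_def]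
lemmas torus_quotient = quot_hopf_algebra[OF gl2_algebra ideals(1), folded torus_hopf_def]

abbreviation "n v \<equiv> \<pi>\<^sub>N (x v)"

lemma n_closed [simp]: "n v \<in> carrier N" by (simp add: alg_homD(2)[OF norm_quotient(2)])

lemma n_prod: "n X12 \<otimes>\<^bsub>N\<^esub> n X11 = \<zero>\<^bsub>N\<^esub>" "n X12 \<otimes>\<^bsub>N\<^esub> n X22 = \<zero>\<^bsub>N\<^esub>"
  "n X21 \<otimes>\<^bsub>N\<^esub> n X11 = \<zero>\<^bsub>N\<^esub>" "n X21 \<otimes>\<^bsub>N\<^esub> n X22 = \<zero>\<^bsub>N\<^esub>"
  by (simp_all add: norm_quotient(3) norm_ideal_prod ideal_gens flip: alg_homD(4)[OF norm_quotient(2)])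

interpretation N: algebra A N by (rule norm_quotient(1))
interpretation T: algebra A T by (rule torus_quotient(1))

abbreviation "NN \<equiv> tensor A N N"
lemma norm_tensor_algebra: "algebra A NN" by (rule tensor_algebra[OF norm_quotient(1) norm_quotient(1)])
interpretation NN: algebra A NN by (rule norm_tensor_algebra)

abbreviation "l v \<equiv> tensor_elt A N N (n v) \<one>\<^bsub>N\<^esub>"
abbreviation "r v \<equiv> tensor_elt A N N \<one>\<^bsub>N\<^esub> (n v)"

lemmas NN_map = tensor_map[OF norm_quotient(1) norm_quotient(1) gl2_algebra gl2_algebra norm_quotient(2) norm_quotient(2)]

lemma lr_closed [simp]: "l v \<in> carrier NN" "r v \<in> carrier NN"
  by (simp_all add: tensor_elt_closed[OF norm_quotient(1) norm_quotient(1)])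

lemma tn_split: "tensor_elt A N N (n u) (n w) = l u \<otimes>\<^bsub>NN\<^esub> r w"
  by (rule tensor_elt_split[OF norm_quotient(1) norm_quotient(1)]) simp_all

lemma comult_NN:
  "tensor_map A N N (\<lambda>g. \<pi>\<^sub>N g) (\<lambda>g. \<pi>\<^sub>N g) (comult G (x X11)) = l X11 \<otimes>\<^bsub>NN\<^esub> r X11 \<oplus>\<^bsub>NN\<^esub> l X12 \<otimes>\<^bsub>NN\<^esub> r X21"
  "tensor_map A N N (\<lambda>g. \<pi>\<^sub>N g) (\<lambda>g. \<pi>\<^sub>N g) (comult G (x X12)) = l X11 \<otimes>\<^bsub>NN\<^esub> r X12 \<oplus>\<^bsub>NN\<^esub> l X12 \<otimes>\<^bsub>NN\<^esub> r X22"
  "tensor_map A N N (\<lambda>g. \<pi>\<^sub>N g) (\<lambda>g. \<pi>\<^sub>N g) (comult G (x X21)) = l X21 \<otimes>\<^bsub>NN\<^esub> r X11 \<oplus>\<^bsub>NN\<^esub> l X22 \<otimes>\<^bsub>NN\<^esub> r X21"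
  "tensor_map A N N (\<lambda>g. \<pi>\<^sub>N g) (\<lambda>g. \<pi>\<^sub>N g) (comult G (x X22)) = l X21 \<otimes>\<^bsub>NN\<^esub> r X12 \<oplus>\<^bsub>NN\<^esub> l X22 \<otimes>\<^bsub>NN\<^esub> r X22"
  "tensor_map A N N (\<lambda>g. \<pi>\<^sub>N g) (\<lambda>g. \<pi>\<^sub>N g) (comult G (x Dinv)) = l Dinv \<otimes>\<^bsub>NN\<^esub> r Dinv"
  by (simp_all add: gl2_comult(2) comult_gen alg_homD(3)[OF NN_map(1)] NN_map(2) tensor_elt_closed[OF gl2_algebra gl2_algebra] tn_split)

lemma lr_prod:
  "l X12 \<otimes>\<^bsub>NN\<^esub> l X11 = \<zero>\<^bsub>NN\<^esub>" "l X12 \<otimes>\<^bsub>NN\<^esub> l X22 = \<zero>\<^bsub>NN\<^esub>"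
  "l X21 \<otimes>\<^bsub>NN\<^esub> l X11 = \<zero>\<^bsub>NN\<^esub>" "l X21 \<otimes>\<^bsub>NN\<^esub> l X22 = \<zero>\<^bsub>NN\<^esub>"
  "r X12 \<otimes>\<^bsub>NN\<^esub> r X11 = \<zero>\<^bsub>NN\<^esub>" "r X12 \<otimes>\<^bsub>NN\<^esub> r X22 = \<zero>\<^bsub>NN\<^esub>"
  "r X21 \<otimes>\<^bsub>NN\<^esub> r X11 = \<zero>\<^bsub>NN\<^esub>" "r X21 \<otimes>\<^bsub>NN\<^esub> r X22 = \<zero>\<^bsub>NN\<^esub>"
  by (simp_all add: n_prod alg_hom_zero_inv(1)[OF tensor_inl[OF norm_quotient(1) norm_quotient(1)] norm_quotient(1) norm_tensor_algebra]
      alg_hom_zero_inv(1)[OF tensor_inr[OF norm_quotient(1) norm_quotient(1)] norm_quotient(1) norm_tensor_algebra]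
      flip: alg_homD(4)[OF tensor_inl[OF norm_quotient(1) norm_quotient(1)]] alg_homD(4)[OF tensor_inr[OF norm_quotient(1) norm_quotient(1)]])

text \<open>The ideal of N is a Hopf ideal: the condition that diagonal and off-diagonal entries
  annihilate each other survives products and inverses and holds for the identity matrix.\<close>

lemma norm_comult:
  "comult N \<in> alg_hom A N NN" "counit N \<in> alg_hom A N (base_alg A)" "antipode N \<in> alg_hom A N N"
  "g \<in> carrier G \<Longrightarrow> comult N (\<pi>\<^sub>N g) = tensor_map A N N (\<lambda>g. \<pi>\<^sub>N g) (\<lambda>g. \<pi>\<^sub>N g) (comult G g)"
  "g \<in> carrier G \<Longrightarrow> counit N (\<pi>\<^sub>N g) = counit G g"
  "g \<in> carrier G \<Longrightarrow> antipode N (\<pi>\<^sub>N g) = \<pi>\<^sub>N (antipode G g)"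
proof -
  have k1: "tensor_map A N N (\<lambda>g. \<pi>\<^sub>N g) (\<lambda>g. \<pi>\<^sub>N g) (comult G g) = \<zero>\<^bsub>NN\<^esub>" if "g \<in> I\<^sub>N" for g
  proof (rule norm_ideal_zero[OF norm_tensor_algebra alg_hom_comp[OF gl2_comult(1) NN_map(1)] _ _ _ _ that], unfold comult_NN)
    \<comment> \<open>Each of the four terms pairs two left entries and two right entries, and at
      least one of these pairs multiplies to zero.\<close>
    have *: "(a \<otimes>\<^bsub>NN\<^esub> b' \<oplus>\<^bsub>NN\<^esub> b \<otimes>\<^bsub>NN\<^esub> c') \<otimes>\<^bsub>NN\<^esub> (c \<otimes>\<^bsub>NN\<^esub> a' \<oplus>\<^bsub>NN\<^esub> d \<otimes>\<^bsub>NN\<^esub> d') = \<zero>\<^bsub>NN\<^esub>"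
      if "a \<in> carrier NN" "b \<in> carrier NN" "c \<in> carrier NN" "d \<in> carrier NN"
        "a' \<in> carrier NN" "b' \<in> carrier NN" "c' \<in> carrier NN" "d' \<in> carrier NN"
        "a \<otimes>\<^bsub>NN\<^esub> c = \<zero>\<^bsub>NN\<^esub> \<or> b' \<otimes>\<^bsub>NN\<^esub> a' = \<zero>\<^bsub>NN\<^esub>" "a \<otimes>\<^bsub>NN\<^esub> d = \<zero>\<^bsub>NN\<^esub> \<or> b' \<otimes>\<^bsub>NN\<^esub> d' = \<zero>\<^bsub>NN\<^esub>"
        "b \<otimes>\<^bsub>NN\<^esub> c = \<zero>\<^bsub>NN\<^esub> \<or> c' \<otimes>\<^bsub>NN\<^esub> a' = \<zero>\<^bsub>NN\<^esub>" "b \<otimes>\<^bsub>NN\<^esub> d = \<zero>\<^bsub>NN\<^esub> \<or> c' \<otimes>\<^bsub>NN\<^esub> d' = \<zero>\<^bsub>NN\<^esub>"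
      for a b c d a' b' c' d'
    proof -
      have m: "(u \<otimes>\<^bsub>NN\<^esub> u') \<otimes>\<^bsub>NN\<^esub> (v \<otimes>\<^bsub>NN\<^esub> v') = \<zero>\<^bsub>NN\<^esub>"
        if "u \<in> carrier NN" "v \<in> carrier NN" "u' \<in> carrier NN" "v' \<in> carrier NN"
          "u \<otimes>\<^bsub>NN\<^esub> v = \<zero>\<^bsub>NN\<^esub> \<or> u' \<otimes>\<^bsub>NN\<^esub> v' = \<zero>\<^bsub>NN\<^esub>" for u v u' v'
      proof -
        have "(u \<otimes>\<^bsub>NN\<^esub> u') \<otimes>\<^bsub>NN\<^esub> (v \<otimes>\<^bsub>NN\<^esub> v') = (u \<otimes>\<^bsub>NN\<^esub> v) \<otimes>\<^bsub>NN\<^esub> (u' \<otimes>\<^bsub>NN\<^esub> v')"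
          using that(1-4) by (simp add: NN.m_ac)
        with that show ?thesis by auto
      qed
      show ?thesis using that by (simp add: NN.l_distr NN.r_distr m)
    qed
    have lc: "l X11 \<otimes>\<^bsub>NN\<^esub> l X12 = \<zero>\<^bsub>NN\<^esub>" "l X22 \<otimes>\<^bsub>NN\<^esub> l X12 = \<zero>\<^bsub>NN\<^esub>"
      "l X11 \<otimes>\<^bsub>NN\<^esub> l X21 = \<zero>\<^bsub>NN\<^esub>" "l X22 \<otimes>\<^bsub>NN\<^esub> l X21 = \<zero>\<^bsub>NN\<^esub>"
      "r X11 \<otimes>\<^bsub>NN\<^esub> r X12 = \<zero>\<^bsub>NN\<^esub>" "r X22 \<otimes>\<^bsub>NN\<^esub> r X12 = \<zero>\<^bsub>NN\<^esub>"
      "r X11 \<otimes>\<^bsub>NN\<^esub> r X21 = \<zero>\<^bsub>NN\<^esub>" "r X22 \<otimes>\<^bsub>NN\<^esub> r X21 = \<zero>\<^bsub>NN\<^esub>"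
      using lr_prod by (simp_all add: NN.m_comm)
    show "(l X11 \<otimes>\<^bsub>NN\<^esub> r X12 \<oplus>\<^bsub>NN\<^esub> l X12 \<otimes>\<^bsub>NN\<^esub> r X22) \<otimes>\<^bsub>NN\<^esub>
        (l X11 \<otimes>\<^bsub>NN\<^esub> r X11 \<oplus>\<^bsub>NN\<^esub> l X12 \<otimes>\<^bsub>NN\<^esub> r X21) = \<zero>\<^bsub>NN\<^esub>"
      "(l X11 \<otimes>\<^bsub>NN\<^esub> r X12 \<oplus>\<^bsub>NN\<^esub> l X12 \<otimes>\<^bsub>NN\<^esub> r X22) \<otimes>\<^bsub>NN\<^esub>
        (l X21 \<otimes>\<^bsub>NN\<^esub> r X12 \<oplus>\<^bsub>NN\<^esub> l X22 \<otimes>\<^bsub>NN\<^esub> r X22) = \<zero>\<^bsub>NN\<^esub>"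
      "(l X21 \<otimes>\<^bsub>NN\<^esub> r X11 \<oplus>\<^bsub>NN\<^esub> l X22 \<otimes>\<^bsub>NN\<^esub> r X21) \<otimes>\<^bsub>NN\<^esub>
        (l X11 \<otimes>\<^bsub>NN\<^esub> r X11 \<oplus>\<^bsub>NN\<^esub> l X12 \<otimes>\<^bsub>NN\<^esub> r X21) = \<zero>\<^bsub>NN\<^esub>"
      "(l X21 \<otimes>\<^bsub>NN\<^esub> r X11 \<oplus>\<^bsub>NN\<^esub> l X22 \<otimes>\<^bsub>NN\<^esub> r X21) \<otimes>\<^bsub>NN\<^esub>
        (l X21 \<otimes>\<^bsub>NN\<^esub> r X12 \<oplus>\<^bsub>NN\<^esub> l X22 \<otimes>\<^bsub>NN\<^esub> r X22) = \<zero>\<^bsub>NN\<^esub>"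
      by (rule *; simp add: lr_prod lc)+
  qed
  have k2: "counit G g = \<zero>\<^bsub>A\<^esub>" if "g \<in> I\<^sub>N" for g
    using norm_ideal_zero[OF base_algebra gl2_counit(1) _ _ _ _ that] by (simp add: gl2_counit(2) gl2_counit_gen_def)
  have k3: "antipode G g \<in> I\<^sub>N" if g: "g \<in> I\<^sub>N" for g
  proof -
    have gG: "g \<in> carrier G" by (rule ideal.Icarr[OF ideals(3) g])
    \<comment> \<open>Up to sign and exchange of the diagonal entries, the antipode only multiplies
      entries by 1/D, so vanishing products stay zero.\<close>
    have m: "(n y \<otimes>\<^bsub>N\<^esub> n u) \<otimes>\<^bsub>N\<^esub> (n y \<otimes>\<^bsub>N\<^esub> n v) = \<zero>\<^bsub>N\<^esub>" if "n u \<otimes>\<^bsub>N\<^esub> n v = \<zero>\<^bsub>N\<^esub>" for y u v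
    proof -
      have "(n y \<otimes>\<^bsub>N\<^esub> n u) \<otimes>\<^bsub>N\<^esub> (n y \<otimes>\<^bsub>N\<^esub> n v) = (n u \<otimes>\<^bsub>N\<^esub> n v) \<otimes>\<^bsub>N\<^esub> (n y \<otimes>\<^bsub>N\<^esub> n y)"
        by (simp add: N.m_ac)
      with that show ?thesis by simp
    qed
    have "\<pi>\<^sub>N (antipode G g) = \<zero>\<^bsub>N\<^esub>"
      by (rule norm_ideal_zero[OF norm_quotient(1) alg_hom_comp[OF gl2_antipode(1) norm_quotient(2)] _ _ _ _ g])
         (simp_all add: gl2_antipode(2) antipode_gen alg_homD[OF norm_quotient(2)] alg_hom_zero_inv[OF norm_quotient(2) gl2_algebra norm_quotient(1)]
           N.l_minus m n_prod)
    then show ?thesis using norm_quotient(3) alg_homD(2)[OF gl2_antipode(1) gG] by blast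
  qed
  note q = quot_hopf[OF gl2_algebra ideals(3) gl2_comult(1) gl2_counit(1) gl2_antipode(1) k1[unfolded norm_hopf_def] k2 k3, folded norm_hopf_def]
  show "comult N \<in> alg_hom A N NN" "counit N \<in> alg_hom A N (base_alg A)" "antipode N \<in> alg_hom A N N"
    by (rule q; assumption)+
  show "comult N (\<pi>\<^sub>N g) = tensor_map A N N (\<lambda>g. \<pi>\<^sub>N g) (\<lambda>g. \<pi>\<^sub>N g) (comult G g)" if "g \<in> carrier G"
    by (rule q(4); simp add: that)
  show "counit N (\<pi>\<^sub>N g) = counit G g" if "g \<in> carrier G"
    by (rule q(5); simp add: that)
  show "antipode N (\<pi>\<^sub>N g) = \<pi>\<^sub>N (antipode G g)" if "g \<in> carrier G"
    by (rule q(6); simp add: that)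
qed

text \<open>The function on \<open>GL\<^sub>2\<close> that restricts to \<open>1\<close> on \<open>T\<close> and to \<open>0\<close> on \<open>w T\<close>.\<close>

definition e\<^sub>G :: "((gl2_var \<Rightarrow> nat) \<Rightarrow> 'a) set" where
  "e\<^sub>G = x Dinv \<otimes>\<^bsub>G\<^esub> x X11 \<otimes>\<^bsub>G\<^esub> x X22"

definition e\<^sub>N :: "((gl2_var \<Rightarrow> nat) \<Rightarrow> 'a) set set" where
  "e\<^sub>N = \<pi>\<^sub>N e\<^sub>G"

lemma e\<^sub>G_closed [simp]: "e\<^sub>G \<in> carrier G"
  by (simp add: e\<^sub>G_def)

lemma e\<^sub>N_alt: "e\<^sub>N = n Dinv \<otimes>\<^bsub>N\<^esub> n X11 \<otimes>\<^bsub>N\<^esub> n X22"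
  by (simp add: e\<^sub>N_def e\<^sub>G_def alg_homD[OF norm_quotient(2)])

lemma e\<^sub>N_closed [simp]: "e\<^sub>N \<in> carrier N"
  by (simp add: e\<^sub>N_alt)

lemma e\<^sub>N_idem: "e\<^sub>N \<otimes>\<^bsub>N\<^esub> e\<^sub>N = e\<^sub>N"
  unfolding e\<^sub>N_alt
  by (rule N.det_unit_idem[of _ _ "n X12" "n X21"]) (simp_all add: hom_rel[OF norm_quotient(1) norm_quotient(2)] n_prod)

text \<open>A product of two elements of N is diagonal exactly when both are diagonal or both
  antidiagonal; \<open>det_unit_xnor\<close> is the algebraic form of this.\<close>

lemma comult_e\<^sub>N:
  "comult N e\<^sub>N = xnor NN (tensor_elt A N N e\<^sub>N \<one>\<^bsub>N\<^esub>) (tensor_elt A N N \<one>\<^bsub>N\<^esub> e\<^sub>N)"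
proof -
  note c = norm_comult(1)
  have g: "comult N (n v) = tensor_map A N N (\<lambda>g. \<pi>\<^sub>N g) (\<lambda>g. \<pi>\<^sub>N g) (comult G (x v))" for v
    by (rule norm_comult(4)) simp
  note inl = tensor_inl[OF norm_quotient(1) norm_quotient(1)] and inr = tensor_inr[OF norm_quotient(1) norm_quotient(1)]
  have "comult N e\<^sub>N = (l Dinv \<otimes>\<^bsub>NN\<^esub> r Dinv) \<otimes>\<^bsub>NN\<^esub> (l X11 \<otimes>\<^bsub>NN\<^esub> r X11 \<oplus>\<^bsub>NN\<^esub> l X12 \<otimes>\<^bsub>NN\<^esub> r X21) \<otimes>\<^bsub>NN\<^esub>
      (l X21 \<otimes>\<^bsub>NN\<^esub> r X12 \<oplus>\<^bsub>NN\<^esub> l X22 \<otimes>\<^bsub>NN\<^esub> r X22)"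
    unfolding e\<^sub>N_alt by (simp add: alg_homD[OF c] g comult_NN)
  also have "\<dots> = xnor NN (l Dinv \<otimes>\<^bsub>NN\<^esub> l X11 \<otimes>\<^bsub>NN\<^esub> l X22) (r Dinv \<otimes>\<^bsub>NN\<^esub> r X11 \<otimes>\<^bsub>NN\<^esub> r X22)"
    by (rule NN.det_unit_xnor)
       (simp_all add: lr_prod hom_rel[OF norm_tensor_algebra alg_hom_comp[OF norm_quotient(2) inl]] hom_rel[OF norm_tensor_algebra alg_hom_comp[OF norm_quotient(2) inr]])
  finally show ?thesis by (simp add: e\<^sub>N_alt alg_homD[OF inl] alg_homD[OF inr])
qed

lemma counit_e\<^sub>N: "counit N e\<^sub>N = \<one>\<^bsub>A\<^esub>"
  unfolding e\<^sub>N_def norm_comult(5)[OF e\<^sub>G_closed]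
  by (simp add: e\<^sub>G_def alg_homD[OF gl2_counit(1)] gl2_counit(2) gl2_counit_gen_def)

lemma antipode_e\<^sub>N: "antipode N e\<^sub>N = e\<^sub>N"
proof -
  have "antipode G e\<^sub>G = e\<^sub>G"
    by (simp add: e\<^sub>G_def alg_homD[OF gl2_antipode(1)] gl2_antipode(2) antipode_gen G.det_unit_adjugate(2) x_rel)
  then show ?thesis by (simp add: e\<^sub>N_def norm_comult(6))
qed

text \<open>The coordinates of the permutation matrix \<open>w\<close>.\<close>

definition weyl_gen :: "gl2_var \<Rightarrow> 'a" where
  "weyl_gen v = (case v of X11 \<Rightarrow> \<zero>\<^bsub>A\<^esub> | X12 \<Rightarrow> \<one>\<^bsub>A\<^esub> | X21 \<Rightarrow> \<one>\<^bsub>A\<^esub> | X22 \<Rightarrow> \<zero>\<^bsub>A\<^esub> | Dinv \<Rightarrow> \<ominus>\<^bsub>A\<^esub> \<one>\<^bsub>A\<^esub>)"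

definition weyl_eval :: "((gl2_var \<Rightarrow> nat) \<Rightarrow> 'a) set set \<Rightarrow> 'a" where
  "weyl_eval = quot_lift (gl2_eval A (base_alg A) weyl_gen)"

text \<open>The matrix w is a point of N, because its diagonal entries are zero.\<close>

lemma weyl_eval: "weyl_eval \<in> alg_hom A N (base_alg A)" "weyl_eval (n v) = weyl_gen v"
proof -
  have cl: "weyl_gen v \<in> carrier (base_alg A)" for v by (cases v) (simp_all add: weyl_gen_def)
  have rel: "gl2_rel (base_alg A) weyl_gen = \<one>\<^bsub>base_alg A\<^esub>"
    by (simp add: weyl_gen_def A.minus_eq A.l_minus A.r_minus)
  note ev = gl2_eval[OF base_algebra cl rel]
  have "gl2_eval A (base_alg A) weyl_gen g = \<zero>\<^bsub>base_alg A\<^esub>" if "g \<in> I\<^sub>N" for g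
    by (rule norm_ideal_zero[OF base_algebra ev(1) _ _ _ _ that]; simp add: ev(2)) (simp_all add: weyl_gen_def)
  note q = quot_lift[OF gl2_algebra ideals(3) base_algebra ev(1) this]
  show "weyl_eval \<in> alg_hom A N (base_alg A)"
    using q(1) by (simp add: weyl_eval_def norm_hopf_def quot_hopf_def Let_def)
  show "weyl_eval (n v) = weyl_gen v" unfolding weyl_eval_def by (simp add: q(2) ev(2))
qed

lemma weyl_eval_e\<^sub>N: "weyl_eval e\<^sub>N = \<zero>\<^bsub>A\<^esub>"
  by (simp add: e\<^sub>N_alt alg_homD[OF weyl_eval(1)] weyl_eval(2) weyl_gen_def)

lemma evals_closed: "y \<in> carrier N \<Longrightarrow> counit N y \<in> carrier A" "y \<in> carrier N \<Longrightarrow> weyl_eval y \<in> carrier A"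
  using alg_homD(2)[OF norm_comult(2)] alg_homD(2)[OF weyl_eval(1)] by simp_all

section \<open>The coaction of T on k[N] and its invariants\<close>

abbreviation "NT \<equiv> tensor A N T"
lemma norm_torus_tensor_algebra: "algebra A NT" by (rule tensor_algebra[OF norm_quotient(1) torus_quotient(1)])
interpretation NT: algebra A NT by (rule norm_torus_tensor_algebra)

abbreviation "tt v \<equiv> \<pi>\<^sub>T (x v)"

lemma tt_closed [simp]: "tt v \<in> carrier T" by (simp add: alg_homD(2)[OF torus_quotient(2)])

lemma tt_zero: "tt X12 = \<zero>\<^bsub>T\<^esub>" "tt X21 = \<zero>\<^bsub>T\<^esub>"
  by (simp_all add: torus_quotient(3) ideal_gens)

text \<open>On T the determinant is x11 x22.\<close>

lemma tt_unit: "\<pi>\<^sub>T e\<^sub>G = \<one>\<^bsub>T\<^esub>"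
  using hom_rel[OF torus_quotient(1) torus_quotient(2)]
  by (simp add: e\<^sub>G_def alg_homD[OF torus_quotient(2)] tt_zero T.minus_eq T.m_assoc)

lemma norm_to_torus: "norm_to_torus A \<in> alg_hom A N T" "g \<in> carrier G \<Longrightarrow> norm_to_torus A (\<pi>\<^sub>N g) = \<pi>\<^sub>T g"
proof -
  have "\<pi>\<^sub>T g = \<zero>\<^bsub>T\<^esub>" if "g \<in> I\<^sub>N" for g
    by (rule norm_ideal_zero[OF torus_quotient(1) torus_quotient(2) _ _ _ _ that]) (simp_all add: tt_zero)
  note q = quot_lift[OF gl2_algebra ideals(3) torus_quotient(1) torus_quotient(2) this]
  show "norm_to_torus A \<in> alg_hom A N T"
    unfolding norm_to_torus_def using q(1) by (simp add: norm_hopf_def quot_hopf_def Let_def)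
  show "g \<in> carrier G \<Longrightarrow> norm_to_torus A (\<pi>\<^sub>N g) = \<pi>\<^sub>T g"
    unfolding norm_to_torus_def by (rule q(2))
qed

lemmas NT_map = tensor_map[OF norm_quotient(1) torus_quotient(1) norm_quotient(1) norm_quotient(1) alg_hom_id norm_to_torus(1)]

abbreviation "tnt u w \<equiv> tensor_elt A N T (n u) (tt w)"

lemma tnt_closed [simp]: "tnt u w \<in> carrier NT"
  by (simp add: tensor_elt_closed[OF norm_quotient(1) torus_quotient(1)])

text \<open>The terms with \<open>tt X12\<close> and \<open>tt X21\<close> vanish but are kept:
  evaluating the left factor at a point p then visibly gives the entries of the matrix product p
  t.\<close>

lemma coaction: "torus_coaction A \<in> alg_hom A N NT"
  "torus_coaction A (n X11) = tnt X11 X11 \<oplus>\<^bsub>NT\<^esub> tnt X12 X21"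
  "torus_coaction A (n X12) = tnt X11 X12 \<oplus>\<^bsub>NT\<^esub> tnt X12 X22"
  "torus_coaction A (n X21) = tnt X21 X11 \<oplus>\<^bsub>NT\<^esub> tnt X22 X21"
  "torus_coaction A (n X22) = tnt X21 X12 \<oplus>\<^bsub>NT\<^esub> tnt X22 X22"
  "torus_coaction A (n Dinv) = tnt Dinv Dinv"
proof -
  show "torus_coaction A \<in> alg_hom A N NT"
    using alg_hom_comp[OF norm_comult(1) NT_map(1)] by (simp add: torus_coaction_def[abs_def])
  have g: "torus_coaction A (n v) = tensor_map A N T (\<lambda>y. y) (norm_to_torus A)
      (tensor_map A N N (\<lambda>g. \<pi>\<^sub>N g) (\<lambda>g. \<pi>\<^sub>N g) (comult G (x v)))" for v
    by (simp add: torus_coaction_def norm_comult(4))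
  show "torus_coaction A (n X11) = tnt X11 X11 \<oplus>\<^bsub>NT\<^esub> tnt X12 X21"
    "torus_coaction A (n X12) = tnt X11 X12 \<oplus>\<^bsub>NT\<^esub> tnt X12 X22"
    "torus_coaction A (n X21) = tnt X21 X11 \<oplus>\<^bsub>NT\<^esub> tnt X22 X21"
    "torus_coaction A (n X22) = tnt X21 X12 \<oplus>\<^bsub>NT\<^esub> tnt X22 X22"
    "torus_coaction A (n Dinv) = tnt Dinv Dinv"
    by (simp_all add: g comult_NN flip: tn_split)
       (simp_all add: alg_homD(3)[OF NT_map(1)] NT_map(2) tensor_elt_closed[OF norm_quotient(1) norm_quotient(1)] norm_to_torus(2))
qed

abbreviation "K \<equiv> norm_mod_torus_carrier A"

lemma K_iff: "y \<in> K \<longleftrightarrow> y \<in> carrier N \<and> torus_coaction A y = tensor_elt A N T y \<one>\<^bsub>T\<^esub>"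
  by (simp add: norm_mod_torus_carrier_def)

lemma inl_zero: "tensor_elt A N T y \<zero>\<^bsub>T\<^esub> = \<zero>\<^bsub>NT\<^esub>" if y: "y \<in> carrier N"
  using tensor_elt_bilinear(4)[OF norm_quotient(1) torus_quotient(1) A.zero_closed y T.zero_closed]
    tensor_elt_closed[OF norm_quotient(1) torus_quotient(1) y T.zero_closed] by simp

text \<open>Right multiplication by t rescales the three factors by the corresponding coordinates of
  t, whose product is 1 on T.\<close>

lemma coaction_e\<^sub>N: "torus_coaction A e\<^sub>N = tensor_elt A N T e\<^sub>N \<one>\<^bsub>T\<^esub>"
proof -
  have "torus_coaction A e\<^sub>N = tnt Dinv Dinv \<otimes>\<^bsub>NT\<^esub> tnt X11 X11 \<otimes>\<^bsub>NT\<^esub> tnt X22 X22"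
    unfolding e\<^sub>N_alt by (simp add: alg_homD[OF coaction(1)] coaction tt_zero inl_zero)
  also have "\<dots> = tensor_elt A N T e\<^sub>N (tt Dinv \<otimes>\<^bsub>T\<^esub> tt X11 \<otimes>\<^bsub>T\<^esub> tt X22)"
    by (simp add: tensor_elt_mult[OF norm_quotient(1) torus_quotient(1)] e\<^sub>N_alt)
  also have "tt Dinv \<otimes>\<^bsub>T\<^esub> tt X11 \<otimes>\<^bsub>T\<^esub> tt X22 = \<one>\<^bsub>T\<^esub>"
    using tt_unit by (simp add: e\<^sub>G_def alg_homD[OF torus_quotient(2)])
  finally show ?thesis .
qed

text \<open>Evaluating the left factor of \<open>\<sigma>\<^sub>T(y) = y \<otimes> 1\<close> at the point \<open>p\<close> of \<open>N\<close>.\<close>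

lemma coaction_left:
  assumes p: "p \<in> alg_hom A N (base_alg A)" and f: "f \<in> alg_hom A G T"
    and v: "\<And>v. tensor_lift A T (\<lambda>y. p y \<odot>\<^bsub>T\<^esub> \<one>\<^bsub>T\<^esub>) (\<lambda>y. y) (torus_coaction A (n v)) = f (x v)"
    and g: "g \<in> carrier G" and K: "\<pi>\<^sub>N g \<in> K"
  shows "f g = p (\<pi>\<^sub>N g) \<odot>\<^bsub>T\<^esub> \<one>\<^bsub>T\<^esub>"
proof -
  note u = alg_hom_comp[OF p alg_hom_unit[OF torus_quotient(1)]]
  note left_translation = tensor_lift[OF norm_quotient(1) torus_quotient(1) torus_quotient(1) u alg_hom_id]
  \<comment> \<open>Both sides are compared as homomorphisms out of k[G], where the generators
    suffice; only afterwards is the invariance of the class of g used.\<close>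
  have "f g = tensor_lift A T (\<lambda>y. p y \<odot>\<^bsub>T\<^esub> \<one>\<^bsub>T\<^esub>) (\<lambda>y. y) (torus_coaction A (\<pi>\<^sub>N g))"
    by (rule gl2_hom_eq[OF torus_quotient(1) f alg_hom_comp[OF norm_quotient(2) alg_hom_comp[OF coaction(1) left_translation(1)]] v[symmetric] g])
  also have "\<dots> = p (\<pi>\<^sub>N g) \<odot>\<^bsub>T\<^esub> \<one>\<^bsub>T\<^esub>"
    using K alg_homD(2)[OF u] by (simp add: K_iff left_translation(2))
  finally show ?thesis .
qed

lemma lift_tnt:
  assumes p: "p \<in> alg_hom A N (base_alg A)"
  shows "tensor_lift A T (\<lambda>y. p y \<odot>\<^bsub>T\<^esub> \<one>\<^bsub>T\<^esub>) (\<lambda>y. y) (tnt u w) = p (n u) \<odot>\<^bsub>T\<^esub> tt w"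
    and "tensor_lift A T (\<lambda>y. p y \<odot>\<^bsub>T\<^esub> \<one>\<^bsub>T\<^esub>) (\<lambda>y. y) \<in> alg_hom A NT T"
proof -
  note left_translation = tensor_lift[OF norm_quotient(1) torus_quotient(1) torus_quotient(1) alg_hom_comp[OF p alg_hom_unit[OF torus_quotient(1)]] alg_hom_id]
  show "tensor_lift A T (\<lambda>y. p y \<odot>\<^bsub>T\<^esub> \<one>\<^bsub>T\<^esub>) (\<lambda>y. y) \<in> alg_hom A NT T" by (rule left_translation(1))
  show "tensor_lift A T (\<lambda>y. p y \<odot>\<^bsub>T\<^esub> \<one>\<^bsub>T\<^esub>) (\<lambda>y. y) (tnt u w) = p (n u) \<odot>\<^bsub>T\<^esub> tt w"
    using alg_homD(2)[OF p, of "n u"] by (simp add: left_translation(2) T.smult_assoc2)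
qed

text \<open>The case p = 1 of \<open>coaction_left\<close>: the translate t \<mapsto> p t is the
  inclusion of T.\<close>

lemma restriction_to_T:
  assumes "g \<in> carrier G" "\<pi>\<^sub>N g \<in> K"
  shows "\<pi>\<^sub>T g = counit N (\<pi>\<^sub>N g) \<odot>\<^bsub>T\<^esub> \<one>\<^bsub>T\<^esub>"
proof (rule coaction_left[OF norm_comult(2) torus_quotient(2) _ assms])
  note p = norm_comult(2)
  show "tensor_lift A T (\<lambda>y. counit N y \<odot>\<^bsub>T\<^esub> \<one>\<^bsub>T\<^esub>) (\<lambda>y. y) (torus_coaction A (n v)) = tt v" for v
    by (cases v)
       (simp_all add: coaction alg_homD(3)[OF lift_tnt(2)[OF p]] lift_tnt(1)[OF p] norm_comult(5) gl2_counit(2) gl2_counit_gen_def)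
qed

text \<open>The case p = w. A function on w T is handled as its left translate on T, which is why
  \<open>L\<close> precedes the projection.\<close>

lemma restriction_to_wT:
  assumes "g \<in> carrier G" "\<pi>\<^sub>N g \<in> K"
  shows "\<pi>\<^sub>T (L g) = weyl_eval (\<pi>\<^sub>N g) \<odot>\<^bsub>T\<^esub> \<one>\<^bsub>T\<^esub>"
proof (rule coaction_left[OF weyl_eval(1) alg_hom_comp[OF left_translation(1) torus_quotient(2)] _ assms])
  note p = weyl_eval(1)
  show "tensor_lift A T (\<lambda>y. weyl_eval y \<odot>\<^bsub>T\<^esub> \<one>\<^bsub>T\<^esub>) (\<lambda>y. y) (torus_coaction A (n v)) = \<pi>\<^sub>T (L (x v))" for v
    by (cases v)
       (simp_all add: coaction alg_homD(3)[OF lift_tnt(2)[OF p]] lift_tnt(1)[OF p] weyl_eval(2) weyl_gen_def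
        left_translation(2) row_swap_def alg_hom_zero_inv[OF torus_quotient(2) gl2_algebra torus_quotient(1)] T.smult_l_minus)
qed

text \<open>Vanishing on T and on w T puts g into I_1 and I_2; the relation for 1/D then puts it
  into their product.\<close>

lemma norm_ideal_if:
  assumes g: "g \<in> carrier G" and T0: "\<pi>\<^sub>T g = \<zero>\<^bsub>T\<^esub>" and wT0: "\<pi>\<^sub>T (L g) = \<zero>\<^bsub>T\<^esub>"
  shows "g \<in> I\<^sub>N"
proof -
  have g1: "g \<in> I\<^sub>1" using torus_quotient(3)[OF g] T0 by simp
  have Lg: "L g \<in> I\<^sub>1" using torus_quotient(3) alg_homD(2)[OF left_translation(1) g] wT0 by blast
  note q2 = quot_hopf_algebra[OF gl2_algebra ideals(2)]
  \<comment> \<open>\<open>L\<close> sends x12 to x22 and x21 to x11, so it maps I_1 into I_2. As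
    \<open>L g\<close> lies in I_1, g = \<open>L (L g)\<close> lies in I_2.\<close>
  have kill: "I\<^sub>2 +>\<^bsub>G\<^esub> L y = \<zero>\<^bsub>quot_hopf A G I\<^sub>2\<^esub>" if "y \<in> {x X12, x X21}" for y
    using that by (elim insertE emptyE) (simp_all add: left_translation(2) row_swap_def q2(3) ideal_gens)
  have "I\<^sub>2 +>\<^bsub>G\<^esub> L (L g) = \<zero>\<^bsub>quot_hopf A G I\<^sub>2\<^esub>"
    by (rule alg_hom_genideal_zero[OF gl2_algebra q2(1) alg_hom_comp[OF left_translation(1) q2(2)] _ _ Lg[unfolded torus_ideal_def]])
       (simp, rule kill)
  then have g2: "g \<in> I\<^sub>2" using q2(3)[OF g] by (simp add: left_translation_involutive[OF g])
  \<comment> \<open>The relation for 1/D reads 1 = ?p - ?q with ?p in I_2 and ?q in I_1. Hence g = g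
    ?p - ?q g is a sum of two elements of I_1 I_2.\<close>
  let ?p = "x Dinv \<otimes>\<^bsub>G\<^esub> x X11 \<otimes>\<^bsub>G\<^esub> x X22" and ?q = "x Dinv \<otimes>\<^bsub>G\<^esub> x X12 \<otimes>\<^bsub>G\<^esub> x X21"
  interpret I1: ideal I\<^sub>1 G by (rule ideals)
  interpret I2: ideal I\<^sub>2 G by (rule ideals)
  interpret IN: ideal I\<^sub>N G by (rule ideals)
  have "?p \<in> I\<^sub>2" "\<ominus>\<^bsub>G\<^esub> ?q \<in> I\<^sub>1"
    by (auto intro!: I2.I_l_closed I1.I_l_closed I1.a_inv_closed ideal_gens)
  then have "g \<otimes>\<^bsub>G\<^esub> ?p \<oplus>\<^bsub>G\<^esub> (\<ominus>\<^bsub>G\<^esub> ?q) \<otimes>\<^bsub>G\<^esub> g \<in> I\<^sub>N"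
    using g1 g2 by (intro IN.a_closed norm_ideal_prod)
  also have "g \<otimes>\<^bsub>G\<^esub> ?p \<oplus>\<^bsub>G\<^esub> (\<ominus>\<^bsub>G\<^esub> ?q) \<otimes>\<^bsub>G\<^esub> g = g \<otimes>\<^bsub>G\<^esub> gl2_rel G x"
    using g by (simp add: G.minus_eq G.r_distr G.l_minus G.r_minus G.m_ac)
  finally show ?thesis using g by (simp add: x_rel)
qed

lemma K_comb:
  assumes y: "y \<in> K"
  shows "y = idem_comb N e\<^sub>N (counit N y) (weyl_eval y)"
proof -
  have yN: "y \<in> carrier N" using y by (simp add: K_iff)
  then obtain g where g: "g \<in> carrier G" "y = \<pi>\<^sub>N g" using norm_quotient(4) by blast
  define a where "a = counit N y"
  define b where "b = weyl_eval y"
  have ab [simp]: "a \<in> carrier A" "b \<in> carrier A" using evals_closed[OF yN] by (simp_all add: a_def b_def)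
  have T1: "\<pi>\<^sub>T g = a \<odot>\<^bsub>T\<^esub> \<one>\<^bsub>T\<^esub>" and T2: "\<pi>\<^sub>T (L g) = b \<odot>\<^bsub>T\<^esub> \<one>\<^bsub>T\<^esub>"
    using restriction_to_T[of g] restriction_to_wT[of g] g y by (simp_all add: a_def b_def)
  \<comment> \<open>A lift of the claimed value to k[G]. Since \<open>e\<^sub>G\<close> restricts to
    1 on T and its translate to 0, g - ?c vanishes on both T and w T.\<close>
  let ?c = "idem_comb G e\<^sub>G a b"
  have c: "?c \<in> carrier G" by simp
  have "\<pi>\<^sub>T (g \<ominus>\<^bsub>G\<^esub> ?c) = a \<odot>\<^bsub>T\<^esub> \<one>\<^bsub>T\<^esub> \<ominus>\<^bsub>T\<^esub> idem_comb T \<one>\<^bsub>T\<^esub> a b"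
    using T1 g(1)
    by (simp add: alg_hom_zero_inv[OF torus_quotient(2) gl2_algebra torus_quotient(1)] alg_hom_idem_comb[OF torus_quotient(2) gl2_algebra torus_quotient(1)] tt_unit)
  then have 1: "\<pi>\<^sub>T (g \<ominus>\<^bsub>G\<^esub> ?c) = \<zero>\<^bsub>T\<^esub>" by (simp add: T.idem_comb_unit T.minus_eq T.r_neg)
  have Le: "\<pi>\<^sub>T (L e\<^sub>G) = \<zero>\<^bsub>T\<^esub>"
    by (simp add: e\<^sub>G_def alg_homD[OF left_translation(1)] left_translation(2) row_swap_def alg_homD[OF torus_quotient(2)] alg_hom_zero_inv[OF torus_quotient(2) gl2_algebra torus_quotient(1)] tt_zero)
  have "\<pi>\<^sub>T (L (g \<ominus>\<^bsub>G\<^esub> ?c)) = b \<odot>\<^bsub>T\<^esub> \<one>\<^bsub>T\<^esub> \<ominus>\<^bsub>T\<^esub> idem_comb T \<zero>\<^bsub>T\<^esub> a b"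
    using T2 g(1) alg_homD(2)[OF left_translation(1)]
    by (simp add: alg_hom_zero_inv[OF torus_quotient(2) gl2_algebra torus_quotient(1)] alg_hom_zero_inv[OF left_translation(1) gl2_algebra gl2_algebra]
      alg_hom_idem_comb[OF torus_quotient(2) gl2_algebra torus_quotient(1)] alg_hom_idem_comb[OF left_translation(1) gl2_algebra gl2_algebra] Le)
  then have 2: "\<pi>\<^sub>T (L (g \<ominus>\<^bsub>G\<^esub> ?c)) = \<zero>\<^bsub>T\<^esub>" by (simp add: idem_comb_def T.minus_eq T.r_neg)
  have "g \<ominus>\<^bsub>G\<^esub> ?c \<in> I\<^sub>N" using g c by (intro norm_ideal_if 1 2) simp
  then have "\<pi>\<^sub>N g = \<pi>\<^sub>N ?c" using quot_eq_iff[OF gl2_algebra ideals(3) g(1) c] by simp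
  also have "\<dots> = idem_comb N e\<^sub>N a b"
    by (simp add: alg_hom_idem_comb[OF norm_quotient(2) gl2_algebra norm_quotient(1)] e\<^sub>N_def)
  finally show ?thesis by (simp add: g(2) a_def b_def)
qed

lemmas NT_inl = tensor_inl[OF norm_quotient(1) torus_quotient(1)]

text \<open>K is the equalizer of two algebra homomorphisms, the coaction and y \<mapsto> y
  \<otimes> 1.\<close>

lemma K_closed:
  "K \<subseteq> carrier N" "\<one>\<^bsub>N\<^esub> \<in> K" "e\<^sub>N \<in> K"
  "y \<in> K \<Longrightarrow> y' \<in> K \<Longrightarrow> y \<oplus>\<^bsub>N\<^esub> y' \<in> K" "y \<in> K \<Longrightarrow> y' \<in> K \<Longrightarrow> y \<otimes>\<^bsub>N\<^esub> y' \<in> K"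
  "a \<in> carrier A \<Longrightarrow> y \<in> K \<Longrightarrow> a \<odot>\<^bsub>N\<^esub> y \<in> K"
  using coaction_e\<^sub>N by (auto simp: K_iff alg_homD[OF coaction(1)] alg_homD[OF NT_inl])

section \<open>The Hopf algebra of N/T\<close>

abbreviation "NK \<equiv> N\<lparr>carrier := K\<rparr>"

lemma invariants_algebra: "algebra A NK"
  by (rule subalgebra[OF norm_quotient(1) K_closed(1,2,4-6)])

interpretation NK: algebra A NK by (rule invariants_algebra)

lemma NK_incl: "(\<lambda>y. y) \<in> alg_hom A NK N"
  by (rule alg_homI) (use K_closed(1) in auto)

lemma NK_comb: "a \<in> carrier A \<Longrightarrow> b \<in> carrier A \<Longrightarrow> idem_comb NK e\<^sub>N a b = idem_comb N e\<^sub>N a b"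
  using alg_hom_idem_comb[OF NK_incl invariants_algebra norm_quotient(1), of e\<^sub>N a b] K_closed(3) by simp

lemma NK_split: "split_algebra A NK e\<^sub>N"
proof (rule split_algebraI[OF invariants_algebra _ _ _ alg_hom_comp[OF NK_incl norm_comult(2)] counit_e\<^sub>N
    alg_hom_comp[OF NK_incl weyl_eval(1)] weyl_eval_e\<^sub>N])
  fix y assume "y \<in> carrier NK"
  then have "y \<in> K" by simp
  then show "\<exists>a\<in>carrier A. \<exists>b\<in>carrier A. y = idem_comb NK e\<^sub>N a b"
    using K_comb[of y] evals_closed[of y] K_closed(1) NK_comb by blast
qed (simp_all add: K_closed(3) e\<^sub>N_idem)

interpretation S: split_algebra A NK e\<^sub>N by (rule NK_split)

text \<open>
  A retraction of the inclusion of \<open>K\<close> into \<open>k[N]\<close>. It makes \<open>K \<otimes> K \<rightarrow> k[N] \<otimes> k[N]\<close> injective and so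
  determines the comultiplication of \<open>K\<close>.
\<close>

definition retract :: "((gl2_var \<Rightarrow> nat) \<Rightarrow> 'a) set set \<Rightarrow> ((gl2_var \<Rightarrow> nat) \<Rightarrow> 'a) set set" where
  "retract y = idem_comb NK e\<^sub>N (counit N y) (weyl_eval y)"

lemma retract: "retract \<in> alg_hom A N NK" "y \<in> K \<Longrightarrow> retract y = y"
proof -
  show "retract \<in> alg_hom A N NK"
    unfolding retract_def[abs_def]
    by (rule idem_comb_alg_hom[OF invariants_algebra _ _ norm_comult(2) weyl_eval(1)]) (simp_all add: K_closed(3) e\<^sub>N_idem)
  show "y \<in> K \<Longrightarrow> retract y = y"
    using K_comb[of y] K_closed(1) evals_closed[of y] by (auto simp: retract_def NK_comb)
qed

abbreviation "KK \<equiv> tensor A NK NK"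
lemma invariants_tensor_algebra: "algebra A KK" by (rule tensor_algebra[OF invariants_algebra invariants_algebra])
lemmas KK_incl = tensor_map[OF norm_quotient(1) norm_quotient(1) invariants_algebra invariants_algebra NK_incl NK_incl]
lemmas KK_retract = tensor_map[OF invariants_algebra invariants_algebra norm_quotient(1) norm_quotient(1) retract(1) retract(1)]

text \<open>The candidate for the induced comultiplication. Applying the retraction to both factors
  lands in K \<otimes> K without prior knowledge that the comultiplication of k[N] takes K
  there.\<close>

definition K_comult :: "((gl2_var \<Rightarrow> nat) \<Rightarrow> 'a) set set \<Rightarrow> _" where
  "K_comult y = tensor_map A NK NK retract retract (comult N y)"

text \<open>The last claim, that the retraction loses nothing on K, equates two algebra
  homomorphisms out of K and is therefore checked at \<open>e\<^sub>N\<close>, where both sides are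
  the same \<open>xnor\<close>.\<close>

lemma K_comult:
  "K_comult \<in> alg_hom A NK KK"
  "K_comult e\<^sub>N = xnor KK (tensor_elt A NK NK e\<^sub>N \<one>\<^bsub>NK\<^esub>) (tensor_elt A NK NK \<one>\<^bsub>NK\<^esub> e\<^sub>N)"
  "y \<in> K \<Longrightarrow> tensor_map A N N (\<lambda>u. u) (\<lambda>u. u) (K_comult y) = comult N y"
proof -
  show h: "K_comult \<in> alg_hom A NK KK"
    using alg_hom_comp[OF alg_hom_comp[OF NK_incl norm_comult(1)] KK_retract(1)]
    by (simp add: K_comult_def[abs_def])
  show e: "K_comult e\<^sub>N = xnor KK (tensor_elt A NK NK e\<^sub>N \<one>\<^bsub>NK\<^esub>) (tensor_elt A NK NK \<one>\<^bsub>NK\<^esub> e\<^sub>N)"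
    using K_closed(2,3)
    by (simp add: K_comult_def comult_e\<^sub>N alg_hom_xnor[OF KK_retract(1) norm_tensor_algebra invariants_tensor_algebra] KK_retract(2)
      tensor_elt_closed[OF norm_quotient(1) norm_quotient(1)] retract(2))
  show "tensor_map A N N (\<lambda>u. u) (\<lambda>u. u) (K_comult y) = comult N y" if "y \<in> K"
  proof (rule S.split_hom_eq[OF norm_tensor_algebra alg_hom_comp[OF h KK_incl(1)] alg_hom_comp[OF NK_incl norm_comult(1)]])
    show "tensor_map A N N (\<lambda>u. u) (\<lambda>u. u) (K_comult e\<^sub>N) = comult N e\<^sub>N"
      using K_closed(2,3)
      by (simp add: e comult_e\<^sub>N alg_hom_xnor[OF KK_incl(1) invariants_tensor_algebra norm_tensor_algebra] KK_incl(2) tensor_elt_closed[OF invariants_algebra invariants_algebra])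
  qed (use that in simp)
qed

lemma KK_incl_inj:
  assumes y: "y \<in> carrier KK"
  shows "tensor_map A NK NK retract retract (tensor_map A N N (\<lambda>u. u) (\<lambda>u. u) y) = y"
  by (rule tensor_alg_hom_eq[OF invariants_algebra invariants_algebra invariants_tensor_algebra alg_hom_comp[OF KK_incl(1) KK_retract(1)] alg_hom_id _ _ y])
     (use K_closed(1,2) in \<open>auto simp: KK_incl(2) KK_retract(2) retract(2)\<close>)

abbreviation "M \<equiv> norm_mod_torus_hopf A"

text \<open>\<open>K_comult\<close> provides a preimage, and the injectivity expressed by
  \<open>KK_incl_inj\<close> makes it the only one, so the definite description is resolved.\<close>

lemma comult_M:
  assumes y: "y \<in> K"
  shows "comult M y = K_comult y"
proof -
  have c: "comult M y = (THE u. u \<in> carrier KK \<and> tensor_map A N N (\<lambda>u. u) (\<lambda>u. u) u = comult N y)"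
    by (simp add: norm_mod_torus_hopf_def sub_hopf_def Let_def)
  show ?thesis unfolding c
  proof (rule the_equality)
    show "K_comult y \<in> carrier KK \<and> tensor_map A N N (\<lambda>u. u) (\<lambda>u. u) (K_comult y) = comult N y"
      using y alg_homD(2)[OF K_comult(1), of y] K_comult(3) by simp
    show "u = K_comult y" if "u \<in> carrier KK \<and> tensor_map A N N (\<lambda>u. u) (\<lambda>u. u) u = comult N y" for u
      using KK_incl_inj[of u] that by (simp add: K_comult_def)
  qed
qed

lemma M_eq: "M = with_coalg NK (comult M) (counit N) (antipode N)"
  by (simp add: norm_mod_torus_hopf_def sub_hopf_def Let_def)

lemma M_split_hopf: "split_hopf A M e\<^sub>N"
proof -
  have co: "comult M \<in> alg_hom A NK KK"
    by (rule alg_hom_cong[OF K_comult(1) invariants_algebra]) (simp add: comult_M)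
  \<comment> \<open>The antipode fixes \<open>e\<^sub>N\<close>, hence is the identity on K; this
    also shows that it maps K to itself.\<close>
  have "antipode N y = y" if "y \<in> carrier NK" for y
    by (rule S.split_hom_eq[OF norm_quotient(1) alg_hom_comp[OF NK_incl norm_comult(3)] NK_incl antipode_e\<^sub>N that])
  then have S: "antipode N \<in> alg_hom A NK NK"
    by (rule alg_hom_cong[OF alg_hom_id invariants_algebra])
  show ?thesis
    by (subst M_eq, intro split_hopf.intro split_hopf_axioms.intro split_algebra_with_coalg NK_split)
       (use K_closed(2,3) alg_hom_comp[OF NK_incl norm_comult(2)] in
        \<open>simp_all add: co S counit_e\<^sub>N antipode_e\<^sub>N comult_M K_comult(2)\<close>)
qed

lemma M_incl: "(\<lambda>y. y) \<in> hopf_hom A M N"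
proof -
  have "(\<lambda>y. y) \<in> alg_hom A M N" by (subst M_eq) (simp add: NK_incl)
  moreover have "carrier M = K" "counit M = counit N" "antipode M = antipode N"
    by (subst M_eq, simp)+
  ultimately show ?thesis by (simp add: hopf_hom_def comult_M K_comult(3))
qed

end

theorem lemma5p6:
  fixes A :: "('a, 'm) ring_scheme"
  assumes "cring A"
  shows "hopf_algebra A (const_hopf A (sym_group 2))
    \<and> hopf_algebra A (idem_hopf A)
    \<and> (let H = idem_hopf A; HH = tensor A H H; t = tensor_elt A H H; z = idem_z A in
        comult H z =
          \<one>\<^bsub>HH\<^esub> \<oplus>\<^bsub>HH\<^esub> [(2::nat)] \<cdot>\<^bsub>HH\<^esub> t z z \<ominus>\<^bsub>HH\<^esub> t \<one>\<^bsub>H\<^esub> z \<ominus>\<^bsub>HH\<^esub> t z \<one>\<^bsub>H\<^esub>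
        \<and> antipode H z = z
        \<and> counit H z = \<one>\<^bsub>A\<^esub>)
    \<and> (\<exists>\<phi>. \<phi> \<in> hopf_iso A (const_hopf A (sym_group 2)) (idem_hopf A))
    \<and> hopf_algebra A (norm_mod_torus_hopf A)
    \<and> (\<lambda>x. x) \<in> hopf_hom A (norm_mod_torus_hopf A) (norm_hopf A)
    \<and> (\<exists>\<psi>. \<psi> \<in> hopf_iso A (norm_mod_torus_hopf A) (const_hopf A (sym_group 2)))"
proof -
  interpret gl2 A by (rule gl2.intro[OF assms])
  note c = const_split_hopf[OF assms sym_group_is_group sym_group_2]
  note i = idem_split_hopf[OF assms]
  interpret i: split_hopf A "idem_hopf A" "idem_z A" by (rule i)
  \<comment> \<open>The statement has z \<otimes> z where \<open>xnor\<close> has the product of z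
    \<otimes> 1 and 1 \<otimes> z.\<close>
  have "tensor_elt A (idem_hopf A) (idem_hopf A) (idem_z A) (idem_z A) =
    tensor_elt A (idem_hopf A) (idem_hopf A) (idem_z A) \<one>\<^bsub>idem_hopf A\<^esub> \<otimes>\<^bsub>tensor A (idem_hopf A) (idem_hopf A)\<^esub>
    tensor_elt A (idem_hopf A) (idem_hopf A) \<one>\<^bsub>idem_hopf A\<^esub> (idem_z A)"
    by (rule tensor_elt_split[OF i.algebra_axioms i.algebra_axioms]) simp_all
  then show ?thesis
    unfolding Let_def
    by (intro conjI split_hopf.hopf_algebra[OF c] split_hopf.hopf_algebra[OF i] i.antipode_z i.counit_z
        split_hopf_iso[OF c i] split_hopf.hopf_algebra[OF M_split_hopf] M_incl split_hopf_iso[OF M_split_hopf c])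
       (simp add: i.comult_z xnor_def)
qed

end
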